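(* Let $f\in H=\prod_{j=1}^n L^2(N_j)$ vanish almost everywhere outside a compact set $B\subset N$ and let $-\infty<a<b<+\infty$. Then for all $x\in N$ $$\bigl(E(a,b)f\bigr)(x)=\int_a^b\sum_{l=1}^n q_l(\lambda)\,F_\lambda^{-,l}(x)\int_N\overline{F_\lambda^{-,l}}(x')\,f(x')\,dx'\,d\lambda ,$$ where $$q_l(\lambda):=\begin{cases}0,&\text{if }\lambda<a_l,\\[2pt] \dfrac{c_l\,\xi_l(\lambda)}{|w(\lambda)|^2},&\text{if }a_l<\lambda.\end{cases}$$ Furthermore, for almost all $\lambda\in\mathbb R$ the matrix $q_{lm}(\lambda)=\delta_{lm}\,\mathbf 1_{(a_l,+\infty)}(\lambda)\,\dfrac{c_l\,\xi_l(\lambda)}{|w(\lambda)|^2}$ is the unique matrix satisfying $$\bigl(E(a,b)f\bigr)(x)=\int_a^b\sum_{l,m=1}^n q_{lm}(\lambda)\,F_\lambda^{-,l}(x)\int_N\overline{F_\lambda^{-,m}}(x')\,f(x')\,dx'\,d\lambda$$ (as a representation of the resolution of the identity, i.e. for all such $a,b$, $f$ and $x$).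
   Context: Let $n\ge 2$, $c_1,\dots,c_n>0$ and $0\le a_1\le a_2\le\dots\le a_n<+\infty$. Let $N_1,\dots,N_n$ be $n$ disjoint copies of $(0,+\infty)$ and let $N=\bigcup_{k=1}^n\overline{N_k}$ with the endpoints $0$ of all branches identified (star-shaped network). A function $f$ on $N$ is identified with the tuple $(f_1,\dots,f_n)$ of its restrictions to the branches, and $\int_N$ denotes the sum of the integrals over the $N_k$, $k=1,\dots,n$. Transmission conditions for $(u_k)_{k=1}^n$: $(T_0)$: $u_k\in C^0(\overline{N_k})$ and $u_i(0)=u_k(0)$ for all $i,k$; $(T_1)$: $u_k\in C^1(\overline{N_k})$ and $\sum_{k=1}^n c_k u_k'(0^+)=0$. $H=\prod_{k=1}^n L^2(N_k)$ (complex-valued functions) with $(u,v)_H=\sum_k(u_k,v_k)_{L^2(N_k)}$. The operator $A:D(A)\to H$ is $A(u_k)_k=(-c_k u_k''+a_k u_k)_k$ with $D(A)=\{(u_k)\in\prod_k H^2(N_k): (T_0)\text{ and }(T_1)\text{ hold}\}$. It is self-adjoint; $E(a,b)=\mathbf 1_{(a,b)}(A)$ denotes its resolution of the identity. The complex square root is $\sqrt{re^{i\phi}}=\sqrt r\,e^{i\phi/2}$ for $r>0$, $\phi\in[-\pi,\pi)$. For $\lambda\in\mathbb C$: $\xi_k(\lambda)=\sqrt{(\lambda-a_k)/c_k}$, $s_k(\lambda)=-\dfrac{\sum_{l\ne k}c_l\xi_l(\lambda)}{c_k\xi_k(\lambda)}$. The functions $F_\lambda^{-,j}:N\to\mathbb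 C$ are given on $\overline{N_k}$ by $F_{\lambda,k}^{-,j}$, where $F_{\lambda,j}^{-,j}(x)=\cos(\xi_j(\lambda)x)-i\,s_j(\lambda)\sin(\xi_j(\lambda)x)$ and $F_{\lambda,k}^{-,j}(x)=\exp(-i\xi_k(\lambda)x)$ for $k\ne j$. For real $\lambda$, $w(\lambda)=-i\sum_{j=1}^n c_j\xi_j(\lambda)$.
   Formalization: A factor 1/π is inserted in front of the integrand in both representation formulas: as printed they are false (for n=2, c_1=c_2=1, a_1=a_2=0 the right-hand side tends to πf instead of f as the interval grows to the whole line). *)

theory Defs
  imports "HOL-Analysis.Analysis"
begin

section \<open>The Hilbert space of the star-shaped network\<close>

text \<open>
  The value at the point \<open>x\<close> of the \<open>k\<close>-th branch is \<open>f k x\<close>, for \<open>k \<in> {1..n}\<close> and \<open>x > 0\<close>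
  (\<open>x \<ge> 0\<close> on the closed branch).  Elements of \<open>H\<close> are handled through representatives: equality in
  \<open>H\<close> is \<open>star_eq\<close>, and values at other arguments are irrelevant.
\<close>

type_synonym star_fun = "nat \<Rightarrow> real \<Rightarrow> complex"

definition L2_half :: "(real \<Rightarrow> complex) set" where
  "L2_half = {f \<in> borel_measurable (lebesgue_on {0<..}).
                integrable (lebesgue_on {0<..}) (\<lambda>x. (cmod (f x))\<^sup>2)}"

definition L2_star :: "nat \<Rightarrow> star_fun set" where
  "L2_star n = {f. \<forall>k\<in>{1..n}. f k \<in> L2_half}"

definition star_eq :: "nat \<Rightarrow> star_fun \<Rightarrow> star_fun \<Rightarrow> bool" where
  "star_eq n u v \<longleftrightarrow> (\<forall>k\<in>{1..n}. AE x in lebesgue_on {0<..}. u k x = v k x)"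

definition star_integral :: "nat \<Rightarrow> star_fun \<Rightarrow> complex" where
  "star_integral n f = (\<Sum>k=1..n. integral\<^sup>L (lebesgue_on {0<..}) (f k))"

definition star_inner :: "nat \<Rightarrow> star_fun \<Rightarrow> star_fun \<Rightarrow> complex" where
  "star_inner n u v = star_integral n (\<lambda>k x. u k x * cnj (v k x))"

text \<open>
  A compact subset of the network, given by its traces on the closed branches; as the endpoints
  \<open>0\<close> are identified, they belong to all traces or to none.
\<close>

definition compact_star :: "nat \<Rightarrow> (nat \<Rightarrow> real set) \<Rightarrow> bool" where
  "compact_star n B \<longleftrightarrow> (\<forall>k\<in>{1..n}. compact (B k) \<and> B k \<subseteq> {0..}) \<and>
     (\<forall>i\<in>{1..n}. \<forall>k\<in>{1..n}. 0 \<in> B i \<longleftrightarrow> 0 \<in> B k)"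

definition vanishes_outside :: "nat \<Rightarrow> star_fun \<Rightarrow> (nat \<Rightarrow> real set) \<Rightarrow> bool" where
  "vanishes_outside n f B \<longleftrightarrow>
     (\<forall>k\<in>{1..n}. AE x in lebesgue_on {0<..}. x \<notin> B k \<longrightarrow> f k x = 0)"


section \<open>Sobolev functions and the operator\<close>

definition test_fun :: "(real \<Rightarrow> real) \<Rightarrow> bool" where
  "test_fun \<phi> \<longleftrightarrow> (\<forall>m x. (deriv ^^ m) \<phi> field_differentiable at x) \<and>
     (\<exists>K. compact K \<and> K \<subseteq> {0<..} \<and> (\<forall>x. x \<notin> K \<longrightarrow> \<phi> x = 0))"

definition weak_deriv :: "nat \<Rightarrow> (real \<Rightarrow> complex) \<Rightarrow> (real \<Rightarrow> complex) \<Rightarrow> bool" where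
  "weak_deriv m u v \<longleftrightarrow> (\<forall>\<phi>. test_fun \<phi> \<longrightarrow>
     (LINT x|lebesgue_on {0<..}. u x * of_real ((deriv ^^ m) \<phi> x)) =
     (- 1) ^ m * (LINT x|lebesgue_on {0<..}. v x * of_real (\<phi> x)))"

definition H2_half :: "(real \<Rightarrow> complex) set" where
  "H2_half = {u \<in> L2_half. \<forall>m\<in>{1,2}. \<exists>v\<in>L2_half. weak_deriv m u v}"

definition weak_deriv2 :: "(real \<Rightarrow> complex) \<Rightarrow> real \<Rightarrow> complex" where
  "weak_deriv2 u = (SOME v. v \<in> L2_half \<and> weak_deriv 2 u v)"

definition T0 :: "nat \<Rightarrow> star_fun \<Rightarrow> bool" where
  "T0 n u \<longleftrightarrow> (\<forall>k\<in>{1..n}. continuous_on {0..} (u k)) \<and>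
     (\<forall>i\<in>{1..n}. \<forall>k\<in>{1..n}. u i 0 = u k 0)"

definition T1 :: "nat \<Rightarrow> (nat \<Rightarrow> real) \<Rightarrow> star_fun \<Rightarrow> bool" where
  "T1 n c u \<longleftrightarrow> (\<exists>u'. (\<forall>k\<in>{1..n}. continuous_on {0..} (u' k) \<and>
        (\<forall>x\<ge>0. (u k has_vector_derivative u' k x) (at x within {0..}))) \<and>
      (\<Sum>k=1..n. of_real (c k) * u' k 0) = 0)"

text \<open>The transmission conditions are imposed on the (unique) continuous representative.\<close>

definition star_domain :: "nat \<Rightarrow> (nat \<Rightarrow> real) \<Rightarrow> star_fun set" where
  "star_domain n c = {u. (\<forall>k\<in>{1..n}. u k \<in> H2_half) \<and>
     (\<exists>g. star_eq n g u \<and> T0 n g \<and> T1 n c g)}"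

definition star_op :: "nat \<Rightarrow> (nat \<Rightarrow> real) \<Rightarrow> (nat \<Rightarrow> real) \<Rightarrow> star_fun \<Rightarrow> star_fun" where
  "star_op n c a u =
     (\<lambda>k x. - of_real (c k) * weak_deriv2 (u k) x + of_real (a k) * u k x)"


section \<open>Resolution of the identity\<close>

definition projection_valued_measure ::
    "nat \<Rightarrow> (real set \<Rightarrow> star_fun \<Rightarrow> star_fun) \<Rightarrow> bool" where
  "projection_valued_measure n E \<longleftrightarrow>
     (\<forall>S\<in>sets borel. \<forall>u\<in>L2_star n. E S u \<in> L2_star n) \<and>
     (\<forall>S\<in>sets borel. \<forall>u\<in>L2_star n. \<forall>v\<in>L2_star n.
        star_eq n u v \<longrightarrow> star_eq n (E S u) (E S v)) \<and>
     (\<forall>S\<in>sets borel. \<forall>u\<in>L2_star n. \<forall>v\<in>L2_star n. \<forall>z w.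
        star_eq n (E S (\<lambda>k x. z * u k x + w * v k x)) (\<lambda>k x. z * E S u k x + w * E S v k x)) \<and>
     (\<forall>S\<in>sets borel. \<forall>u\<in>L2_star n. \<forall>v\<in>L2_star n.
        star_inner n (E S u) v = star_inner n u (E S v)) \<and>
     (\<forall>u\<in>L2_star n. star_eq n (E {} u) (\<lambda>k x. 0) \<and> star_eq n (E UNIV u) u) \<and>
     (\<forall>S\<in>sets borel. \<forall>T\<in>sets borel. \<forall>u\<in>L2_star n.
        star_eq n (E (S \<inter> T) u) (E S (E T u))) \<and>
     (\<forall>T :: nat \<Rightarrow> real set. range T \<subseteq> sets borel \<longrightarrow> disjoint_family T \<longrightarrow>
        (\<forall>u\<in>L2_star n. \<forall>v\<in>L2_star n.
          (\<lambda>i. star_inner n (E (T i) u) v) sums star_inner n (E (\<Union>i. T i) u) v))"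

definition spectral_distr ::
    "nat \<Rightarrow> (real set \<Rightarrow> star_fun \<Rightarrow> star_fun) \<Rightarrow> star_fun \<Rightarrow> real measure" where
  "spectral_distr n E u =
     measure_of UNIV (sets borel) (\<lambda>S. ennreal (Re (star_inner n (E S u) u)))"

text \<open>
  \<open>E\<close> is the resolution of the identity of the operator \<open>A\<close> with domain \<open>D\<close>, i.e. \<open>A = \<integral>\<lambda> dE(\<lambda>)\<close>
  and \<open>E S\<close> is the spectral projection \<open>1\<^sub>S(A)\<close>.  The identity for \<open>(Au, v)\<close> follows from the one for
  \<open>(Au, u)\<close> by polarization.  By the spectral theorem such an \<open>E\<close> exists, and is unique up to
  equality in \<open>H\<close>, exactly when \<open>A\<close> is self-adjoint.
\<close>

definition resolution_of_identity ::
    "nat \<Rightarrow> star_fun set \<Rightarrow> (star_fun \<Rightarrow> star_fun) \<Rightarrow>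
     (real set \<Rightarrow> star_fun \<Rightarrow> star_fun) \<Rightarrow> bool" where
  "resolution_of_identity n D A E \<longleftrightarrow>
     projection_valued_measure n E \<and>
     D = {u \<in> L2_star n. (\<integral>\<^sup>+ t. ennreal (t\<^sup>2) \<partial>spectral_distr n E u) < \<infinity>} \<and>
     (\<forall>u\<in>D. star_inner n (A u) u = of_real (LINT t|spectral_distr n E u. t))"


section \<open>Generalized eigenfunctions\<close>

text \<open>The branch of the square root with argument in \<open>[-\<pi>, \<pi>)\<close>; \<open>Arg\<close> takes values in \<open>(-\<pi>, \<pi>]\<close>.\<close>

definition csqrt_low :: "complex \<Rightarrow> complex" where
  "csqrt_low z = rcis (sqrt (cmod z)) ((if Arg z = pi then - pi else Arg z) / 2)"

definition xi :: "(nat \<Rightarrow> real) \<Rightarrow> (nat \<Rightarrow> real) \<Rightarrow> nat \<Rightarrow> complex \<Rightarrow> complex" where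
  "xi c a k z = csqrt_low ((z - of_real (a k)) / of_real (c k))"

definition s_coeff ::
    "nat \<Rightarrow> (nat \<Rightarrow> real) \<Rightarrow> (nat \<Rightarrow> real) \<Rightarrow> nat \<Rightarrow> complex \<Rightarrow> complex" where
  "s_coeff n c a k z =
     - (\<Sum>l\<in>{1..n} - {k}. of_real (c l) * xi c a l z) / (of_real (c k) * xi c a k z)"

definition F_minus ::
    "nat \<Rightarrow> (nat \<Rightarrow> real) \<Rightarrow> (nat \<Rightarrow> real) \<Rightarrow> nat \<Rightarrow> complex \<Rightarrow> star_fun" where
  "F_minus n c a j z = (\<lambda>k x.
     if k = j
     then cos (xi c a j z * of_real x) - \<i> * s_coeff n c a j z * sin (xi c a j z * of_real x)
     else exp (- \<i> * xi c a k z * of_real x))"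

definition w_coeff :: "nat \<Rightarrow> (nat \<Rightarrow> real) \<Rightarrow> (nat \<Rightarrow> real) \<Rightarrow> real \<Rightarrow> complex" where
  "w_coeff n c a t = - \<i> * (\<Sum>j=1..n. of_real (c j) * xi c a j (of_real t))"

definition q_coeff :: "nat \<Rightarrow> (nat \<Rightarrow> real) \<Rightarrow> (nat \<Rightarrow> real) \<Rightarrow> nat \<Rightarrow> real \<Rightarrow> complex" where
  "q_coeff n c a l t =
     (if a l < t then of_real (c l) * xi c a l (of_real t) / of_real ((cmod (w_coeff n c a t))\<^sup>2)
      else 0)"


section \<open>Spectral representations\<close>

text \<open>
  Pointwise identity \<open>u(x) = \<integral>\<^bsub>(\<alpha>, \<beta>)\<^esub> \<Phi>(t, x) dt\<close> at every point \<open>x\<close> of the network, for \<open>u\<close> in \<open>H\<close>: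
  \<open>u\<close> has a continuous representative (necessarily unique), whose value at each point is the
  absolutely convergent integral.
\<close>

definition pointwise_integral ::
    "nat \<Rightarrow> star_fun \<Rightarrow> real \<Rightarrow> real \<Rightarrow> (real \<Rightarrow> star_fun) \<Rightarrow> bool" where
  "pointwise_integral n u \<alpha> \<beta> \<Phi> \<longleftrightarrow> (\<exists>g. T0 n g \<and> star_eq n g u \<and>
     (\<forall>k\<in>{1..n}. \<forall>x\<ge>0.
        has_bochner_integral (lebesgue_on {\<alpha><..<\<beta>}) (\<lambda>t. \<Phi> t k x) (g k x)))"

text \<open>
  The factor \<open>1/\<pi>\<close> is the constant of Stone's formula; it is missing in the source, where the
  integral is taken against \<open>d\<lambda>\<close>.  It cannot be omitted: for \<open>n = 2\<close>, \<open>c\<^sub>1 = c\<^sub>2 = 1\<close>, \<open>a\<^sub>1 = a\<^sub>2 = 0\<close>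
  the operator is \<open>-d\<^sup>2/dx\<^sup>2\<close> on the line, the sum of \<open>q\<^sub>l(\<lambda>) F\<^sub>l(x) cnj (F\<^sub>l(y))\<close> over \<open>l\<close> is
  \<open>cos(\<surd>\<lambda> (x - y)) / (2\<surd>\<lambda>)\<close> in the coordinate of the line, and its integral over
  \<open>\<lambda> > 0\<close> is \<open>\<pi>\<close> times the delta distribution.
\<close>

definition represents_resolution ::
    "nat \<Rightarrow> (nat \<Rightarrow> real) \<Rightarrow> (nat \<Rightarrow> real) \<Rightarrow> (real set \<Rightarrow> star_fun \<Rightarrow> star_fun) \<Rightarrow>
     (real \<Rightarrow> nat \<Rightarrow> nat \<Rightarrow> complex) \<Rightarrow> bool" where
  "represents_resolution n c a E Q \<longleftrightarrow>
     (\<forall>f B \<alpha> \<beta>. f \<in> L2_star n \<longrightarrow> compact_star n B \<longrightarrow> vanishes_outside n f B \<longrightarrow> \<alpha> < \<beta> \<longrightarrow>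
        pointwise_integral n (E {\<alpha><..<\<beta>} f) \<alpha> \<beta> (\<lambda>t k x.
          of_real (1 / pi) * (\<Sum>l=1..n. \<Sum>m=1..n. Q t l m * F_minus n c a l (of_real t) k x *
            star_integral n (\<lambda>j y. cnj (F_minus n c a m (of_real t) j y) * f j y))))"

end

theory Submission
  imports Defs
begin

text \<open>
  The proof is Stone's formula.  The abstract part is the identity
  \<open>d\<mu>\<^sub>f = \<bar>t - z\<bar>\<^sup>2 d\<mu>\<^sub>u\<close> for the spectral measures of \<open>u\<close> in the domain and \<open>f = (A - z) u\<close>; it
  follows from the quadratic form of \<open>A\<close> alone, by polarization.  Hence \<open>Im (f, u)\<close> is the Poisson
  integral of \<open>\<mu>\<^sub>f\<close>.  On the other hand the resolvent \<open>u\<close> of a continuous \<open>f\<close> with bounded support is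
  explicit at \<open>z = s - i\<epsilon>\<close>, in terms of \<open>\<kappa>\<^sub>k = i \<xi>\<^sub>k\<close>: on every branch it is a Dirichlet solution plus
  a multiple of \<open>exp (- \<kappa>\<^sub>k x)\<close>, and the transmission conditions fix the common value at the vertex as
  \<open>(\<Sum>\<^sub>k \<integral> exp (- \<kappa>\<^sub>k y) f\<^sub>k(y) dy) / \<Sum>\<^sub>k c\<^sub>k \<kappa>\<^sub>k\<close>.  As \<open>\<epsilon>\<close> tends to \<open>0\<close>, domination by
  \<open>\<bar>s - a\<^sub>1\<bar>\<close> to the power \<open>-1/2\<close> gives the spectral density, and the imaginary part of the limiting
  kernel is \<open>\<Sum>\<^sub>l q\<^sub>l F\<^sub>l(x) cnj (F\<^sub>l(y))\<close>.

  For uniqueness, two representing matrices are compared on countably many step functions and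
  points; away from the thresholds \<open>a\<^sub>k\<close> the \<open>F\<^sub>l\<close> are linearly independent, so the matrices agree.
\<close>

subsection \<open>Smooth bump functions and the fundamental lemma\<close>

text \<open>Two features of the definitions shape the argument. First,
  \<open>resolution_of_identity\<close> only says that (A u, u) is the first moment of the spectral
  measure of u, so even the commutation of A with E(S) has to be recovered: (A E(S) u, v) and (A u,
  E(S) v) agree because the measures obtained by polarizing them agree. The norm of E(S) A u is
  computed for bounded S, where this vector is again in the domain. Second, the limit \<epsilon> ->
  0 runs over a real interval that may contain thresholds a_k. In the lower half plane all
  \<kappa>_k lie in the closed first quadrant, so the terms of \<Sum> c_k \<kappa>_k cannot cancel;
  this single estimate gives nonvanishing, the integrable majorant and the integrability of q_l.
  Writing Dirichlet solutions as sinh(\<kappa> x)/\<kappa>, extended by x at \<kappa> = 0, keeps all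
  other factors continuous across the thresholds. The limit counts the endpoints of the interval
  with half of their mass; the absence of atoms is then read off from the limit formula
  itself.\<close>

lemma sigma_finite_lebesgue: "sigma_finite_measure (lebesgue :: 'a::euclidean_space measure)"
proof
  show "\<exists>A. countable A \<and> A \<subseteq> sets lebesgue \<and> \<Union>A = space (lebesgue :: 'a measure) \<and>
      (\<forall>a\<in>A. emeasure lebesgue a \<noteq> \<infinity>)"
  proof (intro exI conjI ballI)
    show "countable (range (\<lambda>n::nat. cball (0::'a) (real n)))" by simp
    show "range (\<lambda>n::nat. cball (0::'a) (real n)) \<subseteq> sets lebesgue" by auto
    show "\<Union>(range (\<lambda>n::nat. cball (0::'a) (real n))) = space lebesgue"
      by (auto simp: real_arch_simple)
    fix a assume "a \<in> range (\<lambda>n::nat. cball (0::'a) (real n))"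
    then show "emeasure lebesgue a \<noteq> \<infinity>"
      using emeasure_bounded_finite[of a] by (auto simp: top.not_eq_extremum)
  qed
qed

lemma sigma_finite_lebesgue_on:
  "S \<in> sets lebesgue \<Longrightarrow> sigma_finite_measure (lebesgue_on S)"
  by (simp add: sigma_finite_lebesgue sigma_finite_measure_restrict_space)

lemma borel_eq_Ioo: "borel = sigma UNIV (range (\<lambda>(a::real, b::real). {a<..<b}))"
  using borel_eq_box[where 'a=real] by (simp add: box_real)

text \<open>Open intervals are an intersection-stable generator of the Borel sets, so the vanishing
  spreads by induction over complements and disjoint unions; Lebesgue sets differ from Borel sets by
  null sets. The complement step needs the integral over the whole line, obtained by exhaustion with
  (-k, k).\<close>

lemma AE_zero_if_interval_integrals_zero:
  fixes v :: "real \<Rightarrow> complex"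
  assumes v: "integrable lebesgue v"
    and zero: "\<And>r s. r < s \<Longrightarrow> (LINT x:{r<..<s}|lebesgue. v x) = 0"
  shows "AE x in lebesgue. v x = 0"
proof -
  interpret sigma_finite_measure "lebesgue :: real measure" by (rule sigma_finite_lebesgue)
  have vi: "set_integrable lebesgue A v" if "A \<in> sets lebesgue" for A
    using v that unfolding set_integrable_def by (rule integrable_mult_indicator[rotated])
  have un: "(LINT x:(\<Union>i. F i)|lebesgue. v x) = 0"
    if "\<And>i::nat. F i \<in> sets lebesgue" "disjoint_family F" "\<And>i. (LINT x:F i|lebesgue. v x) = 0" for F
    using that lebesgue_integral_countable_add[of F lebesgue v]
    by (simp add: vi sets.countable_UN disjoint_family_on_def)
  have UNIV0: "(LINT x:UNIV|lebesgue. v x) = 0"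
  proof -
    have "((\<lambda>k. LINT x:{- real k<..<real k}|lebesgue. v x) \<longlongrightarrow> (LINT x:(\<Union>k. {- real k<..<real k})|lebesgue. v x)) sequentially"
      by (rule set_integral_cont_up) (auto simp: incseq_def intro!: vi)
    moreover have "(\<Union>k. {- real k<..<real k}) = UNIV"
      by (auto, metis abs_less_iff minus_less_iff reals_Archimedean2)
    \<comment> \<open>For \<open>k = 0\<close> the interval is empty and \<open>zero\<close> does
      not apply.\<close>
    moreover have "(LINT x:{- real k<..<real k}|lebesgue. v x) = 0" for k
      using zero[of "- real k" "real k"] by (cases "k = 0") (auto simp: set_lebesgue_integral_def)
    ultimately show ?thesis
      by (simp add: LIMSEQ_const_iff)
  qed
  have bor: "(LINT x:A|lebesgue. v x) = 0" if "A \<in> sets borel" for A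
  proof -
    let ?G = "range (\<lambda>(a::real, b::real). {a<..<b})"
    have "Int_stable ?G"
      by (force simp: Int_stable_def greaterThanLessThan_eq[symmetric] intro!: range_eqI[where x="(max _ _, min _ _)"])
    moreover have "?G \<subseteq> Pow UNIV" by simp
    moreover have "A \<in> sigma_sets UNIV ?G"
      using that by (simp add: borel_eq_Ioo)
    ultimately show ?thesis
    proof (induct rule: sigma_sets_induct_disjoint)
      fix A assume "A \<in> ?G" then show "(LINT x:A|lebesgue. v x) = 0"
        using zero by (force simp: set_lebesgue_integral_def)
    next
      show "(LINT x:{}|lebesgue. v x) = 0" by (simp add: set_lebesgue_integral_def)
    next
      fix A assume A: "A \<in> sigma_sets UNIV ?G" "(LINT x:A|lebesgue. v x) = 0"
      then have m: "A \<in> sets borel" by (simp add: borel_eq_Ioo)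
      have "(LINT x:A \<union> (UNIV - A)|lebesgue. v x) = (LINT x:A|lebesgue. v x) + (LINT x:UNIV - A|lebesgue. v x)"
        using m by (intro set_integral_Un vi) auto
      then show "(LINT x:UNIV - A|lebesgue. v x) = 0" using A UNIV0 by (simp add: Un_absorb1)
    next
      fix F :: "nat \<Rightarrow> real set" assume F: "disjoint_family F" "range F \<subseteq> sigma_sets UNIV ?G"
        "\<And>i. (LINT x:F i|lebesgue. v x) = 0"
      then have "F i \<in> sets borel" for i by (auto simp: borel_eq_Ioo)
      then have "F i \<in> sets lebesgue" for i by simp
      then show "(LINT x:(\<Union>i. F i)|lebesgue. v x) = 0" using F by (intro un) auto
    qed
  qed
  show ?thesis
  proof (rule density_zero[OF v])
    fix A :: "real set" assume A: "A \<in> sets lebesgue"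
    obtain S N N' where *: "A = S \<union> N" "N \<subseteq> N'" "N' \<in> null_sets lborel" "S \<in> sets lborel"
      using sets_completionE[OF A] by blast
    have "N \<in> null_sets lebesgue" using * by (metis null_sets_completion null_sets_completion_subset null_sets_completionI)
    then have "AE x in lebesgue. x \<notin> N" by (rule AE_not_in)
    then have "(LINT x:A|lebesgue. v x) = (LINT x:S|lebesgue. v x)"
      using A * borel_measurable_integrable[OF vi[of A, unfolded set_integrable_def]]
        borel_measurable_integrable[OF vi[of S, unfolded set_integrable_def]]
      by (intro set_integral_cong_set) (auto simp: set_borel_measurable_def)
    then show "(LINT x:A|lebesgue. v x) = 0" using bor * by simp
  qed
qed

text \<open>The powers of 1/x are carried along because differentiating exp(-1/x) produces them: the
  linear combinations of this family are closed under derivatives.\<close>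

definition flat_exp :: "nat \<Rightarrow> real \<Rightarrow> real" where
  "flat_exp i x = (if x > 0 then exp (- inverse x) * inverse x ^ i else 0)"

text \<open>A single term of the exponential series at y = 1/x gives y^(i+m) \<le> (i+m)! e^y. The
  free exponent m expresses flatness of every order at 0; the derivative at 0 uses m = 2.\<close>

lemma flat_exp_le: "\<bar>flat_exp i x\<bar> \<le> fact (i + m) * \<bar>x\<bar> ^ m"
proof (cases "x > 0")
  case True
  let ?y = "inverse x"
  have "?y ^ (i+m) / fact (i+m) \<le> exp ?y"
  proof -
    have "(\<Sum>k\<in>{i+m}. ?y ^ k /\<^sub>R fact k) \<le> (\<Sum>k. ?y ^ k /\<^sub>R fact k)"
      using True by (intro sum_le_suminf summable_exp_generic) auto
    then show ?thesis by (simp add: exp_def divide_inverse mult.commute)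
  qed
  then have "?y ^ (i+m) \<le> exp ?y * fact (i+m)"
    by (simp only: pos_divide_le_eq fact_gt_zero)
  then have "exp (- ?y) * ?y ^ (i+m) \<le> exp (- ?y) * (exp ?y * fact (i+m))"
    by (intro mult_left_mono) auto
  also have "\<dots> = fact (i+m)"
    by (simp only: mult.assoc[symmetric] exp_add[symmetric]) simp
  finally have "exp (- ?y) * ?y ^ (i+m) \<le> fact (i+m)" .
  then have "(exp (- ?y) * ?y ^ (i+m)) * x ^ m \<le> fact (i+m) * x ^ m"
    using True by (intro mult_right_mono) auto
  moreover have "(exp (- ?y) * ?y ^ (i+m)) * x ^ m = exp (- ?y) * ?y ^ i"
    using True by (simp add: power_add power_inverse)
  ultimately show ?thesis using True by (simp add: flat_exp_def)
qed (auto simp: flat_exp_def)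

lemma has_real_derivative_flat_exp:
  "(flat_exp i has_real_derivative (flat_exp (i+2) x - i * flat_exp (i+1) x)) (at x)"
proof -
  consider "x > 0" | "x < 0" | "x = 0" by linarith
  then show ?thesis
  proof cases
    case 1
    let ?y = "inverse x"
    have "((\<lambda>x. exp (- inverse x)) has_real_derivative exp (- ?y) * ?y\<^sup>2) (at x)"
      using 1 by (auto intro!: derivative_eq_intros simp: power2_eq_square)
    moreover have "((\<lambda>x. inverse x ^ i) has_real_derivative real i * ?y ^ (i - 1) * - ?y\<^sup>2) (at x)"
      using 1 by (auto intro!: derivative_eq_intros simp: power2_eq_square)
    ultimately have "((\<lambda>x. exp (- inverse x) * inverse x ^ i) has_real_derivative
        exp (- ?y) * ?y\<^sup>2 * ?y ^ i + real i * ?y ^ (i - 1) * - ?y\<^sup>2 * exp (- ?y)) (at x)"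
      by (rule DERIV_mult)
    moreover have "exp (- ?y) * ?y\<^sup>2 * ?y ^ i + real i * ?y ^ (i - 1) * - ?y\<^sup>2 * exp (- ?y)
        = flat_exp (i+2) x - i * flat_exp (i+1) x"
      using 1 by (cases i) (simp_all add: flat_exp_def power2_eq_square algebra_simps)
    ultimately have "((\<lambda>x. exp (- inverse x) * inverse x ^ i) has_real_derivative
        (flat_exp (i+2) x - i * flat_exp (i+1) x)) (at x)"
      by simp
    then show ?thesis
      by (rule has_field_derivative_transform_within_open[where S="{0<..}"])
         (use 1 in \<open>auto simp: flat_exp_def\<close>)
  next
    case 2
    have "((\<lambda>x. 0) has_real_derivative (flat_exp (i+2) x - i * flat_exp (i+1) x)) (at x)"
      using 2 by (simp add: flat_exp_def)
    then show ?thesis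
      by (rule has_field_derivative_transform_within_open[where S="{..<0}"])
         (use 2 in \<open>auto simp: flat_exp_def\<close>)
  next
    case 3
    have "(\<lambda>h. (flat_exp i h - flat_exp i 0) / h) \<midarrow>0\<rightarrow> 0"
    proof (rule Lim_null_comparison)
      show "\<forall>\<^sub>F h in at 0. norm ((flat_exp i h - flat_exp i 0) / h) \<le> fact (i+2) * \<bar>h\<bar>"
      proof (rule eventually_at_filter[THEN iffD2], rule always_eventually, intro allI impI)
        fix h :: real assume "h \<noteq> 0"
        have "norm ((flat_exp i h - flat_exp i 0) / h) = \<bar>flat_exp i h\<bar> / \<bar>h\<bar>"
          by (simp add: flat_exp_def)
        also have "\<dots> \<le> fact (i+2) * \<bar>h\<bar>^2 / \<bar>h\<bar>"
          by (intro divide_right_mono flat_exp_le) auto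
        also have "\<dots> = fact (i+2) * \<bar>h\<bar>" by (simp add: power2_eq_square del: abs_mult_self_eq power2_abs)
        finally show "norm ((flat_exp i h - flat_exp i 0) / h) \<le> fact (i+2) * \<bar>h\<bar>" .
      qed
      show "((\<lambda>h. fact (i+2) * \<bar>h\<bar>) \<longlongrightarrow> 0) (at (0::real))"
        by (rule tendsto_eq_intros refl)+ auto
    qed
    then show ?thesis using 3 by (simp add: DERIV_def flat_exp_def)
  qed
qed

text \<open>Sums of products of flat functions attached to the two ends of [r, s]. As
  \<open>deriv\<close> maps this set into itself, all iterated derivatives are handled at once. The
  factor k steepens the flanks, so that the basic bump tends to the indicator of (r, s).\<close>

inductive_set bump_space :: "real \<Rightarrow> real \<Rightarrow> real \<Rightarrow> (real \<Rightarrow> real) set" for k r s where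
  base: "(\<lambda>x. z * (flat_exp i (k * (x - r)) * flat_exp j (k * (s - x)))) \<in> bump_space k r s"
| add: "f \<in> bump_space k r s \<Longrightarrow> g \<in> bump_space k r s \<Longrightarrow> (\<lambda>x. f x + g x) \<in> bump_space k r s"

lemma bump_space_deriv:
  "f \<in> bump_space k r s \<Longrightarrow> \<exists>f'\<in>bump_space k r s. \<forall>x. (f has_real_derivative f' x) (at x)"
proof (induction rule: bump_space.induct)
  case (base z i j)
  let ?A = "\<lambda>i x. flat_exp i (k * (x - r))" and ?B = "\<lambda>j x. flat_exp j (k * (s - x))"
  let ?g = "\<lambda>x. ((z*k) * (?A (i+2) x * ?B j x) + (-z*k*i) * (?A (i+1) x * ?B j x))
      + ((-z*k) * (?A i x * ?B (j+2) x) + (z*k*j) * (?A i x * ?B (j+1) x))"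
  have A: "(?A i has_real_derivative (?A (i+2) x - i * ?A (i+1) x) * k) (at x)" for i x
  proof -
    have "((\<lambda>x. k * (x - r)) has_real_derivative k) (at x)" by (auto intro!: derivative_eq_intros)
    from DERIV_chain2[OF has_real_derivative_flat_exp this] show ?thesis by simp
  qed
  have B: "(?B j has_real_derivative (?B (j+2) x - j * ?B (j+1) x) * (-k)) (at x)" for j x
  proof -
    have "((\<lambda>x. k * (s - x)) has_real_derivative - k) (at x)" by (auto intro!: derivative_eq_intros)
    from DERIV_chain2[OF has_real_derivative_flat_exp this] show ?thesis by simp
  qed
  have "((\<lambda>x. z * (?A i x * ?B j x)) has_real_derivative ?g x) (at x)" for x
    by (rule derivative_eq_intros A B refl | simp)+ (simp add: algebra_simps)
  then show ?case
    by (intro bexI[of _ ?g] allI) (assumption, intro bump_space.intros)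
next
  case (add f g)
  then obtain f' g' where "f' \<in> bump_space k r s" "\<forall>x. (f has_real_derivative f' x) (at x)"
      "g' \<in> bump_space k r s" "\<forall>x. (g has_real_derivative g' x) (at x)" by blast
  then show ?case
    by (intro bexI[of _ "\<lambda>x. f' x + g' x"] bump_space.intros) (auto intro!: derivative_intros)
qed

lemma test_fun_bump:
  assumes "0 < r" "k > 0"
  shows "test_fun (\<lambda>x. flat_exp 0 (k * (x - r)) * flat_exp 0 (k * (s - x)))"
    (is "test_fun ?f")
proof -
  have "(\<lambda>x. 1 * ?f x) \<in> bump_space k r s" by (rule base)
  then have f: "?f \<in> bump_space k r s" by simp
  have D: "deriv g \<in> bump_space k r s" if g: "g \<in> bump_space k r s" for g
  proof -
    obtain h where "h \<in> bump_space k r s" "\<forall>x. (g has_real_derivative h x) (at x)"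
      using bump_space_deriv[OF g] by blast
    moreover from this have "deriv g = h" by (auto intro!: DERIV_imp_deriv)
    ultimately show ?thesis by simp
  qed
  have m: "(deriv ^^ m) ?f \<in> bump_space k r s" for m
    by (induction m) (use f D in auto)
  show ?thesis
    unfolding test_fun_def
  proof (intro conjI allI exI)
    show "(deriv ^^ m) ?f field_differentiable at x" for m x
      using bump_space_deriv[OF m[of m]] by (auto simp: field_differentiable_def)
    show "compact {r..s}" by simp
    show "{r..s} \<subseteq> {0<..}" using assms by auto
    show "x \<notin> {r..s} \<longrightarrow> ?f x = 0" for x
      using assms by (auto simp: flat_exp_def not_le zero_less_mult_iff)
  qed
qed

text \<open>Bumps with growing slope are bounded by 1 and tend to the indicator of (r, s). Dominated
  convergence turns the hypothesis on test functions into vanishing integrals over open intervals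
  away from 0, and the interval criterion applies on an exhaustion of the half line.\<close>

lemma fundamental_lemma:
  fixes v :: "real \<Rightarrow> complex"
  assumes v: "\<And>r s. 0 < r \<Longrightarrow> r < s \<Longrightarrow> set_integrable lebesgue {r..s} v"
    and zero: "\<And>\<phi>. test_fun \<phi> \<Longrightarrow> (LINT x|lebesgue_on {0<..}. v x * of_real (\<phi> x)) = 0"
  shows "AE x in lebesgue_on {0<..}. v x = 0"
proof -
  have int0: "(LINT x:{r<..<s}|lebesgue. v x) = 0" if rs: "0 < r" "r < s" for r s
  proof -
    define \<phi> where "\<phi> k x = flat_exp 0 (real (Suc k) * (x - r)) * flat_exp 0 (real (Suc k) * (s - x))" for k x
    have le1: "0 \<le> flat_exp 0 x \<and> flat_exp 0 x \<le> 1" for x by (simp add: flat_exp_def)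
    have out: "\<phi> k x = 0" if "x \<notin> {r<..<s}" for k x
      using that by (auto simp: \<phi>_def flat_exp_def not_le zero_less_mult_iff not_less)
    have abs: "\<bar>\<phi> k x\<bar> \<le> 1" for k x
      unfolding \<phi>_def using le1 by (auto simp: abs_mult intro!: mult_le_one)
    have cont: "continuous_on UNIV (flat_exp 0)"
      using has_real_derivative_flat_exp by (intro DERIV_continuous_on) (auto intro: DERIV_subset)
    have "continuous_on UNIV (\<phi> k)" for k
      unfolding \<phi>_def by (intro continuous_intros continuous_on_compose2[OF cont]) auto
    then have bm: "\<phi> k \<in> borel_measurable borel" for k
      by (rule borel_measurable_continuous_onI)
    have "((\<lambda>k. LINT x:{r..s}|lebesgue. v x * of_real (\<phi> k x)) \<longlongrightarrow> (LINT x:{r..s}|lebesgue. v x * indicator {r<..<s} x)) sequentially"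
      unfolding set_lebesgue_integral_def
    proof (rule integral_dominated_convergence[where w="\<lambda>x. indicator {r..s} x *\<^sub>R norm (v x)"])
      have vm: "(\<lambda>x. indicator {r..s} x *\<^sub>R v x) \<in> borel_measurable lebesgue"
        using v[OF rs] unfolding set_integrable_def by (rule borel_measurable_integrable)
      have "(\<lambda>x. (indicator {r..s} x *\<^sub>R v x) * g x) \<in> borel_measurable lebesgue"
        if "g \<in> borel_measurable borel" for g :: "real \<Rightarrow> complex"
        using borel_measurable_times[OF vm measurable_completion[of g lborel borel]] that by simp
      note * = this
      show "(\<lambda>x. indicator {r..s} x *\<^sub>R (v x * indicator {r<..<s} x)) \<in> borel_measurable lebesgue"
        using *[of "indicator {r<..<s}"] by simp
      show "(\<lambda>x. indicator {r..s} x *\<^sub>R (v x * of_real (\<phi> k x))) \<in> borel_measurable lebesgue" for k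
        using *[of "\<lambda>x. of_real (\<phi> k x)"] bm by simp
      show "integrable lebesgue (\<lambda>x. indicator {r..s} x *\<^sub>R norm (v x))"
        using integrable_norm[OF v[OF rs, unfolded set_integrable_def]] by simp
      show "AE x in lebesgue. norm (indicator {r..s} x *\<^sub>R (v x * of_real (\<phi> k x))) \<le> indicator {r..s} x *\<^sub>R norm (v x)" for k
        using abs by (auto simp: norm_mult indicator_def intro!: mult_left_le)
      have "(\<lambda>k. \<phi> k x) \<longlonglongrightarrow> 1" if "x \<in> {r<..<s}" for x
      proof -
        have "(\<lambda>k. exp (- inverse (real (Suc k) * y))) \<longlonglongrightarrow> 1" if "y > 0" for y :: real
        proof -
          have "(\<lambda>k. exp (-(inverse (real (Suc k)) * inverse y))) \<longlonglongrightarrow> exp (-(0 * inverse y))"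
            by (intro tendsto_intros LIMSEQ_inverse_real_of_nat)
          then show ?thesis by (simp only: inverse_mult_distrib) simp
        qed
        then have "(\<lambda>k. exp (- inverse (real (Suc k) * (x - r))) * exp (- inverse (real (Suc k) * (s - x)))) \<longlonglongrightarrow> 1 * 1"
          using that by (intro tendsto_mult) auto
        then show ?thesis using that by (simp add: \<phi>_def flat_exp_def)
      qed
      then show "AE x in lebesgue. (\<lambda>k. indicator {r..s} x *\<^sub>R (v x * of_real (\<phi> k x))) \<longlonglongrightarrow> indicator {r..s} x *\<^sub>R (v x * indicator {r<..<s} x)"
        using out by (intro AE_I2) (force simp: indicator_def intro!: tendsto_eq_intros)
    qed
    moreover have "(LINT x:{r..s}|lebesgue. v x * of_real (\<phi> k x)) = 0" for k
    proof -
      have "(LINT x:{r..s}|lebesgue. v x * of_real (\<phi> k x)) = (LINT x:{0<..}|lebesgue. v x * of_real (\<phi> k x))"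
        unfolding set_lebesgue_integral_def
        proof (intro Bochner_Integration.integral_cong refl)
        show "indicator {r..s} x *\<^sub>R (v x * of_real (\<phi> k x)) = indicator {0<..} x *\<^sub>R (v x * of_real (\<phi> k x))" for x
          using rs out[of x k] by (cases "x \<in> {r<..<s}") auto
      qed
      also have "\<dots> = (LINT x|lebesgue_on {0<..}. v x * of_real (\<phi> k x))"
        by (simp add: integral_restrict_space set_lebesgue_integral_def)
      also have "\<dots> = 0" using test_fun_bump[of r "real (Suc k)" s] rs
        by (intro zero) (simp add: \<phi>_def)
      finally show ?thesis .
    qed
    ultimately have "(LINT x:{r..s}|lebesgue. v x * indicator {r<..<s} x) = 0"
      by (simp add: LIMSEQ_const_iff)
    moreover have "(LINT x:{r..s}|lebesgue. v x * indicator {r<..<s} x) = (LINT x:{r<..<s}|lebesgue. v x)"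
      unfolding set_lebesgue_integral_def
      by (intro Bochner_Integration.integral_cong refl) (auto simp: indicator_def)
    ultimately show ?thesis by simp
  qed
  \<comment> \<open>The offset 2 ensures 1/(m+2) < m+2, as the local integrability hypothesis
    demands.\<close>
  define I where "I m = {1 / real (m+2)<..<real (m+2)}" for m
  have "AE x in lebesgue. x \<in> I m \<longrightarrow> v x = 0" for m
  proof -
    let ?w = "\<lambda>x. indicator (I m) x *\<^sub>R v x"
    have "AE x in lebesgue. ?w x = 0"
    proof (rule AE_zero_if_interval_integrals_zero)
      have "set_integrable lebesgue {1 / real (m+2)..real (m+2)} v"
        by (rule v) (auto simp: field_simps add_pos_nonneg)
      then have "set_integrable lebesgue (I m) v"
        by (rule set_integrable_subset) (auto simp: I_def)
      then show "integrable lebesgue ?w" by (simp add: set_integrable_def)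
      fix r s :: real assume "r < s"
      let ?r = "max r (1 / real (m+2))" and ?s = "min s (real (m+2))"
      have "(LINT x:{r<..<s}|lebesgue. ?w x) = (LINT x:{?r<..<?s}|lebesgue. v x)"
        unfolding set_lebesgue_integral_def
        by (intro Bochner_Integration.integral_cong refl) (auto simp: I_def indicator_def)
      also have "\<dots> = 0"
      proof (cases "?r < ?s")
        case True
        then show ?thesis by (intro int0) (auto simp: less_max_iff_disj)
      next
        case False
        then have "{?r<..<?s} = {}" by (simp only: greaterThanLessThan_empty_iff not_less)
        then show ?thesis by (simp only: set_lebesgue_integral_def) simp
      qed
      finally show "(LINT x:{r<..<s}|lebesgue. ?w x) = 0" .
    qed
    then show ?thesis by (auto elim!: eventually_mono simp: indicator_def)
  qed
  then have "AE x in lebesgue. \<forall>m. x \<in> I m \<longrightarrow> v x = 0"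
    unfolding AE_all_countable by blast
  then have "AE x in lebesgue. x \<in> {0<..} \<longrightarrow> v x = 0"
  proof (rule eventually_mono, intro impI)
    fix x assume *: "\<forall>m. x \<in> I m \<longrightarrow> v x = 0" and x: "x \<in> {0<..}"
    obtain m where m: "x < real m" "1/x < real m" using reals_Archimedean2[of "max x (1/x)"] by auto
    have "inverse x < real (m+2)" using m by (simp add: divide_inverse)
    then have "inverse (real (m+2)) < inverse (inverse x)"
      using x by (intro less_imp_inverse_less) auto
    then have "x \<in> I m" using m by (simp add: I_def divide_inverse)
    then show "v x = 0" using * by blast
  qed
  then show ?thesis by (simp add: AE_restrict_space_iff)
qed

subsection \<open>Square-integrable functions on the star\<close>

lemma L2_halfD:
  assumes "u \<in> L2_half"
  shows "u \<in> borel_measurable (lebesgue_on {0<..})" "integrable (lebesgue_on {0<..}) (\<lambda>x. (cmod (u x))\<^sup>2)"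
  using assms by (auto simp: L2_half_def)

lemma L2_half_lin:
  assumes u: "u \<in> L2_half" and v: "v \<in> L2_half"
  shows "(\<lambda>x. z * u x + w * v x) \<in> L2_half"
  unfolding L2_half_def
proof (intro CollectI conjI)
  note [measurable] = L2_halfD(1)[OF u] L2_halfD(1)[OF v]
  show "(\<lambda>x. z * u x + w * v x) \<in> borel_measurable (lebesgue_on {0<..})" by measurable
  show "integrable (lebesgue_on {0<..}) (\<lambda>x. (cmod (z * u x + w * v x))\<^sup>2)"
  proof (rule Bochner_Integration.integrable_bound)
    show "integrable (lebesgue_on {0<..}) (\<lambda>x. 2 * (cmod z)\<^sup>2 * (cmod (u x))\<^sup>2 + 2 * (cmod w)\<^sup>2 * (cmod (v x))\<^sup>2)"
      using L2_halfD(2)[OF u] L2_halfD(2)[OF v] by auto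
    show "AE x in lebesgue_on {0<..}. norm ((cmod (z * u x + w * v x))\<^sup>2)
        \<le> norm (2 * (cmod z)\<^sup>2 * (cmod (u x))\<^sup>2 + 2 * (cmod w)\<^sup>2 * (cmod (v x))\<^sup>2)"
    proof (rule AE_I2)
      fix x
      have "(cmod (z * u x + w * v x))\<^sup>2 \<le> (cmod z * cmod (u x) + cmod w * cmod (v x))\<^sup>2"
        by (intro power_mono) (auto intro: order_trans[OF norm_triangle_ineq] simp: norm_mult)
      also have "\<dots> \<le> 2 * (cmod z)\<^sup>2 * (cmod (u x))\<^sup>2 + 2 * (cmod w)\<^sup>2 * (cmod (v x))\<^sup>2"
        using zero_le_power2[of "cmod z * cmod (u x) - cmod w * cmod (v x)"]
        by (simp add: power2_eq_square algebra_simps)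
      finally show "norm ((cmod (z * u x + w * v x))\<^sup>2)
        \<le> norm (2 * (cmod z)\<^sup>2 * (cmod (u x))\<^sup>2 + 2 * (cmod w)\<^sup>2 * (cmod (v x))\<^sup>2)" by simp
    qed
  qed measurable
qed

lemma L2_half_mult_integrable:
  assumes u: "u \<in> L2_half" and v: "v \<in> L2_half"
  shows "integrable (lebesgue_on {0<..}) (\<lambda>x. u x * v x)"
proof (rule Bochner_Integration.integrable_bound)
  note [measurable] = L2_halfD(1)[OF u] L2_halfD(1)[OF v]
  show "(\<lambda>x. u x * v x) \<in> borel_measurable (lebesgue_on {0<..})" by measurable
  show "integrable (lebesgue_on {0<..}) (\<lambda>x. (cmod (u x))\<^sup>2 + (cmod (v x))\<^sup>2)"
    using L2_halfD(2)[OF u] L2_halfD(2)[OF v] by auto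
  have "cmod (u x) * cmod (v x) \<le> (cmod (u x))\<^sup>2 + (cmod (v x))\<^sup>2" for x
  proof -
    have "0 \<le> cmod (u x) * cmod (v x)" by simp
    then show ?thesis using sum_squares_bound[of "cmod (u x)" "cmod (v x)"] by linarith
  qed
  then show "AE x in lebesgue_on {0<..}. norm (u x * v x) \<le> norm ((cmod (u x))\<^sup>2 + (cmod (v x))\<^sup>2)"
    by (simp add: norm_mult)
qed

lemma L2_half_cnj: "u \<in> L2_half \<Longrightarrow> (\<lambda>x. cnj (u x)) \<in> L2_half"
  using measurable_compose[of u "lebesgue_on {0<..}" borel cnj borel] borel_measurable_continuous_onI[OF continuous_on_cnj[OF continuous_on_id]]
  by (auto simp: L2_half_def)

lemma L2_half_mult_cnj_integrable:
  "u \<in> L2_half \<Longrightarrow> v \<in> L2_half \<Longrightarrow> integrable (lebesgue_on {0<..}) (\<lambda>x. u x * cnj (v x))"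
  by (rule L2_half_mult_integrable[OF _ L2_half_cnj])

text \<open>The indicator of a set of finite measure is square-integrable, and a product of two
  square-integrable functions is integrable.\<close>

lemma L2_half_locally_integrable:
  assumes u: "u \<in> L2_half" and S: "S \<in> sets lebesgue" "S \<subseteq> {0<..}" "emeasure lebesgue S < \<infinity>"
  shows "set_integrable lebesgue S u"
proof -
  have "(\<lambda>x. indicator S x) \<in> L2_half"
  proof -
    have "integrable lebesgue (indicator S :: real \<Rightarrow> real)" using S by auto
    then have "integrable lebesgue (\<lambda>x. indicator {0<..} x *\<^sub>R (cmod (indicator S x))\<^sup>2)"
      using S(2) by (subst Bochner_Integration.integrable_cong[OF refl, where g="indicator S"])
        (auto simp: indicator_def)
    then show ?thesis
      using S(1) by (auto simp: L2_half_def integrable_restrict_space intro!: measurable_restrict_space1)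
  qed
  from L2_half_mult_integrable[OF u this]
  have "integrable lebesgue (\<lambda>x. indicator {0<..} x *\<^sub>R (u x * indicator S x))"
    by (simp add: integrable_restrict_space)
  then show ?thesis unfolding set_integrable_def
    using S(2) by (subst Bochner_Integration.integrable_cong[OF refl, where g="\<lambda>x. indicator {0<..} x *\<^sub>R (u x * indicator S x)"])
      (auto simp: indicator_def)
qed

text \<open>Continuity is asked only on [0, R], so a jump at R is allowed; this covers truncations
  and indicators of [0, R] as well as continuous functions.\<close>

lemma bounded_support_L2_half:
  fixes f :: "real \<Rightarrow> complex"
  assumes cont: "continuous_on {0..R} f" and supp: "\<And>x. x > R \<Longrightarrow> f x = 0"
  shows "f \<in> L2_half"
proof -
  have eq: "(\<lambda>x. indicator {0<..} x *\<^sub>R f x) = (\<lambda>x. indicator {0<..R} x *\<^sub>R f x)"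
    using supp by (auto simp: indicator_def fun_eq_iff not_le)
  have "(\<lambda>x. indicator {0<..R} x *\<^sub>R f x) \<in> borel_measurable borel"
    by (intro borel_measurable_continuous_on_indicator continuous_on_subset[OF cont]) auto
  then have m: "(\<lambda>x. indicator {0<..} x *\<^sub>R f x) \<in> borel_measurable lebesgue"
    unfolding eq by (intro measurable_completion) simp
  have "compact (f ` {0..R})" by (intro compact_continuous_image cont compact_Icc)
  then obtain B where B: "\<And>x. x \<in> {0..R} \<Longrightarrow> cmod (f x) \<le> B"
    by (metis bounded_iff compact_imp_bounded imageI)
  have "integrable lebesgue (\<lambda>x. indicator {0<..} x *\<^sub>R (cmod (f x))\<^sup>2)"
  proof (rule Bochner_Integration.integrable_bound)
    show "integrable lebesgue (\<lambda>x. B\<^sup>2 * indicator {0..R} x)" by (cases "R \<ge> 0") auto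
    have "(\<lambda>x. (cmod (indicator {0<..} x *\<^sub>R f x))\<^sup>2) \<in> borel_measurable lebesgue"
      using m by measurable
    then show "(\<lambda>x. indicator {0<..} x *\<^sub>R (cmod (f x))\<^sup>2) \<in> borel_measurable lebesgue"
      by (rule measurable_cong[THEN iffD1, rotated]) (auto simp: indicator_def)
    have "(cmod (f x))\<^sup>2 \<le> B\<^sup>2" if "x \<in> {0..R}" for x using B[OF that] by (intro power_mono) auto
    then show "AE x in lebesgue. norm (indicator {0<..} x *\<^sub>R (cmod (f x))\<^sup>2) \<le> norm (B\<^sup>2 * indicator {0..R} x)"
      using supp by (auto simp: indicator_def not_le)
  qed
  moreover have "f \<in> borel_measurable (lebesgue_on {0<..})"
    using m by (simp add: borel_measurable_restrict_space_iff)
  ultimately show ?thesis by (simp add: L2_half_def integrable_restrict_space)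
qed

subsection \<open>Test functions and weak derivatives\<close>

lemma test_fun_deriv:
  assumes t: "test_fun \<phi>" shows "test_fun (deriv \<phi>)"
  unfolding test_fun_def
proof (intro conjI allI)
  have "(deriv ^^ Suc m) \<phi> field_differentiable at x" for m x
    using t unfolding test_fun_def by blast
  then show "(deriv ^^ m) (deriv \<phi>) field_differentiable at x" for m x
    by (simp only: funpow_Suc_right o_apply)
  obtain K where K: "compact K" "K \<subseteq> {0<..}" "\<forall>x. x \<notin> K \<longrightarrow> \<phi> x = 0"
    using t unfolding test_fun_def by blast
  have "deriv \<phi> x = 0" if "x \<notin> K" for x
  proof -
    have "((\<lambda>x. 0) has_real_derivative 0) (at x)" by simp
    then have "(\<phi> has_real_derivative 0) (at x)"
      by (rule has_field_derivative_transform_within_open[where S="- K"])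
        (use K that compact_imp_closed in \<open>auto simp: open_Compl\<close>)
    then show ?thesis by (rule DERIV_imp_deriv)
  qed
  then show "\<exists>K. compact K \<and> K \<subseteq> {0<..} \<and> (\<forall>x. x \<notin> K \<longrightarrow> deriv \<phi> x = 0)"
    using K by blast
qed

lemma test_fun_funpow_deriv: "test_fun \<phi> \<Longrightarrow> test_fun ((deriv ^^ m) \<phi>)"
  by (induction m) (auto intro: test_fun_deriv)

lemma test_fun_has_derivative:
  "test_fun \<phi> \<Longrightarrow> (\<phi> has_real_derivative deriv \<phi> x) (at x)"
  unfolding test_fun_def using DERIV_deriv_iff_field_differentiable[of \<phi> x]
  by (elim conjE) (drule spec[of _ 0], simp)

text \<open>Turns the compact support into an interval away from 0, the form used for integration by
  parts. Halving the infimum of K and adding 1 to its supremum makes the function vanish at both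
  endpoints as well.\<close>

lemma test_fun_support:
  assumes "test_fun \<phi>"
  obtains r R where "0 < r" "r < R" "\<And>x. x \<le> r \<Longrightarrow> \<phi> x = 0" "\<And>x. x \<ge> R \<Longrightarrow> \<phi> x = 0"
proof -
  obtain K where K: "compact K" "K \<subseteq> {0<..}" "\<forall>x. x \<notin> K \<longrightarrow> \<phi> x = 0"
    using assms unfolding test_fun_def by blast
  show thesis
  proof (cases "K = {}")
    case True then show thesis using K by (intro that[of 1 2]) auto
  next
    case False
    obtain p where p: "p \<in> K" "\<And>x. x \<in> K \<Longrightarrow> p \<le> x" using compact_attains_inf[OF K(1) False] by blast
    obtain q where q: "q \<in> K" "\<And>x. x \<in> K \<Longrightarrow> x \<le> q" using compact_attains_sup[OF K(1) False] by blast
    have "0 < p" using p K by auto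
    show thesis
    proof (rule that[of "p/2" "q+1"])
      show "0 < p/2" "p/2 < q+1" using \<open>0 < p\<close> p(2)[OF q(1)] by auto
      show "\<phi> x = 0" if "x \<le> p/2" for x using K(3) p(2)[of x] that \<open>0 < p\<close> by force
      show "\<phi> x = 0" if "x \<ge> q+1" for x using K(3) q(2)[of x] that by force
    qed
  qed
qed

lemma test_fun_continuous: "test_fun \<phi> \<Longrightarrow> continuous_on S \<phi>"
  using test_fun_has_derivative by (intro DERIV_continuous_on) (auto intro: DERIV_subset)

lemma test_fun_L2_half:
  assumes "test_fun \<phi>" shows "(\<lambda>x. complex_of_real (\<phi> x)) \<in> L2_half"
proof -
  obtain r R where "0 < r" "r < R" "\<And>x. x \<le> r \<Longrightarrow> \<phi> x = 0" "\<And>x. x \<ge> R \<Longrightarrow> \<phi> x = 0"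
    by (rule test_fun_support[OF assms]) blast
  then show ?thesis
    by (intro bounded_support_L2_half[of R] continuous_intros test_fun_continuous assms) auto
qed

lemma AE_eq_if_test_integrals_eq:
  assumes "u \<in> L2_half" "v \<in> L2_half"
    and "\<And>\<phi>. test_fun \<phi> \<Longrightarrow> (LINT x|lebesgue_on {0<..}. u x * of_real (\<phi> x)) = (LINT x|lebesgue_on {0<..}. v x * of_real (\<phi> x))"
  shows "AE x in lebesgue_on {0<..}. u x = v x"
proof -
  have d: "(\<lambda>x. 1 * u x + (-1) * v x) \<in> L2_half" by (intro L2_half_lin assms)
  have "AE x in lebesgue_on {0<..}. 1 * u x + (-1) * v x = 0"
  proof (rule fundamental_lemma)
    show "set_integrable lebesgue {r..s} (\<lambda>x. 1 * u x + (-1) * v x)" if "0 < r" "r < s" for r s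
      using d by (rule L2_half_locally_integrable) (use that in auto)
    fix \<phi> :: "real \<Rightarrow> real" assume t: "test_fun \<phi>"
    have "(LINT x|lebesgue_on {0<..}. (1 * u x + (-1) * v x) * of_real (\<phi> x)) =
        (LINT x|lebesgue_on {0<..}. u x * of_real (\<phi> x) - v x * of_real (\<phi> x))"
      by (intro Bochner_Integration.integral_cong) (auto simp: algebra_simps)
    also have "\<dots> = 0"
      using assms(3)[OF t] L2_half_mult_integrable[OF assms(1) test_fun_L2_half[OF t]] L2_half_mult_integrable[OF assms(2) test_fun_L2_half[OF t]]
      by simp
    finally show "(LINT x|lebesgue_on {0<..}. (1 * u x + (-1) * v x) * of_real (\<phi> x)) = 0" .
  qed
  then show ?thesis by simp
qed

text \<open>Makes \<open>weak_deriv2\<close>, which is a choice by SOME, well defined up to null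
  sets.\<close>

lemma weak_deriv_unique:
  assumes "weak_deriv m u v" "weak_deriv m u w" "v \<in> L2_half" "w \<in> L2_half"
  shows "AE x in lebesgue_on {0<..}. v x = w x"
proof (rule AE_eq_if_test_integrals_eq)
  fix \<phi> assume t: "test_fun \<phi>"
  have "(- 1) ^ m * (LINT x|lebesgue_on {0<..}. v x * of_real (\<phi> x)) =
      (- 1) ^ m * (LINT x|lebesgue_on {0<..}. w x * of_real (\<phi> x))"
    using assms(1)[unfolded weak_deriv_def, rule_format, OF t]
      assms(2)[unfolded weak_deriv_def, rule_format, OF t] by simp
  then show "(LINT x|lebesgue_on {0<..}. v x * of_real (\<phi> x)) = (LINT x|lebesgue_on {0<..}. w x * of_real (\<phi> x))"
    by simp
qed (use assms in auto)

lemma weak_deriv_lin: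
  assumes "weak_deriv m u v" "weak_deriv m u' v'"
    and L: "u \<in> L2_half" "v \<in> L2_half" "u' \<in> L2_half" "v' \<in> L2_half"
  shows "weak_deriv m (\<lambda>x. z * u x + w * u' x) (\<lambda>x. z * v x + w * v' x)"
  unfolding weak_deriv_def
proof (intro allI impI)
  fix \<phi> assume t: "test_fun \<phi>"
  have lin: "(LINT x|lebesgue_on {0<..}. (z * f x + w * g x) * of_real (\<psi> x)) =
     z * (LINT x|lebesgue_on {0<..}. f x * of_real (\<psi> x)) + w * (LINT x|lebesgue_on {0<..}. g x * of_real (\<psi> x))"
    if "f \<in> L2_half" "g \<in> L2_half" "test_fun \<psi>" for f g \<psi>
  proof -
    have "(LINT x|lebesgue_on {0<..}. (z * f x + w * g x) * of_real (\<psi> x)) =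
      (LINT x|lebesgue_on {0<..}. z * (f x * of_real (\<psi> x)) + w * (g x * of_real (\<psi> x)))"
      by (rule Bochner_Integration.integral_cong[OF refl]) (simp only: distrib_right mult.assoc)
    then show ?thesis
      using that by (simp add: L2_half_mult_integrable test_fun_L2_half)
  qed
  show "(LINT x|lebesgue_on {0<..}. (z * u x + w * u' x) * of_real ((deriv ^^ m) \<phi> x)) =
     (- 1) ^ m * (LINT x|lebesgue_on {0<..}. (z * v x + w * v' x) * of_real (\<phi> x))"
    unfolding lin[OF L(1,3) test_fun_funpow_deriv[OF t]] lin[OF L(2,4) t]
    unfolding assms(1)[unfolded weak_deriv_def, rule_format, OF t]
      assms(2)[unfolded weak_deriv_def, rule_format, OF t] by (simp add: algebra_simps)
qed

lemma weak_deriv2: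
  assumes "u \<in> H2_half"
  shows "weak_deriv2 u \<in> L2_half" "weak_deriv 2 u (weak_deriv2 u)"
proof -
  have "\<exists>v. v \<in> L2_half \<and> weak_deriv 2 u v"
    using assms unfolding H2_half_def by auto
  then have "weak_deriv2 u \<in> L2_half \<and> weak_deriv 2 u (weak_deriv2 u)"
    unfolding weak_deriv2_def by (rule someI_ex)
  then show "weak_deriv2 u \<in> L2_half" "weak_deriv 2 u (weak_deriv2 u)" by auto
qed

lemma H2_half_L2: "u \<in> H2_half \<Longrightarrow> u \<in> L2_half" by (simp add: H2_half_def)

text \<open>The shape in which the axioms of a projection-valued measure express linearity; u + v, u
  - v and A u - z u are all instances.\<close>

definition star_lin :: "complex \<Rightarrow> star_fun \<Rightarrow> complex \<Rightarrow> star_fun \<Rightarrow> star_fun" where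
  "star_lin z u w v = (\<lambda>k x. z * u k x + w * v k x)"

lemma star_lin_L2: "u \<in> L2_star n \<Longrightarrow> v \<in> L2_star n \<Longrightarrow> star_lin z u w v \<in> L2_star n"
  by (simp add: L2_star_def star_lin_def L2_half_lin)

lemma star_eq_refl [simp]: "star_eq n u u" by (simp add: star_eq_def)

lemma star_eq_sym: "star_eq n u v \<Longrightarrow> star_eq n v u"
  by (auto simp: star_eq_def elim!: eventually_mono)

lemma star_eq_trans: "star_eq n u v \<Longrightarrow> star_eq n v w \<Longrightarrow> star_eq n u w"
  unfolding star_eq_def
proof
  fix k assume *: "\<forall>k\<in>{1..n}. AE x in lebesgue_on {0<..}. u k x = v k x"
    "\<forall>k\<in>{1..n}. AE x in lebesgue_on {0<..}. v k x = w k x" "k \<in> {1..n}"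
  from bspec[OF *(1,3)] bspec[OF *(2,3)] show "AE x in lebesgue_on {0<..}. u k x = w k x"
    by eventually_elim simp
qed

lemma star_lin_cong:
  "star_eq n u u' \<Longrightarrow> star_eq n v v' \<Longrightarrow> star_eq n (star_lin z u w v) (star_lin z u' w v')"
  unfolding star_eq_def star_lin_def
proof
  fix k assume *: "\<forall>k\<in>{1..n}. AE x in lebesgue_on {0<..}. u k x = u' k x"
    "\<forall>k\<in>{1..n}. AE x in lebesgue_on {0<..}. v k x = v' k x" "k \<in> {1..n}"
  from bspec[OF *(1,3)] bspec[OF *(2,3)]
  show "AE x in lebesgue_on {0<..}. z * u k x + w * v k x = z * u' k x + w * v' k x"
    by eventually_elim simp
qed

lemma star_op_L2:
  assumes "u \<in> star_domain n c" shows "star_op n c a u \<in> L2_star n"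
  unfolding L2_star_def star_op_def
proof (intro CollectI ballI)
  fix k assume "k \<in> {1..n}"
  then have "u k \<in> H2_half" using assms by (auto simp: star_domain_def)
  then show "(\<lambda>x. - complex_of_real (c k) * weak_deriv2 (u k) x + complex_of_real (a k) * u k x) \<in> L2_half"
    by (intro L2_half_lin weak_deriv2 H2_half_L2)
qed

text \<open>Lets any square-integrable second weak derivative replace the chosen one, so that A can
  be applied to the resolvent through classical derivatives.\<close>

lemma star_op_eqI:
  assumes u: "u \<in> star_domain n c"
    and v: "\<And>k. k \<in> {1..n} \<Longrightarrow> v k \<in> L2_half \<and> weak_deriv 2 (u k) (v k)"
  shows "star_eq n (star_op n c a u) (\<lambda>k x. - of_real (c k) * v k x + of_real (a k) * u k x)"
  unfolding star_eq_def
proof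
  fix k assume k: "k \<in> {1..n}"
  then have "u k \<in> H2_half" using u by (auto simp: star_domain_def)
  then have "AE x in lebesgue_on {0<..}. weak_deriv2 (u k) x = v k x"
    using weak_deriv2 v[OF k] by (intro weak_deriv_unique) auto
  then show "AE x in lebesgue_on {0<..}. star_op n c a u k x = - of_real (c k) * v k x + of_real (a k) * u k x"
    by (auto elim!: eventually_mono simp: star_op_def)
qed

lemma star_op_lin:
  assumes u: "u \<in> star_domain n c" and v: "v \<in> star_domain n c"
    and uv: "star_lin z u w v \<in> star_domain n c"
  shows "star_eq n (star_op n c a (star_lin z u w v)) (star_lin z (star_op n c a u) w (star_op n c a v))"
proof -
  have "star_eq n (star_op n c a (star_lin z u w v))
     (\<lambda>k x. - of_real (c k) * (z * weak_deriv2 (u k) x + w * weak_deriv2 (v k) x) + of_real (a k) * star_lin z u w v k x)"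
  proof (rule star_op_eqI[OF uv])
    fix k assume "k \<in> {1..n}"
    then have k: "u k \<in> H2_half" "v k \<in> H2_half" using u v by (auto simp: star_domain_def)
    show "(\<lambda>x. z * weak_deriv2 (u k) x + w * weak_deriv2 (v k) x) \<in> L2_half \<and>
         weak_deriv 2 (star_lin z u w v k) (\<lambda>x. z * weak_deriv2 (u k) x + w * weak_deriv2 (v k) x)"
      unfolding star_lin_def using k
      by (intro conjI L2_half_lin weak_deriv_lin weak_deriv2 H2_half_L2)
  qed
  also have "(\<lambda>k x. - of_real (c k) * (z * weak_deriv2 (u k) x + w * weak_deriv2 (v k) x) + of_real (a k) * star_lin z u w v k x)
     = star_lin z (star_op n c a u) w (star_op n c a v)"
    by (auto simp: fun_eq_iff star_lin_def star_op_def algebra_simps)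
  finally show ?thesis .
qed

subsection \<open>The inner product\<close>

lemma star_inner_lin_left:
  assumes "u \<in> L2_star n" "v \<in> L2_star n" "f \<in> L2_star n"
  shows "star_inner n (star_lin z u w v) f = z * star_inner n u f + w * star_inner n v f"
proof -
  have "(LINT x|lebesgue_on {0<..}. (z * u k x + w * v k x) * cnj (f k x)) =
     z * (LINT x|lebesgue_on {0<..}. u k x * cnj (f k x)) + w * (LINT x|lebesgue_on {0<..}. v k x * cnj (f k x))"
    if "k \<in> {1..n}" for k
  proof -
    have "u k \<in> L2_half" "v k \<in> L2_half" "f k \<in> L2_half" using assms that by (auto simp: L2_star_def)
    then have i: "integrable (lebesgue_on {0<..}) (\<lambda>x. u k x * cnj (f k x))"
       "integrable (lebesgue_on {0<..}) (\<lambda>x. v k x * cnj (f k x))"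
      by (auto intro: L2_half_mult_cnj_integrable)
    have "(LINT x|lebesgue_on {0<..}. (z * u k x + w * v k x) * cnj (f k x)) =
       (LINT x|lebesgue_on {0<..}. z * (u k x * cnj (f k x)) + w * (v k x * cnj (f k x)))"
      by (rule Bochner_Integration.integral_cong[OF refl]) (simp only: distrib_right mult.assoc)
    then show ?thesis using i by simp
  qed
  then show ?thesis
    by (simp add: star_inner_def star_integral_def star_lin_def sum.distrib sum_distrib_left)
qed

lemma star_inner_sym: "star_inner n v u = cnj (star_inner n u v)"
  unfolding star_inner_def star_integral_def cnj_sum Bochner_Integration.integral_cnj[symmetric]
  by (simp only: complex_cnj_mult complex_cnj_cnj mult.commute)

lemma star_inner_lin_right:
  assumes "u \<in> L2_star n" "v \<in> L2_star n" "f \<in> L2_star n"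
  shows "star_inner n f (star_lin z u w v) = cnj z * star_inner n f u + cnj w * star_inner n f v"
  using star_inner_lin_left[OF assms, of z w]
  by (subst (1 2 3) star_inner_sym) simp

lemma star_inner_cong:
  assumes eq: "star_eq n u u'" "star_eq n v v'"
    and L: "u \<in> L2_star n" "u' \<in> L2_star n" "v \<in> L2_star n" "v' \<in> L2_star n"
  shows "star_inner n u v = star_inner n u' v'"
  unfolding star_inner_def star_integral_def
proof (intro sum.cong refl integral_cong_AE)
  fix k assume k: "k \<in> {1..n}"
  then have "u k \<in> L2_half" "u' k \<in> L2_half" "v k \<in> L2_half" "v' k \<in> L2_half"
    using L by (auto simp: L2_star_def)
  then show "(\<lambda>x. u k x * cnj (v k x)) \<in> borel_measurable (lebesgue_on {0<..})"
    "(\<lambda>x. u' k x * cnj (v' k x)) \<in> borel_measurable (lebesgue_on {0<..})"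
    by (auto intro!: borel_measurable_integrable L2_half_mult_cnj_integrable)
  show "AE x in lebesgue_on {0<..}. u k x * cnj (v k x) = u' k x * cnj (v' k x)"
    using bspec[OF eq(1)[unfolded star_eq_def] k] bspec[OF eq(2)[unfolded star_eq_def] k] by eventually_elim simp
qed

lemma star_inner_self:
  "star_inner n u u = of_real (\<Sum>k=1..n. LINT x|lebesgue_on {0<..}. (cmod (u k x))\<^sup>2)"
proof -
  have "u k x * cnj (u k x) = complex_of_real ((cmod (u k x))\<^sup>2)" for k x
    by (rule complex_norm_square[symmetric])
  then show ?thesis by (simp only: star_inner_def star_integral_def integral_complex_of_real of_real_sum)
qed

lemma star_inner_self_nonneg: "0 \<le> Re (star_inner n u u)" "Im (star_inner n u u) = 0"
  by (auto simp: star_inner_self intro!: sum_nonneg)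

subsection \<open>Linear relations between measures\<close>

text \<open>Polarization produces differences of measures. They are kept as equations between sums
  of positive measures, which pass to integrals by induction on the integrand. The coefficients p, q
  serve the parallelogram law.\<close>

lemma nn_integral_measure_add:
  fixes M1 M2 M3 M4 :: "real measure"
  assumes sets: "sets M1 = sets borel" "sets M2 = sets borel" "sets M3 = sets borel" "sets M4 = sets borel"
    and eq: "\<And>S. S \<in> sets borel \<Longrightarrow> emeasure M1 S + emeasure M2 S = p * emeasure M3 S + q * emeasure M4 S"
    and f: "f \<in> borel_measurable borel"
  shows "(\<integral>\<^sup>+x. f x \<partial>M1) + (\<integral>\<^sup>+x. f x \<partial>M2) = p * (\<integral>\<^sup>+x. f x \<partial>M3) + q * (\<integral>\<^sup>+x. f x \<partial>M4)"
  using f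
proof (induction rule: borel_measurable_induct)
  case (cong f g)
  then have "f = g" by auto
  then show ?case using cong by simp
next
  case (set A)
  then show ?case using eq sets by simp
next
  case (mult u c)
  have m: "u \<in> borel_measurable M1" "u \<in> borel_measurable M2" "u \<in> borel_measurable M3" "u \<in> borel_measurable M4"
    using mult(2) sets by (simp_all cong: measurable_cong_sets)
  have "c * (\<integral>\<^sup>+x. u x \<partial>M1) + c * (\<integral>\<^sup>+x. u x \<partial>M2) = c * (p * (\<integral>\<^sup>+x. u x \<partial>M3) + q * (\<integral>\<^sup>+x. u x \<partial>M4))"
    unfolding distrib_left[symmetric] mult by (rule refl)
  then show ?case using m by (simp add: nn_integral_cmult distrib_left mult.left_commute)
next
  case (add u v)
  have m: "u \<in> borel_measurable M1" "u \<in> borel_measurable M2" "u \<in> borel_measurable M3" "u \<in> borel_measurable M4"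
    "v \<in> borel_measurable M1" "v \<in> borel_measurable M2" "v \<in> borel_measurable M3" "v \<in> borel_measurable M4"
    using add sets by (simp_all cong: measurable_cong_sets)
  have "((\<integral>\<^sup>+x. u x \<partial>M1) + (\<integral>\<^sup>+x. u x \<partial>M2)) + ((\<integral>\<^sup>+x. v x \<partial>M1) + (\<integral>\<^sup>+x. v x \<partial>M2))
      = (p * (\<integral>\<^sup>+x. u x \<partial>M3) + q * (\<integral>\<^sup>+x. u x \<partial>M4)) + (p * (\<integral>\<^sup>+x. v x \<partial>M3) + q * (\<integral>\<^sup>+x. v x \<partial>M4))"
    unfolding add by (rule refl)
  then show ?case using m by (simp add: nn_integral_add distrib_left ac_simps)
next
  case (seq U)
  have m: "U i \<in> borel_measurable M1" "U i \<in> borel_measurable M2" "U i \<in> borel_measurable M3" "U i \<in> borel_measurable M4" for i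
    using seq(1) sets by (simp_all cong: measurable_cong_sets)
  have SUP: "(\<integral>\<^sup>+x. (SUP i. U i) x \<partial>M) = (SUP i. \<integral>\<^sup>+x. U i x \<partial>M)" if "\<And>i. U i \<in> borel_measurable M" for M
    using nn_integral_monotone_convergence_SUP[OF seq(3) that] by (simp add: image_comp)
  have inc: "incseq (\<lambda>i. \<integral>\<^sup>+x. U i x \<partial>M)" for M :: "real measure"
    using seq(3) by (auto simp: incseq_def le_fun_def intro!: nn_integral_mono)
  have incm: "incseq (\<lambda>i. r * (\<integral>\<^sup>+x. U i x \<partial>M))" for M :: "real measure" and r
    using inc[of M] by (auto simp: incseq_def intro!: mult_left_mono)
  show ?case
    using seq.IH unfolding SUP[OF m(1)] SUP[OF m(2)] SUP[OF m(3)] SUP[OF m(4)]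
      SUP_mult_left_ennreal
    by (simp add: ennreal_SUP_add[OF inc inc, symmetric] ennreal_SUP_add[OF incm incm, symmetric])
qed

text \<open>The preceding lemma for the positive and negative parts, obtained as
  \<open>ennreal\<close> of f and of -f; integrability makes the integrals finite and permits the
  return to real numbers.\<close>

lemma integral_measure_add:
  fixes M1 M2 M3 M4 :: "real measure" and f :: "real \<Rightarrow> real"
  assumes sets: "sets M1 = sets borel" "sets M2 = sets borel" "sets M3 = sets borel" "sets M4 = sets borel"
    and eq: "\<And>S. S \<in> sets borel \<Longrightarrow> emeasure M1 S + emeasure M2 S = emeasure M3 S + emeasure M4 S"
    and int: "integrable M1 f" "integrable M2 f" "integrable M3 f" "integrable M4 f"
  shows "integral\<^sup>L M1 f + integral\<^sup>L M2 f = integral\<^sup>L M3 f + integral\<^sup>L M4 f"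
proof -
  have f: "f \<in> borel_measurable borel"
    using borel_measurable_integrable[OF int(1)] sets(1) by (simp cong: measurable_cong_sets)
  have *: "enn2real (\<integral>\<^sup>+x. ennreal (g x) \<partial>M1) + enn2real (\<integral>\<^sup>+x. ennreal (g x) \<partial>M2) =
      enn2real (\<integral>\<^sup>+x. ennreal (g x) \<partial>M3) + enn2real (\<integral>\<^sup>+x. ennreal (g x) \<partial>M4)"
    if g: "integrable M1 g" "integrable M2 g" "integrable M3 g" "integrable M4 g" for g :: "real \<Rightarrow> real"
  proof -
    have m: "g \<in> borel_measurable borel"
      using borel_measurable_integrable[OF g(1)] sets(1) by (simp cong: measurable_cong_sets)
    have lt: "(\<integral>\<^sup>+x. ennreal (g x) \<partial>M) < top" if "integrable M g" for M
      using that by (simp add: real_integrable_def top.not_eq_extremum)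
    have "(\<integral>\<^sup>+x. ennreal (g x) \<partial>M1) + (\<integral>\<^sup>+x. ennreal (g x) \<partial>M2) =
        1 * (\<integral>\<^sup>+x. ennreal (g x) \<partial>M3) + 1 * (\<integral>\<^sup>+x. ennreal (g x) \<partial>M4)"
      by (rule nn_integral_measure_add[OF sets]) (use eq m in auto)
    then show ?thesis using lt[OF g(1)] lt[OF g(2)] lt[OF g(3)] lt[OF g(4)]
      by (simp add: enn2real_plus[symmetric])
  qed
  show ?thesis
    using *[of f] *[of "\<lambda>x. - f x"] int by (simp add: real_lebesgue_integral_def)
qed

subsection \<open>Projection-valued measures\<close>

locale pvm =
  fixes n :: nat and E :: "real set \<Rightarrow> star_fun \<Rightarrow> star_fun"
  assumes pvm: "projection_valued_measure n E"
begin

abbreviation "H \<equiv> L2_star n"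
abbreviation "ip \<equiv> star_inner n"
abbreviation "sd \<equiv> spectral_distr n E"

lemmas pvmD = pvm[unfolded projection_valued_measure_def]

lemma E_L2: "S \<in> sets borel \<Longrightarrow> u \<in> H \<Longrightarrow> E S u \<in> H"
  by (rule pvmD[THEN conjunct1, rule_format])

lemma E_cong:
  "S \<in> sets borel \<Longrightarrow> u \<in> H \<Longrightarrow> v \<in> H \<Longrightarrow> star_eq n u v \<Longrightarrow> star_eq n (E S u) (E S v)"
  by (rule pvmD[THEN conjunct2, THEN conjunct1, rule_format])

lemma E_lin:
  "S \<in> sets borel \<Longrightarrow> u \<in> H \<Longrightarrow> v \<in> H \<Longrightarrow>
    star_eq n (E S (star_lin z u w v)) (star_lin z (E S u) w (E S v))"
  unfolding star_lin_def
  by (rule pvmD[THEN conjunct2, THEN conjunct2, THEN conjunct1, rule_format])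

lemma E_sym: "S \<in> sets borel \<Longrightarrow> u \<in> H \<Longrightarrow> v \<in> H \<Longrightarrow> ip (E S u) v = ip u (E S v)"
  by (rule pvmD[THEN conjunct2, THEN conjunct2, THEN conjunct2, THEN conjunct1, rule_format])

lemma E_UNIV: "u \<in> H \<Longrightarrow> star_eq n (E UNIV u) u"
  and E_empty: "u \<in> H \<Longrightarrow> star_eq n (E {} u) (\<lambda>k x. 0)"
  using pvmD[THEN conjunct2, THEN conjunct2, THEN conjunct2, THEN conjunct2, THEN conjunct1]
  by auto

lemma E_Int:
  "S \<in> sets borel \<Longrightarrow> T \<in> sets borel \<Longrightarrow> u \<in> H \<Longrightarrow> star_eq n (E (S \<inter> T) u) (E S (E T u))"
  by (rule pvmD[THEN conjunct2, THEN conjunct2, THEN conjunct2, THEN conjunct2, THEN conjunct2,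
      THEN conjunct1, rule_format])

lemma E_sums:
  fixes F :: "nat \<Rightarrow> real set"
  shows "range F \<subseteq> sets borel \<Longrightarrow> disjoint_family F \<Longrightarrow> u \<in> H \<Longrightarrow> v \<in> H \<Longrightarrow>
    (\<lambda>i. ip (E (F i) u) v) sums ip (E (\<Union>i. F i) u) v"
  by (rule pvmD[THEN conjunct2, THEN conjunct2, THEN conjunct2, THEN conjunct2, THEN conjunct2,
      THEN conjunct2, rule_format])

lemma ip_E_E:
  assumes "S \<in> sets borel" "T \<in> sets borel" "u \<in> H" "v \<in> H"
  shows "ip (E S (E T u)) v = ip (E (S \<inter> T) u) v" "ip (E S u) (E T v) = ip (E (S \<inter> T) u) v"
proof -
  have 1: "ip (E S (E T u)) v = ip (E (S \<inter> T) u) v"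
    if "S \<in> sets borel" "T \<in> sets borel" for S T
    using that assms by (intro star_inner_cong star_eq_sym[OF E_Int] E_L2) auto
  show "ip (E S (E T u)) v = ip (E (S \<inter> T) u) v" using 1 assms by simp
  have "ip (E S u) (E T v) = ip (E T (E S u)) v" using E_sym assms E_L2 by simp
  also have "\<dots> = ip (E (S \<inter> T) u) v" using 1[of T S] assms by (simp add: Int_commute)
  finally show "ip (E S u) (E T v) = ip (E (S \<inter> T) u) v" .
qed

lemma ip_E_lin_left:
  assumes "S \<in> sets borel" "u \<in> H" "v \<in> H" "f \<in> H"
  shows "ip (E S (star_lin z u w v)) f = z * ip (E S u) f + w * ip (E S v) f"
proof -
  have "ip (E S (star_lin z u w v)) f = ip (star_lin z (E S u) w (E S v)) f"
    using assms by (intro star_inner_cong E_lin star_lin_L2 E_L2) auto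
  then show ?thesis using assms by (simp add: star_inner_lin_left E_L2)
qed

lemma ip_E_lin_right:
  assumes "S \<in> sets borel" "u \<in> H" "v \<in> H" "f \<in> H"
  shows "ip (E S f) (star_lin z u w v) = cnj z * ip (E S f) u + cnj w * ip (E S f) v"
  using assms by (simp add: star_inner_lin_right E_L2)

lemma ip_E_cnj:
  assumes "S \<in> sets borel" "u \<in> H" "v \<in> H"
  shows "ip (E S v) u = cnj (ip (E S u) v)"
  using E_sym[OF assms(1,3,2)] star_inner_sym[of n v "E S u"] by simp

lemma ip_E_self:
  assumes "S \<in> sets borel" "u \<in> H"
  shows "0 \<le> Re (ip (E S u) u)" "ip (E S u) u = of_real (Re (ip (E S u) u))"
proof -
  have "ip (E S u) u = ip (E S u) (E S u)" using ip_E_E(2)[of S S u u] assms by simp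
  then show "0 \<le> Re (ip (E S u) u)" "ip (E S u) u = of_real (Re (ip (E S u) u))"
    using star_inner_self_nonneg[of n "E S u"] by (auto simp: complex_eq_iff)
qed

lemma space_sd [simp]: "space (sd u) = UNIV"
  and sets_sd [simp, measurable_cong]: "sets (sd u) = sets borel"
  by (simp_all add: spectral_distr_def sets.sigma_sets_eq[of borel, simplified])

text \<open>\<open>measure_of\<close> takes the prescribed values only for a countably additive set
  function. Nonnegativity of the values comes from (E(S) u, u) = (E(S) u, E(S) u).\<close>

lemma emeasure_sd:
  assumes u: "u \<in> H" and S: "S \<in> sets borel"
  shows "emeasure (sd u) S = ennreal (Re (ip (E S u) u))"
  unfolding spectral_distr_def
proof (rule emeasure_measure_of_sigma)
  show "sigma_algebra UNIV (sets borel)" using sets.sigma_algebra_axioms[of borel] by simp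
  have "ip (E {} u) u = ip (star_lin 0 u 0 u) u"
    using E_empty[OF u] u by (intro star_inner_cong E_L2 star_lin_L2) (auto simp: star_lin_def)
  then show "positive (sets borel) (\<lambda>S. ennreal (Re (ip (E S u) u)))"
    using u by (simp add: positive_def star_inner_lin_left)
  show "countably_additive (sets borel) (\<lambda>S. ennreal (Re (ip (E S u) u)))"
    unfolding countably_additive_def
  proof (intro allI impI)
    fix F :: "nat \<Rightarrow> real set" assume F: "range F \<subseteq> sets borel" "disjoint_family F"
    have s: "(\<lambda>i. Re (ip (E (F i) u) u)) sums Re (ip (E (\<Union>i. F i) u) u)"
      using E_sums[OF F u u] by (rule sums_Re)
    have "0 \<le> Re (ip (E (F i) u) u)" for i using ip_E_self(1) F u by blast
    then show "(\<Sum>i. ennreal (Re (ip (E (F i) u) u))) = ennreal (Re (ip (E (\<Union>i. F i) u) u))"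
      using suminf_ennreal_eq[OF _ s] by blast
  qed
qed (rule S)

lemma finite_measure_sd: "u \<in> H \<Longrightarrow> finite_measure (sd u)"
  by (rule finite_measureI) (simp add: emeasure_sd)

lemma measure_sd: "u \<in> H \<Longrightarrow> S \<in> sets borel \<Longrightarrow> measure (sd u) S = Re (ip (E S u) u)"
  by (simp add: measure_def emeasure_sd ip_E_self(1))

lemma measure_sd_UNIV: "u \<in> H \<Longrightarrow> measure (sd u) UNIV = Re (ip u u)"
  using star_inner_cong[OF E_UNIV star_eq_refl, of u u] by (simp add: measure_sd E_L2)

text \<open>By symmetry and multiplicativity (E(T) E(S) u, E(S) u) = (E(S \<inter> T) u, u):
  projecting a vector cuts off its spectral measure.\<close>

lemma sd_E:
  assumes u: "u \<in> H" and S: "S \<in> sets borel"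
  shows "sd (E S u) = density (sd u) (indicator S)"
proof (rule measure_eqI)
  fix T assume "T \<in> sets (sd (E S u))"
  then have T: "T \<in> sets borel" by simp
  have "ip (E T (E S u)) (E S u) = ip (E (S \<inter> (T \<inter> S)) u) u"
    using T S u by (subst ip_E_E(2)) (auto intro: E_L2 simp: ip_E_E(1) Int_ac)
  also have "S \<inter> (T \<inter> S) = S \<inter> T" by auto
  finally show "emeasure (sd (E S u)) T = emeasure (density (sd u) (indicator S)) T"
    using T S u by (simp add: emeasure_sd E_L2 emeasure_density indicator_inter_arith[symmetric])
qed simp

text \<open>Real polarization and the parallelogram law at the level of spectral measures. The first
  gives access to mixed terms (E(S) u, v), the second controls the moments of sums.\<close>

lemma measure_sd_add_diff:
  assumes "u \<in> H" "v \<in> H" "S \<in> sets borel"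
  shows "measure (sd (star_lin 1 u 1 v)) S - measure (sd (star_lin 1 u (-1) v)) S = 4 * Re (ip (E S u) v)"
    "measure (sd (star_lin z u w v)) S + measure (sd (star_lin z u (-w) v)) S
      = 2 * (cmod z)\<^sup>2 * measure (sd u) S + 2 * (cmod w)\<^sup>2 * measure (sd v) S"
proof -
  show "measure (sd (star_lin 1 u 1 v)) S - measure (sd (star_lin 1 u (-1) v)) S = 4 * Re (ip (E S u) v)"
    using assms ip_E_cnj[OF assms(3,1,2)]
    by (simp add: measure_sd star_lin_L2 ip_E_lin_left ip_E_lin_right)
  have "ip (E S (star_lin z u w v)) (star_lin z u w v) + ip (E S (star_lin z u (-w) v)) (star_lin z u (-w) v)
     = 2 * (z * cnj z * ip (E S u) u) + 2 * (w * cnj w * ip (E S v) v)"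
    using assms by (simp add: star_lin_L2 ip_E_lin_left ip_E_lin_right algebra_simps)
  also have "\<dots> = of_real (2 * ((cmod z)\<^sup>2 * Re (ip (E S u) u)) + 2 * ((cmod w)\<^sup>2 * Re (ip (E S v) v)))"
    using assms ip_E_self(2)[of S u] ip_E_self(2)[of S v]
    by (simp add: complex_norm_square[unfolded of_real_power])
  finally show "measure (sd (star_lin z u w v)) S + measure (sd (star_lin z u (-w) v)) S
      = 2 * (cmod z)\<^sup>2 * measure (sd u) S + 2 * (cmod w)\<^sup>2 * measure (sd v) S"
    using assms by (simp only: measure_sd star_lin_L2 plus_complex.sel[symmetric]) simp
qed

lemma emeasure_eq_measure_sd: "u \<in> H \<Longrightarrow> emeasure (sd u) S = ennreal (measure (sd u) S)"
  using finite_measure.emeasure_eq_measure[OF finite_measure_sd] by blast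

lemma integral_sd_E:
  fixes f :: "real \<Rightarrow> real"
  assumes "u \<in> H" "S \<in> sets borel" "f \<in> borel_measurable borel"
  shows "integral\<^sup>L (sd (E S u)) f = (LINT t|sd u. indicator S t * f t)"
proof -
  have "sd (E S u) = density (sd u) (\<lambda>t. ennreal (indicator S t))"
    using sd_E[OF assms(1,2)] by (simp add: ennreal_indicator[abs_def])
  then show ?thesis using assms by (simp add: integral_density)
qed

end

subsection \<open>The spectral measures of a vector and of its image under \<open>A - z\<close>\<close>

locale star_resolution =
  fixes n :: nat and c a :: "nat \<Rightarrow> real" and E
  assumes res: "resolution_of_identity n (star_domain n c) (star_op n c a) E"

sublocale star_resolution \<subseteq> pvm n E
  using res by unfold_locales (simp add: resolution_of_identity_def)

context star_resolution
begin

abbreviation "D \<equiv> star_domain n c"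
abbreviation "A \<equiv> star_op n c a"

lemma D_eq: "D = {u \<in> H. (\<integral>\<^sup>+ t. ennreal (t\<^sup>2) \<partial>sd u) < \<infinity>}"
  and form: "u \<in> D \<Longrightarrow> ip (A u) u = of_real (LINT t|sd u. t)"
  using res by (auto simp: resolution_of_identity_def)

lemma D_L2: "u \<in> D \<Longrightarrow> u \<in> H" using D_eq by auto

lemma A_L2: "u \<in> D \<Longrightarrow> A u \<in> H" by (rule star_op_L2)

lemma integrable_square: "u \<in> D \<Longrightarrow> integrable (sd u) (\<lambda>t. t\<^sup>2)"
  using D_eq by (intro integrableI_nonneg) auto

lemma integrable_id:
  assumes "u \<in> D" shows "integrable (sd u) (\<lambda>t. t)"
proof (rule Bochner_Integration.integrable_bound)
  interpret finite_measure "sd u" using finite_measure_sd D_L2 assms by blast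
  show "integrable (sd u) (\<lambda>t. t\<^sup>2 + 1)" using integrable_square[OF assms] by simp
  have "\<bar>t\<bar> \<le> t\<^sup>2 + 1" for t :: real
  proof -
    have "0 \<le> (\<bar>t\<bar> - 1)\<^sup>2" by simp
    then have "2 * \<bar>t\<bar> \<le> t\<^sup>2 + 1" by (simp add: power2_diff)
    then show ?thesis using abs_ge_zero[of t] by linarith
  qed
  then show "AE t in sd u. norm t \<le> norm (t\<^sup>2 + 1)" by (auto intro!: AE_I2)
qed simp

text \<open>By the parallelogram law the second moments of z u + w v and z u - w v have a finite
  sum.\<close>

lemma D_lin:
  assumes u: "u \<in> D" and v: "v \<in> D" shows "star_lin z u w v \<in> D"
proof -
  note L = D_L2[OF u] D_L2[OF v]
  have "(\<integral>\<^sup>+ t. ennreal (t\<^sup>2) \<partial>sd (star_lin z u w v)) + (\<integral>\<^sup>+ t. ennreal (t\<^sup>2) \<partial>sd (star_lin z u (-w) v))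
     = ennreal (2 * (cmod z)\<^sup>2) * (\<integral>\<^sup>+ t. ennreal (t\<^sup>2) \<partial>sd u) + ennreal (2 * (cmod w)\<^sup>2) * (\<integral>\<^sup>+ t. ennreal (t\<^sup>2) \<partial>sd v)"
  proof (rule nn_integral_measure_add)
    fix S :: "real set" assume S: "S \<in> sets borel"
    show "emeasure (sd (star_lin z u w v)) S + emeasure (sd (star_lin z u (- w) v)) S =
         ennreal (2 * (cmod z)\<^sup>2) * emeasure (sd u) S + ennreal (2 * (cmod w)\<^sup>2) * emeasure (sd v) S"
      using measure_sd_add_diff(2)[OF L S, of z w] L
      by (simp add: emeasure_eq_measure_sd star_lin_L2 ennreal_mult[symmetric] ennreal_plus[symmetric] del: ennreal_plus)
  qed auto
  also have "\<dots> < \<infinity>"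
    using u v D_eq by (auto simp: ennreal_mult_less_top)
  finally have "(\<integral>\<^sup>+ t. ennreal (t\<^sup>2) \<partial>sd (star_lin z u w v)) < \<infinity>"
    by (simp add: less_top[symmetric])
  then show ?thesis using L star_lin_L2 D_eq by auto
qed

lemma E_D:
  assumes u: "u \<in> D" and S: "S \<in> sets borel" shows "E S u \<in> D"
proof -
  have "(\<integral>\<^sup>+ t. ennreal (t\<^sup>2) \<partial>sd (E S u)) = (\<integral>\<^sup>+ t. indicator S t * ennreal (t\<^sup>2) \<partial>sd u)"
    using D_L2[OF u] S by (simp add: sd_E nn_integral_density)
  also have "\<dots> \<le> (\<integral>\<^sup>+ t. ennreal (t\<^sup>2) \<partial>sd u)"
    by (intro nn_integral_mono) (auto simp: indicator_def)
  also have "\<dots> < \<infinity>" using u D_eq by auto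
  finally show ?thesis using D_eq E_L2 S D_L2[OF u] by auto
qed

lemma E_bounded_D:
  assumes u: "u \<in> H" and S: "S \<in> sets borel" "bounded S" shows "E S u \<in> D"
proof -
  obtain b where b: "\<And>t. t \<in> S \<Longrightarrow> \<bar>t\<bar> \<le> b" using S(2) by (auto simp: bounded_iff)
  have le: "t\<^sup>2 \<le> b\<^sup>2" if "t \<in> S" for t using b[OF that] abs_le_square_iff[of t b] by linarith
  have "(\<integral>\<^sup>+ t. ennreal (t\<^sup>2) \<partial>sd (E S u)) = (\<integral>\<^sup>+ t. indicator S t * ennreal (t\<^sup>2) \<partial>sd u)"
    using u S by (simp add: sd_E nn_integral_density)
  also have "\<dots> \<le> (\<integral>\<^sup>+ t. ennreal (b\<^sup>2) \<partial>sd u)"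
    using le by (intro nn_integral_mono) (auto simp: indicator_def intro!: ennreal_leI)
  also have "\<dots> < \<infinity>" using u by (simp add: emeasure_sd ennreal_mult_less_top)
  finally show ?thesis using D_eq E_L2 S u by auto
qed

lemma ip_A_lin_left:
  assumes "u \<in> D" "v \<in> D" "f \<in> H"
  shows "ip (A (star_lin z u w v)) f = z * ip (A u) f + w * ip (A v) f"
proof -
  have "ip (A (star_lin z u w v)) f = ip (star_lin z (A u) w (A v)) f"
    using assms by (intro star_inner_cong star_op_lin D_lin A_L2 star_lin_L2) auto
  then show ?thesis using assms by (simp add: star_inner_lin_left A_L2)
qed

lemma form_expand:
  assumes "u \<in> D" "v \<in> D"
  shows "ip (A (star_lin z u w v)) (star_lin z u w v) =
    z * cnj z * ip (A u) u + z * cnj w * ip (A u) v + w * cnj z * ip (A v) u + w * cnj w * ip (A v) v"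
  using assms by (simp add: ip_A_lin_left star_inner_lin_right D_L2 A_L2 star_lin_L2 algebra_simps)

text \<open>The form (A p, p) is real for p = u + v and p = u + i v, which forces it to be
  Hermitian.\<close>

lemma A_symmetric:
  assumes u: "u \<in> D" and v: "v \<in> D"
  shows "ip (A v) u = cnj (ip (A u) v)"
proof -
  have r: "Im (ip (A p) p) = 0" if "p \<in> D" for p using form[OF that] by simp
  have "Im (ip (A (star_lin 1 u 1 v)) (star_lin 1 u 1 v)) = 0"
    "Im (ip (A (star_lin 1 u \<i> v)) (star_lin 1 u \<i> v)) = 0" by (intro r D_lin u v)+
  then show ?thesis using r[OF u] r[OF v] unfolding form_expand[OF u v]
    by (simp add: complex_eq_iff)
qed

lemma form_polar:
  assumes u: "u \<in> D" and v: "v \<in> D"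
  shows "4 * Re (ip (A u) v) = (LINT t|sd (star_lin 1 u 1 v). t) - (LINT t|sd (star_lin 1 u (-1) v). t)"
proof -
  have "of_real (LINT t|sd (star_lin 1 u 1 v). t) - of_real (LINT t|sd (star_lin 1 u (-1) v). t) =
      2 * (ip (A u) v + ip (A v) u)"
    unfolding form[OF D_lin[OF u v], symmetric] form_expand[OF u v] by (simp add: algebra_simps)
  then have "complex_of_real ((LINT t|sd (star_lin 1 u 1 v). t) - (LINT t|sd (star_lin 1 u (-1) v). t)) =
      of_real (4 * Re (ip (A u) v))"
    unfolding A_symmetric[OF u v] by (simp add: complex_eq_iff)
  then show ?thesis by (metis of_real_eq_iff)
qed

text \<open>Weak commutation of A with E(S). By \<open>form_polar\<close> both sides are differences
  of first moments, and the underlying differences of measures agree: on every T both equal 4 Re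
  (E(T) E(S) u, v).\<close>

lemma form_E_Re:
  assumes u: "u \<in> D" and v: "v \<in> D" and S: "S \<in> sets borel"
  shows "Re (ip (A (E S u)) v) = Re (ip (A u) (E S v))"
proof -
  note Eu = E_D[OF u S] and Ev = E_D[OF v S]
  note L = D_L2[OF u] D_L2[OF v] D_L2[OF Eu] D_L2[OF Ev]
  have "(LINT t|sd (star_lin 1 (E S u) 1 v). t) + (LINT t|sd (star_lin 1 u (-1) (E S v)). t) =
      (LINT t|sd (star_lin 1 u 1 (E S v)). t) + (LINT t|sd (star_lin 1 (E S u) (-1) v). t)"
  proof (rule integral_measure_add)
    fix T :: "real set" assume T: "T \<in> sets borel"
    have "ip (E T (E S u)) v = ip (E T u) (E S v)" using ip_E_E[OF T S L(1,2)] by simp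
    then show "emeasure (sd (star_lin 1 (E S u) 1 v)) T + emeasure (sd (star_lin 1 u (-1) (E S v))) T =
      emeasure (sd (star_lin 1 u 1 (E S v))) T + emeasure (sd (star_lin 1 (E S u) (-1) v)) T"
      using measure_sd_add_diff(1)[OF L(3,2) T] measure_sd_add_diff(1)[OF L(1,4) T] L
      by (simp add: emeasure_eq_measure_sd star_lin_L2 ennreal_plus[symmetric] del: ennreal_plus)
  qed (auto intro!: integrable_id D_lin u v Eu Ev)
  then show ?thesis using form_polar[OF Eu v] form_polar[OF u Ev] by simp
qed

lemma form_E:
  assumes u: "u \<in> D" and v: "v \<in> D" and S: "S \<in> sets borel"
  shows "ip (A (E S u)) v = ip (A u) (E S v)"
proof -
  note Eu = E_D[OF u S] and Ev = E_D[OF v S]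
  \<comment> \<open>Testing against i v converts imaginary parts into real ones; the zero summand
    only brings i v into the form of \<open>star_lin\<close>.\<close>
  let ?iv = "star_lin \<i> v 0 v"
  have "Re (ip (A (E S u)) ?iv) = Re (ip (A u) (E S ?iv))"
    using u v S D_lin by (intro form_E_Re) auto
  also have "ip (A u) (E S ?iv) = ip (A u) (star_lin \<i> (E S v) 0 (E S v))"
    using u v S by (intro star_inner_cong E_lin D_L2 A_L2 D_lin star_lin_L2 E_L2) auto
  finally have "Im (ip (A (E S u)) v) = Im (ip (A u) (E S v))"
    using u v Eu Ev by (simp add: star_inner_lin_right D_L2 A_L2)
  then show ?thesis using form_E_Re[OF assms] by (simp add: complex_eq_iff)
qed

text \<open>As E(T) is idempotent, one of its two copies can be moved to the left by
  \<open>form_E\<close>; then the first moment formula holds for the measure cut off to T.\<close>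

lemma form_E_self:
  assumes u: "u \<in> D" and T: "T \<in> sets borel"
  shows "ip (A u) (E T u) = of_real (LINT t|sd u. indicator T t * t)"
proof -
  note L = D_L2[OF u]
  have "ip (A u) (E T u) = ip (A u) (E T (E T u))"
    using E_Int[OF T T L] L u T by (intro star_inner_cong A_L2 E_L2) auto
  also have "\<dots> = ip (A (E T u)) (E T u)" using form_E[OF u E_D[OF u T] T] by simp
  also have "\<dots> = of_real (LINT t|sd u. indicator T t * t)"
    unfolding form[OF E_D[OF u T]] using L T by (simp add: integral_sd_E)
  finally show ?thesis .
qed

text \<open>For bounded S the vector p = E(S) A u lies in the domain, so with y = E(S) u the number
  (p, p) = (A y, p) can be evaluated by \<open>form_polar\<close>. The spectral measures of y + p
  and y - p differ by the density 4 t with respect to that of y, and integrating t against this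
  gives 4 t^2.\<close>

lemma norm_E_A:
  assumes u: "u \<in> D" and S: "S \<in> sets borel" "bounded S"
  shows "Re (ip (E S (A u)) (E S (A u))) = (LINT t|sd u. indicator S t * t\<^sup>2)"
proof -
  let ?y = "E S u" and ?p = "E S (A u)"
  have y: "?y \<in> D" by (rule E_D[OF u S(1)])
  have p: "?p \<in> D" by (rule E_bounded_D[OF A_L2[OF u] S])
  note L = D_L2[OF u] D_L2[OF y] D_L2[OF p] A_L2[OF u] A_L2[OF y]
  have pp: "ip ?p ?p = ip (A ?y) ?p"
    using E_sym[OF S(1) L(4,3)] form_E[OF u p S(1)] by simp
  have bnd: "\<bar>t * (4 * max 0 t)\<bar> \<le> 4 * t\<^sup>2" "\<bar>t * (4 * max 0 (-t))\<bar> \<le> 4 * t\<^sup>2" for t :: real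
    by (auto simp: max_def power2_eq_square abs_mult)
  have i1: "integrable (sd ?y) (\<lambda>t. 4 * max 0 t * t)"
    by (rule Bochner_Integration.integrable_bound[OF integrable_mult_right[OF integrable_square[OF y], of 4]])
      (use bnd(1) in \<open>auto simp: mult.commute mult.left_commute\<close>)
  have i2: "integrable (sd ?y) (\<lambda>t. 4 * max 0 (-t) * t)"
    by (rule Bochner_Integration.integrable_bound[OF integrable_mult_right[OF integrable_square[OF y], of 4]])
      (use bnd(2) in \<open>auto simp: mult.commute mult.left_commute\<close>)
  \<comment> \<open>Positive and negative parts of the signed density 4 t; they go to opposite sides
    of the equation, so that only positive measures occur.\<close>
  let ?P = "density (sd ?y) (\<lambda>t. ennreal (4 * max 0 t))" and ?M = "density (sd ?y) (\<lambda>t. ennreal (4 * max 0 (-t)))"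
  have "(LINT t|sd (star_lin 1 ?y 1 ?p). t) + (LINT t|?M. t) = (LINT t|sd (star_lin 1 ?y (-1) ?p). t) + (LINT t|?P. t)"
  proof (rule integral_measure_add)
    fix T :: "real set" assume T: "T \<in> sets borel"
    have iT: "integrable (sd ?y) (\<lambda>t. indicator T t * g t)" if "g \<in> borel_measurable borel" "\<And>t. \<bar>g t\<bar> \<le> 4 * \<bar>t\<bar>" for g :: "real \<Rightarrow> real"
      by (rule Bochner_Integration.integrable_bound[OF integrable_mult_right[OF integrable_norm[OF integrable_id[OF y]], of 4]])
        (use that T in \<open>auto simp: indicator_def intro!: borel_measurable_times\<close>)
    have iP: "integrable (sd ?y) (\<lambda>t. indicator T t * (4 * max 0 t))"
      and iM: "integrable (sd ?y) (\<lambda>t. indicator T t * (4 * max 0 (-t)))"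
      by (intro iT; (measurable | simp add: max_def))+
    have eP: "emeasure ?P T = ennreal (LINT t|sd ?y. indicator T t * (4 * max 0 t))"
      using T nn_integral_eq_integral[OF iP]
      by (simp add: emeasure_density ennreal_mult' mult.commute ennreal_indicator[symmetric])
    have eM: "emeasure ?M T = ennreal (LINT t|sd ?y. indicator T t * (4 * max 0 (-t)))"
      using T nn_integral_eq_integral[OF iM]
      by (simp add: emeasure_density ennreal_mult' mult.commute ennreal_indicator[symmetric])
    have "ip (E T ?y) ?p = ip (E S (E T ?y)) (A u)"
      using E_sym[OF S(1), of "E T ?y" "A u"] L E_L2[OF T] by simp
    also have "\<dots> = cnj (ip (A u) (E S (E T ?y)))" by (rule star_inner_sym)
    also have "ip (A u) (E S (E T ?y)) = ip (A ?y) (E T ?y)"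
      using form_E[OF u E_D[OF y T] S(1)] by simp
    also have "\<dots> = of_real (LINT t|sd ?y. indicator T t * t)" by (rule form_E_self[OF y T])
    finally have "4 * Re (ip (E T ?y) ?p) = (LINT t|sd ?y. 4 * (indicator T t * t))" by simp
    also have "\<dots> = (LINT t|sd ?y. indicator T t * (4 * max 0 t) - indicator T t * (4 * max 0 (-t)))"
      by (intro Bochner_Integration.integral_cong refl) (auto simp: max_def)
    also have "\<dots> = (LINT t|sd ?y. indicator T t * (4 * max 0 t)) - (LINT t|sd ?y. indicator T t * (4 * max 0 (-t)))"
      by (rule Bochner_Integration.integral_diff[OF iP iM])
    finally have eq: "measure (sd (star_lin 1 ?y 1 ?p)) T + (LINT t|sd ?y. indicator T t * (4 * max 0 (-t))) =
        measure (sd (star_lin 1 ?y (-1) ?p)) T + (LINT t|sd ?y. indicator T t * (4 * max 0 t))"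
      using measure_sd_add_diff(1)[OF L(2,3) T] by simp
    show "emeasure (sd (star_lin 1 ?y 1 ?p)) T + emeasure ?M T =
        emeasure (sd (star_lin 1 ?y (-1) ?p)) T + emeasure ?P T"
      unfolding eP eM using eq L
      by (simp add: emeasure_eq_measure_sd star_lin_L2 ennreal_plus[symmetric] Bochner_Integration.integral_nonneg del: ennreal_plus)
  next
    show "integrable ?P (\<lambda>t. t)" "integrable ?M (\<lambda>t. t)"
      using i1 i2 by (auto simp: integrable_density)
  qed (auto intro!: integrable_id D_lin y p)
  moreover have "(LINT t|?P. t) - (LINT t|?M. t) = (LINT t|sd ?y. 4 * t\<^sup>2)"
  proof -
    have "(LINT t|?P. t) - (LINT t|?M. t) = (LINT t|sd ?y. 4 * max 0 t * t) - (LINT t|sd ?y. 4 * max 0 (-t) * t)"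
      by (simp add: integral_density)
    also have "\<dots> = (LINT t|sd ?y. 4 * max 0 t * t - 4 * max 0 (-t) * t)"
      by (rule Bochner_Integration.integral_diff[OF i1 i2, symmetric])
    also have "\<dots> = (LINT t|sd ?y. 4 * t\<^sup>2)"
      by (intro Bochner_Integration.integral_cong refl) (auto simp: max_def power2_eq_square)
    finally show ?thesis .
  qed
  ultimately have "4 * Re (ip (A ?y) ?p) = (LINT t|sd ?y. 4 * t\<^sup>2)"
    using form_polar[OF y p] by simp
  then have "Re (ip ?p ?p) = (LINT t|sd ?y. t\<^sup>2)" by (simp add: pp)
  then show ?thesis using L(1) S(1) by (simp add: integral_sd_E)
qed

text \<open>Expands the norm of E(S) A u - z E(S) u. The moments of order 0, 1 and 2 over S are
  known by now and assemble to |t - z|^2.\<close>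

lemma measure_sd_resolvent:
  assumes u: "u \<in> D" and f: "f \<in> H" "star_eq n f (star_lin 1 (A u) (-z) u)"
    and S: "S \<in> sets borel" "bounded S"
  shows "measure (sd f) S = (LINT t|sd u. indicator S t * (cmod (of_real t - z))\<^sup>2)"
proof -
  let ?y = "E S u" and ?p = "E S (A u)"
  note L = D_L2[OF u] A_L2[OF u]
  have LE: "?y \<in> H" "?p \<in> H" using L S by (auto intro: E_L2)
  have "star_eq n (E S f) (star_lin 1 ?p (-z) ?y)"
    using E_cong[OF S(1) f(1) _ f(2)] E_lin[OF S(1) L(2,1), of 1 "-z"] L star_lin_L2 star_eq_trans by blast
  then have "ip (E S f) (E S f) = ip (star_lin 1 ?p (-z) ?y) (star_lin 1 ?p (-z) ?y)"
    using f S L LE by (intro star_inner_cong E_L2 star_lin_L2) auto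
  also have "\<dots> = ip ?p ?p - cnj z * ip ?p ?y - z * cnj (ip ?p ?y) + z * cnj z * ip ?y ?y"
    using LE star_inner_sym[of n ?y ?p]
    by (simp add: star_inner_lin_left star_inner_lin_right star_lin_L2 algebra_simps)
  finally have 1: "ip (E S f) (E S f) = ip ?p ?p - cnj z * ip ?p ?y - z * cnj (ip ?p ?y) + z * cnj z * ip ?y ?y" .
  have "ip ?p ?y = ip (A u) (E S ?y)" using E_sym[OF S(1) L(2) LE(1)] .
  also have "\<dots> = ip (A u) ?y"
    using star_eq_sym[OF E_Int[OF S(1) S(1) L(1)]] L LE S by (intro star_inner_cong E_L2) auto
  also have "\<dots> = of_real (LINT t|sd u. indicator S t * t)" by (rule form_E_self[OF u S(1)])
  finally have 2: "ip ?p ?y = of_real (LINT t|sd u. indicator S t * t)" .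
  have "Re (ip ?y ?y) = measure (sd u) S" using ip_E_E(2)[OF S(1) S(1) L(1) L(1)] by (simp add: measure_sd L S)
  then have 3: "ip ?y ?y = of_real (LINT t|sd u. indicator S t)"
    using star_inner_self_nonneg(2)[of n ?y] S by (simp add: complex_eq_iff)
  have i: "integrable (sd u) (\<lambda>t. indicator S t * t\<^sup>2)" "integrable (sd u) (\<lambda>t. indicator S t * t)"
      "integrable (sd u) (\<lambda>t. indicator S t :: real)"
    using integrable_mult_indicator[of S "sd u", OF _ integrable_square[OF u]]
      integrable_mult_indicator[of S "sd u", OF _ integrable_id[OF u]] S
      finite_measure.emeasure_finite[OF finite_measure_sd[OF L(1)]]
    by (auto simp: top.not_eq_extremum)
  have "measure (sd f) S = Re (ip (E S f) (E S f))"
    using ip_E_E(2)[OF S(1) S(1) f(1) f(1)] by (simp add: measure_sd f S)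
  also have "\<dots> = (LINT t|sd u. indicator S t * t\<^sup>2) - 2 * Re z * (LINT t|sd u. indicator S t * t)
      + (cmod z)\<^sup>2 * (LINT t|sd u. indicator S t)"
  proof -
    have "(cmod z)\<^sup>2 = Re z * Re z + Im z * Im z" by (simp add: cmod_power2) (simp add: power2_eq_square)
    then show ?thesis unfolding 1 2 3 using norm_E_A[OF u S] by simp
  qed
  also have "\<dots> = (LINT t|sd u. indicator S t * t\<^sup>2 - 2 * Re z * (indicator S t * t) + (cmod z)\<^sup>2 * indicator S t)"
    using i by simp
  also have "\<dots> = (LINT t|sd u. indicator S t * (cmod (of_real t - z))\<^sup>2)"
    by (intro Bochner_Integration.integral_cong refl) (simp add: cmod_power2 power2_diff algebra_simps)
  finally show ?thesis .
qed

lemma sd_resolvent: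
  assumes u: "u \<in> D" and f: "f \<in> H" "star_eq n f (star_lin 1 (A u) (-z) u)"
  shows "sd f = density (sd u) (\<lambda>t. ennreal ((cmod (of_real t - z))\<^sup>2))"
proof (rule measure_eqI)
  fix S assume "S \<in> sets (sd f)"
  then have S: "S \<in> sets borel" by simp
  let ?N = "density (sd u) (\<lambda>t. ennreal ((cmod (of_real t - z))\<^sup>2))"
  \<comment> \<open>The moment formula holds for bounded sets; both measures are continuous along
    this increasing sequence.\<close>
  define T where "T k = S \<inter> {- real k..real k}" for k
  have T: "T k \<in> sets borel" "bounded (T k)" for k
    using S by (auto simp: T_def intro: bounded_subset[OF bounded_closed_interval])
  have "emeasure (sd f) (T k) = emeasure ?N (T k)" for k
  proof -
    have m: "(\<lambda>t. (cmod (of_real t - z))\<^sup>2) \<in> borel_measurable borel" by measurable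
    have "integrable (sd u) (\<lambda>t. (cmod (of_real t - z))\<^sup>2)"
    proof -
      interpret finite_measure "sd u" using finite_measure_sd D_L2 u by blast
      have "integrable (sd u) (\<lambda>t. t\<^sup>2 - 2 * Re z * t + (cmod z)\<^sup>2)"
        using integrable_square[OF u] integrable_id[OF u] by simp
      then show ?thesis
        by (rule Bochner_Integration.integrable_cong[THEN iffD1, rotated 2])
          (auto simp: cmod_power2 power2_diff algebra_simps)
    qed
    then have i: "integrable (sd u) (\<lambda>t. indicator (T k) t * (cmod (of_real t - z))\<^sup>2)"
      using integrable_mult_indicator[of "T k" "sd u" "\<lambda>t. (cmod (of_real t - z))\<^sup>2"] T by simp
    have "emeasure ?N (T k) = (\<integral>\<^sup>+t. ennreal (indicator (T k) t * (cmod (of_real t - z))\<^sup>2) \<partial>sd u)"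
      using T m by (subst emeasure_density) (auto intro!: nn_integral_cong simp: indicator_def)
    also have "\<dots> = ennreal (LINT t|sd u. indicator (T k) t * (cmod (of_real t - z))\<^sup>2)"
      using i by (rule nn_integral_eq_integral) auto
    also have "\<dots> = emeasure (sd f) (T k)"
      using measure_sd_resolvent[OF u f T] f by (simp add: emeasure_eq_measure_sd)
    finally show ?thesis by simp
  qed
  moreover have "(SUP k. emeasure M (T k)) = emeasure M S" if "sets M = sets borel" for M
  proof -
    have "(\<Union>k. T k) = S"
      by (auto simp: T_def) (metis abs_le_iff minus_le_iff real_arch_simple)
    moreover have "incseq T" by (auto simp: T_def incseq_def)
    ultimately show ?thesis using SUP_emeasure_incseq[of T M] T that by auto
  qed
  ultimately show "emeasure (sd f) S = emeasure ?N S"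
    by (metis (no_types, lifting) sets_density sets_sd SUP_cong)
qed simp

text \<open>Both sides are the imaginary part of \<open>\<integral> 1/(t - cnj z) d\<mu>\<^sub>f(t)\<close>.\<close>

lemma Im_resolvent_form:
  assumes u: "u \<in> D" and f: "f \<in> H" "star_eq n f (star_lin 1 (A u) (-z) u)"
    and z: "z = Complex s (-\<epsilon>)" "\<epsilon> > 0"
  shows "Im (ip f u) = (LINT t|sd f. \<epsilon> / ((t - s)\<^sup>2 + \<epsilon>\<^sup>2))"
proof -
  note L = D_L2[OF u] A_L2[OF u]
  have "ip f u = ip (star_lin 1 (A u) (-z) u) u"
    using f L by (intro star_inner_cong star_lin_L2) auto
  also have "\<dots> = of_real (LINT t|sd u. t) - z * ip u u"
    using L by (simp add: star_inner_lin_left form[OF u])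
  finally have "Im (ip f u) = \<epsilon> * Re (ip u u)"
    using z star_inner_self_nonneg(2)[of n u] by simp
  also have "Re (ip u u) = (LINT t|sd u. 1)" using L by (simp add: measure_sd_UNIV)
  also have "\<epsilon> * (LINT t|sd u. 1) = (LINT t|sd u. (cmod (of_real t - z))\<^sup>2 * (\<epsilon> / ((t - s)\<^sup>2 + \<epsilon>\<^sup>2)))"
  proof -
    have "(cmod (of_real t - z))\<^sup>2 * (\<epsilon> / ((t - s)\<^sup>2 + \<epsilon>\<^sup>2)) = \<epsilon> * 1" for t
      using z by (simp add: cmod_power2 add_nonneg_pos)
    then show ?thesis by (simp only: Bochner_Integration.integral_mult_right_zero)
  qed
  also have "\<dots> = (LINT t|sd f. \<epsilon> / ((t - s)\<^sup>2 + \<epsilon>\<^sup>2))"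
    unfolding sd_resolvent[OF u f] by (subst integral_density) auto
  finally show ?thesis .
qed

end

subsection \<open>The square roots in the closed lower half plane\<close>

text \<open>For \<open>Im z \<le> 0\<close> this is \<open>i \<xi>\<^sub>k(z)\<close>: the branch of \<open>csqrt_low\<close> becomes the principal one.\<close>

definition kap :: "(nat \<Rightarrow> real) \<Rightarrow> (nat \<Rightarrow> real) \<Rightarrow> nat \<Rightarrow> complex \<Rightarrow> complex" where
  "kap c a k z = csqrt ((of_real (a k) - z) / of_real (c k))"

text \<open>The denominator of the vertex value. On the real axis it equals minus
  \<open>w_coeff\<close>, hence has the same modulus.\<close>

definition kapW :: "nat \<Rightarrow> (nat \<Rightarrow> real) \<Rightarrow> (nat \<Rightarrow> real) \<Rightarrow> complex \<Rightarrow> complex" where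
  "kapW n c a z = (\<Sum>k=1..n. of_real (c k) * kap c a k z)"

text \<open>For Im z \<ge> 0, the cut included, the sign in the imaginary part of
  \<open>csqrt\<close> is +1. The formula is therefore continuous up to the negative real axis,
  which is where the argument of the root ends up when \<epsilon> tends to 0 above a
  threshold.\<close>

lemma csqrt_upper_half:
  assumes "Im z \<ge> 0"
  shows "csqrt z = Complex (sqrt ((cmod z + Re z) / 2)) (sqrt ((cmod z - Re z) / 2))"
  using assms by (auto simp: complex_eq_iff sgn_if)

lemma continuous_on_csqrt_upper_half: "continuous_on {z. Im z \<ge> 0} csqrt"
proof -
  have "continuous_on {z. Im z \<ge> 0} (\<lambda>z. Complex (sqrt ((cmod z + Re z) / 2)) (sqrt ((cmod z - Re z) / 2)))"
    unfolding complex_eq by (intro continuous_intros) auto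
  then show ?thesis
    by (rule continuous_on_eq) (auto simp: csqrt_upper_half simp del: csqrt.sel)
qed

lemma csqrt_upper_half_Re_Im:
  assumes "Im z \<ge> 0" shows "Re (csqrt z) \<ge> 0" "Im (csqrt z) \<ge> 0"
  using assms abs_Re_le_cmod[of z] by (auto simp: sgn_if)

lemma kap_arg:
  assumes "0 < c k" "Im z \<le> 0"
  shows "Im ((of_real (a k) - z) / of_real (c k)) \<ge> 0"
  using assms divide_nonpos_pos[of "Im z" "c k"] by (simp add: Im_divide_of_real)

lemma kap_power2: "c k \<noteq> 0 \<Longrightarrow> of_real (c k) * (kap c a k z)\<^sup>2 = of_real (a k) - z"
  by (simp add: kap_def)

lemma kap_nonneg:
  assumes "0 < c k" "Im z \<le> 0" shows "Re (kap c a k z) \<ge> 0" "Im (kap c a k z) \<ge> 0"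
  unfolding kap_def using kap_arg[of c k z a, OF assms] by (intro csqrt_upper_half_Re_Im; assumption)+

text \<open>An imaginary \<kappa> would have a real square, whereas c \<kappa>^2 = a - z is not
  real. This is the decay that makes the resolvent square-integrable.\<close>

lemma kap_Re_pos:
  assumes "0 < c k" "Im z < 0" shows "Re (kap c a k z) > 0"
proof (rule ccontr)
  assume "\<not> Re (kap c a k z) > 0"
  then have "Re (kap c a k z) = 0" using kap_nonneg(1)[of c k z a] assms by auto
  then have "Im (of_real (c k) * (kap c a k z)\<^sup>2) = 0" by (simp add: power2_eq_square)
  then show False using kap_power2[of c k a z] assms by simp
qed

lemma continuous_on_kap:
  assumes "0 < c k" shows "continuous_on {z. Im z \<le> 0} (kap c a k)"
  unfolding kap_def
  by (rule continuous_on_compose2[OF continuous_on_csqrt_upper_half])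
    (use assms kap_arg in \<open>auto intro!: continuous_intros\<close>)

lemma cmod_kap: "0 < c k \<Longrightarrow> cmod (kap c a k z) = sqrt (cmod (of_real (a k) - z) / c k)"
  by (simp add: kap_def norm_divide)

lemma continuous_on_kapW:
  assumes "\<And>k. k \<in> {1..n} \<Longrightarrow> 0 < c k" shows "continuous_on {z. Im z \<le> 0} (kapW n c a)"
  unfolding kapW_def using assms by (intro continuous_intros continuous_on_kap) auto

text \<open>All summands of W lie in the closed first quadrant, so real and imaginary parts add up
  without cancellation. The factor 2 arises because Re W and Im W are each at most |W|.\<close>

lemma kapW_lower:
  assumes c: "\<And>k. k \<in> {1..n} \<Longrightarrow> 0 < c k" and z: "Im z \<le> 0" and k: "k \<in> {1..n}"
  shows "c k * cmod (kap c a k z) \<le> 2 * cmod (kapW n c a z)"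
proof -
  have nn: "0 \<le> Re (kap c a j z)" "0 \<le> Im (kap c a j z)" "0 < c j" if "j \<in> {1..n}" for j
    using kap_nonneg[of c j z a] c[OF that] z by auto
  have "c k * cmod (kap c a k z) \<le> c k * (Re (kap c a k z) + Im (kap c a k z))"
    using cmod_le[of "kap c a k z"] nn[OF k] by (intro mult_left_mono) auto
  also have "\<dots> \<le> (\<Sum>j=1..n. c j * (Re (kap c a j z) + Im (kap c a j z)))"
  proof (rule member_le_sum[OF k])
    show "0 \<le> c j * (Re (kap c a j z) + Im (kap c a j z))" if "j \<in> {1..n} - {k}" for j
      using nn[of j] that by (intro mult_nonneg_nonneg add_nonneg_nonneg) (auto intro: less_imp_le)
  qed simp
  also have "\<dots> = Re (kapW n c a z) + Im (kapW n c a z)"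
    by (simp add: kapW_def sum.distrib distrib_left)
  also have "\<dots> \<le> 2 * cmod (kapW n c a z)"
    using complex_Re_le_cmod[of "kapW n c a z"] abs_Im_le_cmod[of "kapW n c a z"] by linarith
  finally show ?thesis .
qed

subsection \<open>The fundamental solutions\<close>

definition expm :: "complex \<Rightarrow> real \<Rightarrow> complex" where
  "expm \<kappa> x = exp (- (\<kappa> * of_real x))"

text \<open>The solution of u'' = \<kappa>^2 u with value 0 and derivative 1 at the vertex; at
  \<kappa> = 0 the limit x is inserted, so that thresholds are not exceptional.\<close>

definition sinhq :: "complex \<Rightarrow> real \<Rightarrow> complex" where
  "sinhq \<kappa> x = (if \<kappa> = 0 then of_real x else sinh (\<kappa> * of_real x) / \<kappa>)"

text \<open>Green function of -u'' + \<kappa>^2 u on the half line with Dirichlet condition at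
  0.\<close>

definition green :: "complex \<Rightarrow> real \<Rightarrow> real \<Rightarrow> complex" where
  "green \<kappa> x y = sinhq \<kappa> (min x y) * expm \<kappa> (max x y)"

lemma expm_0 [simp]: "expm \<kappa> 0 = 1" and sinhq_0 [simp]: "sinhq \<kappa> 0 = 0"
  by (auto simp: expm_def sinhq_def)

lemma expm_has_derivative: "(expm \<kappa> has_vector_derivative - \<kappa> * expm \<kappa> x) (at x within S)"
proof -
  have "((\<lambda>w. exp (- (\<kappa> * w))) has_field_derivative - \<kappa> * expm \<kappa> x) (at (of_real x))"
    by (auto intro!: derivative_eq_intros simp: expm_def)
  from has_vector_derivative_real_field[OF this] show ?thesis by (simp add: expm_def[abs_def])
qed

lemma sinhq_has_derivative: "(sinhq \<kappa> has_vector_derivative cosh (\<kappa> * of_real x)) (at x within S)"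
proof (cases "\<kappa> = 0")
  case True
  then show ?thesis by (auto simp: sinhq_def[abs_def] intro!: derivative_eq_intros)
next
  case False
  have "((\<lambda>w. sinh (\<kappa> * w) / \<kappa>) has_field_derivative cosh (\<kappa> * of_real x)) (at (of_real x))"
    using False by (auto intro!: derivative_eq_intros)
  from has_vector_derivative_real_field[OF this] show ?thesis using False by (simp add: sinhq_def[abs_def])
qed

lemma cosh_has_derivative:
  "((\<lambda>x. cosh (\<kappa> * of_real x)) has_vector_derivative \<kappa>\<^sup>2 * sinhq \<kappa> x) (at x within S)"
proof -
  have "((\<lambda>w. cosh (\<kappa> * w)) has_field_derivative \<kappa>\<^sup>2 * sinhq \<kappa> x) (at (of_real x))"
    by (auto intro!: derivative_eq_intros simp: sinhq_def power2_eq_square)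
  from has_vector_derivative_real_field[OF this] show ?thesis .
qed

lemma wronskian: "expm \<kappa> x * cosh (\<kappa> * of_real x) + \<kappa> * expm \<kappa> x * sinhq \<kappa> x = 1"
proof -
  have "expm \<kappa> x * (cosh (\<kappa> * of_real x) + sinh (\<kappa> * of_real x)) = 1"
    by (simp add: cosh_plus_sinh expm_def exp_minus)
  then show ?thesis by (cases "\<kappa> = 0") (auto simp: sinhq_def algebra_simps)
qed

lemma continuous_on_expm [continuous_intros]:
  "continuous_on S f \<Longrightarrow> continuous_on S g \<Longrightarrow> continuous_on S (\<lambda>p. expm (f p) (g p))"
  unfolding expm_def by (intro continuous_intros)

text \<open>A representation without case distinction at \<kappa> = 0 and without division; joint
  continuity in \<kappa> and x is immediate from it.\<close>

lemma sinhq_integral: "sinhq \<kappa> x = integral {0..1} (\<lambda>t. of_real x * cosh (\<kappa> * of_real x * of_real t))"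
proof -
  have "((\<lambda>t. of_real x * sinhq (\<kappa> * of_real x) t) has_vector_derivative of_real x * cosh (\<kappa> * of_real x * of_real t)) (at t within {0..1})" for t
    using has_vector_derivative_mult_right[OF sinhq_has_derivative] by blast
  then have "((\<lambda>t. of_real x * cosh (\<kappa> * of_real x * of_real t)) has_integral
      (of_real x * sinhq (\<kappa> * of_real x) 1 - of_real x * sinhq (\<kappa> * of_real x) 0)) {0..1}"
    by (intro fundamental_theorem_of_calculus) auto
  moreover have "of_real x * sinhq (\<kappa> * of_real x) 1 = sinhq \<kappa> x"
    by (auto simp: sinhq_def)
  ultimately show ?thesis by (metis diff_zero integral_unique mult_zero_right sinhq_0)
qed

lemma continuous_on_sinhq [continuous_intros]:
  fixes f :: "'a::topological_space \<Rightarrow> complex"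
  assumes f: "continuous_on S f" and g: "continuous_on S g"
  shows "continuous_on S (\<lambda>p. sinhq (f p) (g p))"
proof -
  have "continuous_on S (\<lambda>p. integral (cbox 0 1) (\<lambda>t::real. of_real (g p) * cosh (f p * of_real (g p) * of_real t)))"
    by (rule integral_continuous_on_param)
      (auto simp: case_prod_beta intro!: continuous_intros continuous_on_compose2[OF f] continuous_on_compose2[OF g])
  then show ?thesis by (simp add: sinhq_integral)
qed

lemma continuous_on_green [continuous_intros]:
  fixes f :: "'a::topological_space \<Rightarrow> complex"
  assumes "continuous_on S f" "continuous_on S g" "continuous_on S h"
  shows "continuous_on S (\<lambda>p. green (f p) (g p) (h p))"
  unfolding green_def using assms by (intro continuous_intros)

lemma green_sym: "green \<kappa> x y = green \<kappa> y x"
  by (simp add: green_def min.commute max.commute)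

subsection \<open>Integrals over the half line\<close>

lemma half_line_integral:
  fixes g :: "real \<Rightarrow> complex"
  assumes cont: "continuous_on {0..R} g" and supp: "\<And>x. x > R \<Longrightarrow> g x = 0"
  shows "(LINT x|lebesgue_on {0<..}. g x) = integral {0..R} g"
proof -
  have "set_integrable lebesgue {0..R} g" by (rule absolutely_integrable_continuous_real[OF cont])
  then have "(LINT x:{0..R}|lebesgue. g x) = integral {0..R} g"
    by (rule set_lebesgue_integral_eq_integral)
  moreover have "(LINT x:{0..R}|lebesgue. g x) = (LINT x:{0<..}|lebesgue. g x)"
    unfolding set_lebesgue_integral_def
  proof (rule integral_cong_AE)
    have m: "(\<lambda>x. indicator {0..R} x *\<^sub>R g x) \<in> borel_measurable lebesgue"
      using borel_measurable_continuous_on_indicator[OF _ cont] by (intro measurable_completion) simp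
    then show "(\<lambda>x. indicator {0..R} x *\<^sub>R g x) \<in> borel_measurable lebesgue" .
    have "(\<lambda>x. indicator {0<..} x *\<^sub>R g x) = (\<lambda>x. indicator {0<..} x *\<^sub>R (indicator {0..R} x *\<^sub>R g x))"
    proof
      fix x show "indicator {0<..} x *\<^sub>R g x = indicator {0<..} x *\<^sub>R (indicator {0..R} x *\<^sub>R g x)"
        using supp[of x] by (cases "x > R") (auto simp: indicator_def)
    qed
    moreover have "(\<lambda>x. indicator {0<..} x *\<^sub>R (indicator {0..R} x *\<^sub>R g x)) \<in> borel_measurable lebesgue"
      by (rule borel_measurable_scaleR[OF borel_measurable_indicator m]) simp
    ultimately show "(\<lambda>x. indicator {0<..} x *\<^sub>R g x) \<in> borel_measurable lebesgue" by simp
    have "AE x in lebesgue. x \<notin> {0::real}" by (rule AE_not_in) simp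
    then show "AE x in lebesgue. indicator {0..R} x *\<^sub>R g x = indicator {0<..} x *\<^sub>R g x"
    proof (rule eventually_mono)
      fix x :: real assume "x \<notin> {0}"
      then show "indicator {0..R} x *\<^sub>R g x = indicator {0<..} x *\<^sub>R g x"
        using supp[of x] by (cases "x > R") (auto simp: indicator_def)
    qed
  qed
  ultimately show ?thesis
    by (simp add: integral_restrict_space set_lebesgue_integral_def)
qed

text \<open>Up to R the function is bounded, beyond R its square decays like exp(-2 (Re \<kappa>)
  x).\<close>

lemma exp_tail_L2_half:
  assumes cont: "continuous_on {0..} v" and \<kappa>: "Re \<kappa> > 0" and tail: "\<And>x. x \<ge> R \<Longrightarrow> v x = C * expm \<kappa> x"
  shows "v \<in> L2_half"
proof -
  have m: "(\<lambda>x. indicator {0<..} x *\<^sub>R v x) \<in> borel_measurable lebesgue"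
    by (intro measurable_completion) (simp, intro borel_measurable_continuous_on_indicator continuous_on_subset[OF cont], auto)
  have "compact (v ` {0..R})" by (intro compact_continuous_image continuous_on_subset[OF cont]) auto
  then obtain B where B: "\<And>x. x \<in> {0..R} \<Longrightarrow> cmod (v x) \<le> B"
    by (metis bounded_iff compact_imp_bounded imageI)
  have "integrable lebesgue (\<lambda>x. indicator {0<..} x *\<^sub>R (cmod (v x))\<^sup>2)"
  proof (rule Bochner_Integration.integrable_bound)
    have "set_integrable lebesgue {0..} (\<lambda>x::real. exp (- (2 * Re \<kappa>) * x))"
      using has_integral_exp_minus_to_infinity[of "2 * Re \<kappa>" 0] \<kappa>
      by (intro nonnegative_absolutely_integrable_1) (auto simp: integrable_on_def)
    then have "integrable lebesgue (\<lambda>x. indicator {0..} x *\<^sub>R exp (- (2 * Re \<kappa>) * x))"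
      by (simp add: set_integrable_def)
    then show "integrable lebesgue (\<lambda>x. B\<^sup>2 * indicator {0..R} x + (cmod C)\<^sup>2 * (indicator {0..} x *\<^sub>R exp (- (2 * Re \<kappa>) * x)))"
      by (cases "R \<ge> 0") auto
    have "(\<lambda>x. (cmod (indicator {0<..} x *\<^sub>R v x))\<^sup>2) \<in> borel_measurable lebesgue"
      using m by measurable
    then show "(\<lambda>x. indicator {0<..} x *\<^sub>R (cmod (v x))\<^sup>2) \<in> borel_measurable lebesgue"
      by (rule measurable_cong[THEN iffD1, rotated]) (auto simp: indicator_def)
    have 1: "(cmod (v x))\<^sup>2 \<le> B\<^sup>2" if "x \<in> {0..R}" for x using B[OF that] by (intro power_mono) auto
    have 2: "(cmod (v x))\<^sup>2 = (cmod C)\<^sup>2 * exp (- (2 * Re \<kappa>) * x)" if "x \<ge> R" for x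
      using tail[OF that]
      by (simp add: norm_mult expm_def power_mult_distrib exp_double[symmetric] mult.assoc)
    show "AE x in lebesgue. norm (indicator {0<..} x *\<^sub>R (cmod (v x))\<^sup>2) \<le>
        norm (B\<^sup>2 * indicator {0..R} x + (cmod C)\<^sup>2 * (indicator {0..} x *\<^sub>R exp (- (2 * Re \<kappa>) * x)))"
    proof (rule AE_I2)
      fix x :: real
      show "norm (indicator {0<..} x *\<^sub>R (cmod (v x))\<^sup>2) \<le>
        norm (B\<^sup>2 * indicator {0..R} x + (cmod C)\<^sup>2 * (indicator {0..} x *\<^sub>R exp (- (2 * Re \<kappa>) * x)))"
        using 1[of x] 2[of x] by (cases "x > 0"; cases "x \<le> R") (auto simp: indicator_def intro: add_increasing2)
    qed
  qed
  moreover have "v \<in> borel_measurable (lebesgue_on {0<..})"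
    using m by (simp add: borel_measurable_restrict_space_iff)
  ultimately show ?thesis by (simp add: L2_half_def integrable_restrict_space)
qed

lemma half_line_by_parts:
  fixes u u' :: "real \<Rightarrow> complex"
  assumes u: "\<And>x. x \<ge> 0 \<Longrightarrow> (u has_vector_derivative u' x) (at x within {0..})"
    and u': "continuous_on {0..} u'" and t: "test_fun \<phi>"
  shows "(LINT x|lebesgue_on {0<..}. u x * of_real (deriv \<phi> x)) = - (LINT x|lebesgue_on {0<..}. u' x * of_real (\<phi> x))"
proof -
  obtain r R where R: "0 < r" "r < R" "\<And>x. x \<le> r \<Longrightarrow> \<phi> x = 0" "\<And>x. x \<ge> R \<Longrightarrow> \<phi> x = 0"
    by (rule test_fun_support[OF t]) blast
  obtain r' R' where R': "0 < r'" "r' < R'" "\<And>x. x \<le> r' \<Longrightarrow> deriv \<phi> x = 0" "\<And>x. x \<ge> R' \<Longrightarrow> deriv \<phi> x = 0"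
    by (rule test_fun_support[OF test_fun_deriv[OF t]]) blast
  \<comment> \<open>One interval beyond the supports of \<phi> and of its derivative, which are
    obtained independently.\<close>
  define M where "M = max R R'"
  have cu: "continuous_on {0..} u"
    using u by (intro continuous_on_vector_derivative[of _ u u']) auto
  have c1: "continuous_on {0..M} (\<lambda>x. u x * of_real (deriv \<phi> x))"
    "continuous_on {0..M} (\<lambda>x. u' x * of_real (\<phi> x))"
    by (auto intro!: continuous_intros test_fun_continuous test_fun_deriv t
        continuous_on_subset[OF cu] continuous_on_subset[OF u'])
  have d: "((\<lambda>x. u x * of_real (\<phi> x)) has_vector_derivative (u x * of_real (deriv \<phi> x) + u' x * of_real (\<phi> x))) (at x within {0..M})"
    if "x \<in> {0..M}" for x
  proof (rule has_vector_derivative_mult)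
    show "(u has_vector_derivative u' x) (at x within {0..M})"
      using u[of x] that by (auto intro: has_vector_derivative_within_subset)
    have "(\<phi> has_vector_derivative deriv \<phi> x) (at x within {0..M})"
      using test_fun_has_derivative[OF t, of x]
      by (auto simp: has_real_derivative_iff_has_vector_derivative[symmetric] intro: DERIV_subset)
    then show "((\<lambda>x. complex_of_real (\<phi> x)) has_vector_derivative of_real (deriv \<phi> x)) (at x within {0..M})"
      by (rule bounded_linear.has_vector_derivative[OF bounded_linear_of_real])
  qed
  have "((\<lambda>x. u x * of_real (deriv \<phi> x) + u' x * of_real (\<phi> x)) has_integral
      (u M * of_real (\<phi> M) - u 0 * of_real (\<phi> 0))) {0..M}"
    by (rule fundamental_theorem_of_calculus[OF _ d]) (use R in \<open>auto simp: M_def\<close>)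
  moreover have "\<phi> M = 0" "\<phi> 0 = 0" using R by (auto simp: M_def)
  ultimately have "integral {0..M} (\<lambda>x. u x * of_real (deriv \<phi> x) + u' x * of_real (\<phi> x)) = 0"
    by (simp add: integral_unique)
  then have "integral {0..M} (\<lambda>x. u x * of_real (deriv \<phi> x)) + integral {0..M} (\<lambda>x. u' x * of_real (\<phi> x)) = 0"
    using c1 by (subst (asm) Henstock_Kurzweil_Integration.integral_add) (auto intro: integrable_continuous_real)
  moreover have "(LINT x|lebesgue_on {0<..}. u x * of_real (deriv \<phi> x)) = integral {0..M} (\<lambda>x. u x * of_real (deriv \<phi> x))"
    by (rule half_line_integral[OF c1(1)]) (use R' in \<open>auto simp: M_def\<close>)
  moreover have "(LINT x|lebesgue_on {0<..}. u' x * of_real (\<phi> x)) = integral {0..M} (\<lambda>x. u' x * of_real (\<phi> x))"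
    by (rule half_line_integral[OF c1(2)]) (use R in \<open>auto simp: M_def\<close>)
  ultimately show ?thesis by (simp add: add_eq_0_iff)
qed

lemma H2_half_classical:
  assumes u: "\<And>x. x \<ge> 0 \<Longrightarrow> (u has_vector_derivative u' x) (at x within {0..})"
    and u': "\<And>x. x \<ge> 0 \<Longrightarrow> (u' has_vector_derivative u'' x) (at x within {0..})"
    and u'': "continuous_on {0..} u''"
    and L: "u \<in> L2_half" "u' \<in> L2_half" "u'' \<in> L2_half"
  shows "u \<in> H2_half" "weak_deriv 2 u u''"
proof -
  have c: "continuous_on {0..} u'"
    using u' by (intro continuous_on_vector_derivative[of _ u' u'']) auto
  have 1: "weak_deriv 1 u u'"
    unfolding weak_deriv_def using half_line_by_parts[OF u c] by simp
  show 2: "weak_deriv 2 u u''"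
    unfolding weak_deriv_def
  proof (intro allI impI)
    fix \<phi> assume t: "test_fun \<phi>"
    have "(LINT x|lebesgue_on {0<..}. u x * of_real ((deriv ^^ 2) \<phi> x)) =
        (LINT x|lebesgue_on {0<..}. u x * of_real (deriv (deriv \<phi>) x))"
      by (simp add: numeral_2_eq_2)
    also have "\<dots> = - (LINT x|lebesgue_on {0<..}. u' x * of_real (deriv \<phi> x))"
      by (rule half_line_by_parts[OF u c test_fun_deriv[OF t]])
    also have "\<dots> = (LINT x|lebesgue_on {0<..}. u'' x * of_real (\<phi> x))"
      using half_line_by_parts[OF u' u'' t] by simp
    finally show "(LINT x|lebesgue_on {0<..}. u x * of_real ((deriv ^^ 2) \<phi> x)) =
      (- 1)\<^sup>2 * (LINT x|lebesgue_on {0<..}. u'' x * of_real (\<phi> x))" by simp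
  qed
  show "u \<in> H2_half" unfolding H2_half_def using L 1 2 by auto
qed

subsection \<open>The resolvent\<close>

text \<open>Variation of constants for -c u'' + c \<kappa>^2 u = f with vertex value U, where R
  bounds the support of f. The integral from x to R is written as a difference of integrals from 0,
  so that the same formula can be differentiated also for x > R.\<close>

definition branch_sol :: "complex \<Rightarrow> real \<Rightarrow> complex \<Rightarrow> (real \<Rightarrow> complex) \<Rightarrow> real \<Rightarrow> real \<Rightarrow> complex" where
  "branch_sol \<kappa> c U f R x =
    (expm \<kappa> x * integral {0..x} (\<lambda>y. sinhq \<kappa> y * f y) +
     sinhq \<kappa> x * (integral {0..R} (\<lambda>y. expm \<kappa> y * f y) - integral {0..x} (\<lambda>y. expm \<kappa> y * f y))) / of_real c
    + U * expm \<kappa> x"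

text \<open>The derivative of \<open>branch_sol\<close>; the two terms from differentiating the
  integrals cancel.\<close>

definition branch_sol' :: "complex \<Rightarrow> real \<Rightarrow> complex \<Rightarrow> (real \<Rightarrow> complex) \<Rightarrow> real \<Rightarrow> real \<Rightarrow> complex" where
  "branch_sol' \<kappa> c U f R x =
    (- \<kappa> * expm \<kappa> x * integral {0..x} (\<lambda>y. sinhq \<kappa> y * f y) +
     cosh (\<kappa> * of_real x) * (integral {0..R} (\<lambda>y. expm \<kappa> y * f y) - integral {0..x} (\<lambda>y. expm \<kappa> y * f y))) / of_real c
    - U * \<kappa> * expm \<kappa> x"

lemma integral_has_vector_derivative_half_line:
  fixes g :: "real \<Rightarrow> complex"
  assumes g: "continuous_on {0..} g" and x: "x \<ge> 0"
  shows "((\<lambda>u. integral {0..u} g) has_vector_derivative g x) (at x within {0..})"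
proof -
  have "((\<lambda>u. integral {0..u} g) has_vector_derivative g x) (at x within {0..x+1})"
    using x by (intro integral_has_vector_derivative continuous_on_subset[OF g]) auto
  \<comment> \<open>Near x the compact interval and the half line coincide, also at the endpoint
    0.\<close>
  moreover have "at x within {0..x+1} = at x within {0..}"
    by (rule at_within_nhd[of x "{x-1<..<x+1}"]) auto
  ultimately show ?thesis by simp
qed

lemma branch_sol_derivs:
  assumes f: "continuous_on {0..} f" and x: "x \<ge> 0" and c: "c > 0"
  shows "(branch_sol \<kappa> c U f R has_vector_derivative branch_sol' \<kappa> c U f R x) (at x within {0..})"
    "(branch_sol' \<kappa> c U f R has_vector_derivative \<kappa>\<^sup>2 * branch_sol \<kappa> c U f R x - f x / of_real c) (at x within {0..})"
proof -
  have 1: "((\<lambda>x. integral {0..x} (\<lambda>y. sinhq \<kappa> y * f y)) has_vector_derivative sinhq \<kappa> x * f x) (at x within {0..})"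
    "((\<lambda>x. integral {0..x} (\<lambda>y. expm \<kappa> y * f y)) has_vector_derivative expm \<kappa> x * f x) (at x within {0..})"
    using x by (intro integral_has_vector_derivative_half_line continuous_intros f; simp)+
  note d = expm_has_derivative[of \<kappa> x "{0..}"] sinhq_has_derivative[of \<kappa> x "{0..}"] cosh_has_derivative[of \<kappa> x "{0..}"]
  have "(branch_sol \<kappa> c U f R has_vector_derivative
     ((expm \<kappa> x * (sinhq \<kappa> x * f x) + - \<kappa> * expm \<kappa> x * integral {0..x} (\<lambda>y. sinhq \<kappa> y * f y)) +
      (sinhq \<kappa> x * (0 - expm \<kappa> x * f x) + cosh (\<kappa> * of_real x) *
        (integral {0..R} (\<lambda>y. expm \<kappa> y * f y) - integral {0..x} (\<lambda>y. expm \<kappa> y * f y)))) / of_real c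
      + U * (- \<kappa> * expm \<kappa> x)) (at x within {0..})"
    unfolding branch_sol_def[abs_def]
    by (intro has_vector_derivative_add has_vector_derivative_divide has_vector_derivative_mult
        has_vector_derivative_mult_right has_vector_derivative_diff has_vector_derivative_const 1 d)
  then show "(branch_sol \<kappa> c U f R has_vector_derivative branch_sol' \<kappa> c U f R x) (at x within {0..})"
    by (rule has_vector_derivative_eq_rhs) (simp add: branch_sol'_def algebra_simps)
  have "(branch_sol' \<kappa> c U f R has_vector_derivative
     ((- \<kappa> * expm \<kappa> x * (sinhq \<kappa> x * f x) + - \<kappa> * (- \<kappa> * expm \<kappa> x) * integral {0..x} (\<lambda>y. sinhq \<kappa> y * f y)) +
      (cosh (\<kappa> * of_real x) * (0 - expm \<kappa> x * f x) + \<kappa>\<^sup>2 * sinhq \<kappa> x *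
        (integral {0..R} (\<lambda>y. expm \<kappa> y * f y) - integral {0..x} (\<lambda>y. expm \<kappa> y * f y)))) / of_real c
      - U * \<kappa> * (- \<kappa> * expm \<kappa> x)) (at x within {0..})"
    unfolding branch_sol'_def[abs_def]
    by (intro has_vector_derivative_add has_vector_derivative_divide has_vector_derivative_mult
        has_vector_derivative_mult_right has_vector_derivative_diff has_vector_derivative_const 1 d)
  then show "(branch_sol' \<kappa> c U f R has_vector_derivative \<kappa>\<^sup>2 * branch_sol \<kappa> c U f R x - f x / of_real c) (at x within {0..})"
  proof (rule has_vector_derivative_eq_rhs)
    \<comment> \<open>After collecting terms, f is multiplied by minus the Wronskian, which is
      1.\<close>
    let ?P = "integral {0..x} (\<lambda>y. sinhq \<kappa> y * f y)"
      and ?Q = "integral {0..R} (\<lambda>y. expm \<kappa> y * f y) - integral {0..x} (\<lambda>y. expm \<kappa> y * f y)"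
    have "(- \<kappa> * expm \<kappa> x * (sinhq \<kappa> x * f x) + - \<kappa> * (- \<kappa> * expm \<kappa> x) * ?P) +
      (cosh (\<kappa> * of_real x) * (0 - expm \<kappa> x * f x) + \<kappa>\<^sup>2 * sinhq \<kappa> x * ?Q)
      = \<kappa>\<^sup>2 * (expm \<kappa> x * ?P + sinhq \<kappa> x * ?Q) -
        (expm \<kappa> x * cosh (\<kappa> * of_real x) + \<kappa> * expm \<kappa> x * sinhq \<kappa> x) * f x"
      by (simp add: algebra_simps power2_eq_square)
    also have "\<dots> = \<kappa>\<^sup>2 * (expm \<kappa> x * ?P + sinhq \<kappa> x * ?Q) - f x"
      by (simp only: wronskian mult_1)
    finally have fin: "(- \<kappa> * expm \<kappa> x * (sinhq \<kappa> x * f x) + - \<kappa> * (- \<kappa> * expm \<kappa> x) * ?P) +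
      (cosh (\<kappa> * of_real x) * (0 - expm \<kappa> x * f x) + \<kappa>\<^sup>2 * sinhq \<kappa> x * ?Q)
      = \<kappa>\<^sup>2 * (expm \<kappa> x * ?P + sinhq \<kappa> x * ?Q) - f x" .
    show "((- \<kappa> * expm \<kappa> x * (sinhq \<kappa> x * f x) + - \<kappa> * (- \<kappa> * expm \<kappa> x) * ?P) +
      (cosh (\<kappa> * of_real x) * (0 - expm \<kappa> x * f x) + \<kappa>\<^sup>2 * sinhq \<kappa> x * ?Q)) / of_real c
      - U * \<kappa> * (- \<kappa> * expm \<kappa> x) = \<kappa>\<^sup>2 * branch_sol \<kappa> c U f R x - f x / of_real c"
      unfolding branch_sol_def fin by (simp add: algebra_simps diff_divide_distrib add_divide_distrib power2_eq_square)
  qed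
qed

lemma integral_tail:
  fixes g :: "real \<Rightarrow> complex"
  assumes g: "continuous_on {0..} g" and R: "0 \<le> R" "R \<le> x" and z: "\<And>y. y \<ge> R \<Longrightarrow> g y = 0"
  shows "integral {0..x} g = integral {0..R} g"
proof -
  have "integral {0..R} g + integral {R..x} g = integral {0..x} g"
    using R by (intro Henstock_Kurzweil_Integration.integral_combine integrable_continuous_real continuous_on_subset[OF g]) auto
  moreover have "integral {R..x} g = integral {R..x} (\<lambda>_. 0)"
    using z by (intro Henstock_Kurzweil_Integration.integral_cong) auto
  ultimately show ?thesis by simp
qed

text \<open>Beyond the support only the decaying exponential survives, so square integrability of
  the solution and of its derivative reduces to Re \<kappa> > 0.\<close>

lemma branch_sol_tail:
  fixes \<kappa> U :: complex and c :: real
  assumes f: "continuous_on {0..} f" and supp: "\<And>x. x \<ge> R \<Longrightarrow> f x = 0" and R: "0 \<le> R" "R \<le> x"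
  defines "C \<equiv> integral {0..R} (\<lambda>y. sinhq \<kappa> y * f y) / of_real c + U"
  shows "branch_sol \<kappa> c U f R x = C * expm \<kappa> x" "branch_sol' \<kappa> c U f R x = (- \<kappa> * C) * expm \<kappa> x"
proof -
  have t: "integral {0..x} (\<lambda>y. sinhq \<kappa> y * f y) = integral {0..R} (\<lambda>y. sinhq \<kappa> y * f y)"
    "integral {0..x} (\<lambda>y. expm \<kappa> y * f y) = integral {0..R} (\<lambda>y. expm \<kappa> y * f y)"
    using R supp by (intro integral_tail continuous_intros f; simp)+
  show "branch_sol \<kappa> c U f R x = C * expm \<kappa> x" "branch_sol' \<kappa> c U f R x = (- \<kappa> * C) * expm \<kappa> x"
    unfolding branch_sol_def branch_sol'_def t by (simp_all add: C_def algebra_simps)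
qed

lemma branch_sol_0:
  "branch_sol \<kappa> c U f R 0 = U"
  "branch_sol' \<kappa> c U f R 0 = integral {0..R} (\<lambda>y. expm \<kappa> y * f y) / of_real c - U * \<kappa>"
  by (simp_all add: branch_sol_def branch_sol'_def)

lemma branch_sol_L2:
  assumes f: "continuous_on {0..} f" and supp: "\<And>x. x \<ge> R \<Longrightarrow> f x = 0" and R: "0 \<le> R"
    and \<kappa>: "Re \<kappa> > 0" and c: "c > 0"
  shows "continuous_on {0..} (branch_sol \<kappa> c U f R)" "continuous_on {0..} (branch_sol' \<kappa> c U f R)"
    "branch_sol \<kappa> c U f R \<in> L2_half" "branch_sol' \<kappa> c U f R \<in> L2_half"
proof -
  show c1: "continuous_on {0..} (branch_sol \<kappa> c U f R)"
    using branch_sol_derivs(1)[OF f _ c] by (intro continuous_on_vector_derivative) auto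
  show c2: "continuous_on {0..} (branch_sol' \<kappa> c U f R)"
    using branch_sol_derivs(2)[OF f _ c] by (intro continuous_on_vector_derivative) auto
  show "branch_sol \<kappa> c U f R \<in> L2_half" "branch_sol' \<kappa> c U f R \<in> L2_half"
    using branch_sol_tail[OF f supp R, of _ \<kappa> c U]
    by (blast intro: exp_tail_L2_half[OF c1 \<kappa>] exp_tail_L2_half[OF c2 \<kappa>])+
qed

definition Ie :: "real \<Rightarrow> complex \<Rightarrow> (real \<Rightarrow> complex) \<Rightarrow> complex" where
  "Ie R \<kappa> f = integral {0..R} (\<lambda>y. expm \<kappa> y * f y)"

text \<open>Quadratic form of the Dirichlet Green operator on one branch, with the factor 1/c left
  out.\<close>

definition Jg :: "real \<Rightarrow> complex \<Rightarrow> (real \<Rightarrow> complex) \<Rightarrow> complex" where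
  "Jg R \<kappa> f = integral {0..R} (\<lambda>x. integral {0..R} (\<lambda>y. green \<kappa> x y * f y) * cnj (f x))"

text \<open>The form (u, f) for the resolvent u of f at z: decoupled Dirichlet branches plus a
  rank-one coupling through the vertex. In the coupling f is conjugated inside the transform while
  \<kappa> is not conjugated.\<close>

definition resolvent_form :: "nat \<Rightarrow> (nat \<Rightarrow> real) \<Rightarrow> (nat \<Rightarrow> real) \<Rightarrow> real \<Rightarrow> star_fun \<Rightarrow> complex \<Rightarrow> complex" where
  "resolvent_form n c a R f z =
    (\<Sum>k=1..n. Jg R (kap c a k z) (f k) / of_real (c k)) +
    (\<Sum>k=1..n. Ie R (kap c a k z) (f k)) * (\<Sum>k=1..n. Ie R (kap c a k z) (\<lambda>x. cnj (f k x))) / kapW n c a z"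

lemma integral_green:
  assumes f: "continuous_on {0..} f" and x: "0 \<le> x" "x \<le> R"
  shows "integral {0..R} (\<lambda>y. green \<kappa> x y * f y) =
    expm \<kappa> x * integral {0..x} (\<lambda>y. sinhq \<kappa> y * f y) +
     sinhq \<kappa> x * (integral {0..R} (\<lambda>y. expm \<kappa> y * f y) - integral {0..x} (\<lambda>y. expm \<kappa> y * f y))"
proof -
  have i: "g integrable_on {p..q}" if "continuous_on {0..} g" "0 \<le> p" for g :: "real \<Rightarrow> complex" and p q
    by (rule integrable_continuous_real, rule continuous_on_subset[OF that(1)]) (use that(2) in auto)
  have cg: "continuous_on {0..} (\<lambda>y. green \<kappa> x y * f y)"
    by (intro continuous_on_mult f continuous_on_green continuous_on_const continuous_on_id)
  have ce: "continuous_on {0..} (\<lambda>y. expm \<kappa> y * f y)"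
    by (intro continuous_on_mult f continuous_on_expm continuous_on_const continuous_on_id)
  have "integral {0..R} (\<lambda>y. green \<kappa> x y * f y) =
      integral {0..x} (\<lambda>y. green \<kappa> x y * f y) + integral {x..R} (\<lambda>y. green \<kappa> x y * f y)"
    using x by (intro Henstock_Kurzweil_Integration.integral_combine[symmetric] i[OF cg]) auto
  also have "integral {0..x} (\<lambda>y. green \<kappa> x y * f y) = integral {0..x} (\<lambda>y. expm \<kappa> x * (sinhq \<kappa> y * f y))"
    by (intro Henstock_Kurzweil_Integration.integral_cong) (auto simp: green_def)
  also have "integral {x..R} (\<lambda>y. green \<kappa> x y * f y) = integral {x..R} (\<lambda>y. sinhq \<kappa> x * (expm \<kappa> y * f y))"
    by (intro Henstock_Kurzweil_Integration.integral_cong) (auto simp: green_def)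
  also have "integral {x..R} (\<lambda>y. sinhq \<kappa> x * (expm \<kappa> y * f y)) = sinhq \<kappa> x *
      (integral {0..R} (\<lambda>y. expm \<kappa> y * f y) - integral {0..x} (\<lambda>y. expm \<kappa> y * f y))"
  proof -
    have "integral {x..R} (\<lambda>y. expm \<kappa> y * f y) =
        integral {0..R} (\<lambda>y. expm \<kappa> y * f y) - integral {0..x} (\<lambda>y. expm \<kappa> y * f y)"
      using Henstock_Kurzweil_Integration.integral_combine[OF x i[OF ce, of 0 R]] by (simp add: algebra_simps)
    then show ?thesis by simp
  qed
  finally show ?thesis by simp
qed

lemma resolvent_exists:
  assumes n: "1 \<le> n" and c: "\<And>k. k \<in> {1..n} \<Longrightarrow> 0 < c k" and z: "Im z < 0" and R: "0 \<le> R"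
    and f: "\<And>k. k \<in> {1..n} \<Longrightarrow> continuous_on {0..} (f k)"
    and supp: "\<And>k x. k \<in> {1..n} \<Longrightarrow> x \<ge> R \<Longrightarrow> f k x = 0"
  obtains u where "u \<in> star_domain n c" "star_eq n f (star_lin 1 (star_op n c a u) (-z) u)"
    "star_inner n u f = resolvent_form n c a R f z"
proof -
  let ?\<kappa> = "\<lambda>k. kap c a k z"
  define U where "U = (\<Sum>k=1..n. Ie R (?\<kappa> k) (f k)) / kapW n c a z"
  define u where "u k = branch_sol (?\<kappa> k) (c k) U (f k) R" for k
  define u' where "u' k = branch_sol' (?\<kappa> k) (c k) U (f k) R" for k
  \<comment> \<open>The second derivative of u, arranged as a linear combination of u and f to fit
    \<open>L2_half_lin\<close>.\<close>
  define u'' where "u'' k x = (?\<kappa> k)\<^sup>2 * u k x + (- 1 / of_real (c k)) * f k x" for k x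
  have \<kappa>: "Re (?\<kappa> k) > 0" if "k \<in> {1..n}" for k using kap_Re_pos[where c=c and k=k and a=a, OF c[OF that] z] .
  have W: "kapW n c a z \<noteq> 0"
  proof
    assume "kapW n c a z = 0"
    then have "c 1 * cmod (?\<kappa> 1) \<le> 0" using kapW_lower[where n=n and c=c and z=z and k=1 and a=a] c z n by auto
    then show False using \<kappa>[of 1] c[of 1] n by (auto simp: mult_le_0_iff)
  qed
  have L: "continuous_on {0..} (u k)" "continuous_on {0..} (u' k)" "u k \<in> L2_half" "u' k \<in> L2_half"
    if "k \<in> {1..n}" for k
    using branch_sol_L2[OF f[OF that] supp[OF that] R \<kappa>[OF that] c[OF that], where U=U]
    by (auto simp: u_def u'_def)
  have Lf: "f k \<in> L2_half" if "k \<in> {1..n}" for k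
    using supp[OF that] by (intro bounded_support_L2_half[of R] continuous_on_subset[OF f[OF that]]) auto
  have d: "(u k has_vector_derivative u' k x) (at x within {0..})"
    "(u' k has_vector_derivative u'' k x) (at x within {0..})" if "k \<in> {1..n}" "x \<ge> 0" for k x
    using branch_sol_derivs[OF f[OF that(1)] that(2) c[OF that(1)], of "?\<kappa> k" U R]
    by (auto simp: u_def u'_def u''_def)
  have c'': "continuous_on {0..} (u'' k)" and L'': "u'' k \<in> L2_half" if "k \<in> {1..n}" for k
    unfolding u''_def by (intro continuous_intros L[OF that] f[OF that] L2_half_lin Lf[OF that])+
  have H2: "u k \<in> H2_half" "weak_deriv 2 (u k) (u'' k)" if "k \<in> {1..n}" for k
    using that by (auto intro!: H2_half_classical[of "u k" "u' k" "u'' k"] d c'' L'' L)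
  have u0: "u k 0 = U" "u' k 0 = Ie R (?\<kappa> k) (f k) / of_real (c k) - U * ?\<kappa> k" for k
    by (simp_all add: u_def u'_def branch_sol_0 Ie_def)
  have dom: "u \<in> star_domain n c"
    unfolding star_domain_def
  proof (intro CollectI conjI ballI exI)
    show "u k \<in> H2_half" if "k \<in> {1..n}" for k by (rule H2[OF that])
    show "star_eq n u u" by simp
    show "T0 n u" using L by (auto simp: T0_def u0)
    have "(\<Sum>k=1..n. of_real (c k) * u' k 0) = (\<Sum>k=1..n. Ie R (?\<kappa> k) (f k) - U * (of_real (c k) * ?\<kappa> k))"
      using c by (intro sum.cong) (force simp: u0 algebra_simps)+
    also have "\<dots> = (\<Sum>k=1..n. Ie R (?\<kappa> k) (f k)) - U * kapW n c a z"
      unfolding kapW_def by (simp only: sum_subtractf sum_distrib_left)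
    also have "\<dots> = 0" using W by (simp add: U_def)
    finally show "T1 n c u" unfolding T1_def using L d by blast
  qed
  have "star_eq n (star_op n c a u) (\<lambda>k x. - of_real (c k) * u'' k x + of_real (a k) * u k x)"
    using H2 L'' by (intro star_op_eqI[OF dom]) auto
  then have "star_eq n (star_lin 1 (star_op n c a u) (-z) u)
     (star_lin 1 (\<lambda>k x. - of_real (c k) * u'' k x + of_real (a k) * u k x) (-z) u)"
    by (rule star_lin_cong) simp
  moreover have "star_eq n \<dots> f"
    unfolding star_eq_def
  proof
    fix k assume k: "k \<in> {1..n}"
    have "star_lin 1 (\<lambda>k x. - of_real (c k) * u'' k x + of_real (a k) * u k x) (-z) u k x = f k x" for x
    proof -
      have "of_real (c k) * u'' k x = (of_real (c k) * (?\<kappa> k)\<^sup>2) * u k x - f k x"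
        using c[OF k] by (simp add: u''_def algebra_simps)
      then show ?thesis using kap_power2[of c k a z] c[OF k] by (simp add: star_lin_def algebra_simps)
    qed
    then show "AE x in lebesgue_on {0<..}. star_lin 1 (\<lambda>k x. - of_real (c k) * u'' k x + of_real (a k) * u k x) (-z) u k x = f k x"
      by simp
  qed
  ultimately have eq: "star_eq n f (star_lin 1 (star_op n c a u) (-z) u)"
    using star_eq_trans star_eq_sym by blast
  have "star_inner n u f = (\<Sum>k=1..n. Jg R (?\<kappa> k) (f k) / of_real (c k) + U * Ie R (?\<kappa> k) (\<lambda>x. cnj (f k x)))"
    unfolding star_inner_def star_integral_def
  proof (rule sum.cong[OF refl])
    fix k assume k: "k \<in> {1..n}"
    have "(LINT x|lebesgue_on {0<..}. u k x * cnj (f k x)) = integral {0..R} (\<lambda>x. u k x * cnj (f k x))"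
      using supp[OF k] by (intro half_line_integral continuous_intros
        continuous_on_subset[OF L(1)[OF k]] continuous_on_subset[OF f[OF k]]) auto
    also have "\<dots> = integral {0..R} (\<lambda>x. integral {0..R} (\<lambda>y. green (?\<kappa> k) x y * f k y) * cnj (f k x) / of_real (c k)
        + U * (expm (?\<kappa> k) x * cnj (f k x)))"
    proof (rule Henstock_Kurzweil_Integration.integral_cong)
      fix x assume x: "x \<in> {0..R}"
      have "u k x = integral {0..R} (\<lambda>y. green (?\<kappa> k) x y * f k y) / of_real (c k) + U * expm (?\<kappa> k) x"
        using x by (simp only: u_def branch_sol_def integral_green[OF f[OF k]] atLeastAtMost_iff)
      then show "u k x * cnj (f k x) = integral {0..R} (\<lambda>y. green (?\<kappa> k) x y * f k y) * cnj (f k x) / of_real (c k)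
        + U * (expm (?\<kappa> k) x * cnj (f k x))"
        by (simp only: distrib_right mult.assoc times_divide_eq_left)
    qed
    also have "\<dots> = integral {0..R} (\<lambda>x. integral {0..R} (\<lambda>y. green (?\<kappa> k) x y * f k y) * cnj (f k x) / of_real (c k))
        + integral {0..R} (\<lambda>x. U * (expm (?\<kappa> k) x * cnj (f k x)))"
    proof (rule Henstock_Kurzweil_Integration.integral_add)
      have "continuous_on {0..R} (\<lambda>x. integral (cbox 0 R) (\<lambda>y. green (?\<kappa> k) x y * f k y))"
        by (rule integral_continuous_on_param)
          (auto simp: case_prod_beta intro!: continuous_intros continuous_on_compose2[OF f[OF k]])
      then show "(\<lambda>x. integral {0..R} (\<lambda>y. green (?\<kappa> k) x y * f k y) * cnj (f k x) / of_real (c k)) integrable_on {0..R}"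
        using c[OF k] by (intro integrable_continuous_real continuous_intros continuous_on_subset[OF f[OF k]]) auto
      show "(\<lambda>x. U * (expm (?\<kappa> k) x * cnj (f k x))) integrable_on {0..R}"
        by (intro integrable_continuous_real continuous_intros continuous_on_subset[OF f[OF k]]) auto
    qed
    finally show "(LINT x|lebesgue_on {0<..}. u k x * cnj (f k x)) =
        Jg R (?\<kappa> k) (f k) / of_real (c k) + U * Ie R (?\<kappa> k) (\<lambda>x. cnj (f k x))"
      by (simp add: Jg_def Ie_def)
  qed
  also have "\<dots> = resolvent_form n c a R f z"
    unfolding resolvent_form_def sum.distrib sum_distrib_left[symmetric] by (simp add: U_def)
  finally show thesis using that dom eq by blast
qed

subsection \<open>Stone's formula\<close>

text \<open>Fubini applies because the Poisson kernel is at most 1/\<epsilon> and both measures are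
  finite; in s the kernel has the primitive arctan((s - t)/\<epsilon>).\<close>

lemma poisson_integral:
  fixes M :: "real measure"
  assumes M: "finite_measure M" "sets M = sets borel" and e: "\<epsilon> > 0" and ab: "\<alpha> \<le> \<beta>"
  shows "(LINT s:{\<alpha>..\<beta>}|lborel. (LINT t|M. \<epsilon> / ((t - s)\<^sup>2 + \<epsilon>\<^sup>2))) =
    (LINT t|M. arctan ((\<beta> - t) / \<epsilon>) - arctan ((\<alpha> - t) / \<epsilon>))"
proof -
  let ?L = "restrict_space lborel {\<alpha>..\<beta>}"
  interpret M: finite_measure M by fact
  interpret L: finite_measure ?L by (rule finite_measureI) (use ab in \<open>simp add: emeasure_restrict_space space_restrict_space\<close>)
  interpret LM: pair_sigma_finite ?L M ..
  interpret P: finite_measure "?L \<Otimes>\<^sub>M M" by (rule finite_measure_pair_measure) unfold_locales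
  note [measurable_cong] = M(2)
  have pos: "(t - s)\<^sup>2 + \<epsilon>\<^sup>2 > 0" for t s using e by (simp add: add_nonneg_pos)
  have s: "(\<lambda>s. s) \<in> borel_measurable ?L" by (rule measurable_restrict_space1) simp
  have m: "case_prod (\<lambda>s t. \<epsilon> / ((t - s)\<^sup>2 + \<epsilon>\<^sup>2)) \<in> borel_measurable (?L \<Otimes>\<^sub>M M)"
    using measurable_compose[OF measurable_fst s, of M] by (simp add: case_prod_beta) measurable
  have int: "integrable (?L \<Otimes>\<^sub>M M) (case_prod (\<lambda>s t. \<epsilon> / ((t - s)\<^sup>2 + \<epsilon>\<^sup>2)))"
  proof (rule P.integrable_const_bound[OF _ m])
    have "norm (\<epsilon> / ((t - s)\<^sup>2 + \<epsilon>\<^sup>2)) \<le> 1 / \<epsilon>" for s t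
    proof -
      have "\<epsilon> / ((t - s)\<^sup>2 + \<epsilon>\<^sup>2) \<le> \<epsilon> / \<epsilon>\<^sup>2"
        using e pos[of t s] by (intro divide_left_mono) auto
      then show ?thesis using e pos[of t s] by (simp add: power2_eq_square)
    qed
    then show "AE x in ?L \<Otimes>\<^sub>M M. norm (case x of (s, t) \<Rightarrow> \<epsilon> / ((t - s)\<^sup>2 + \<epsilon>\<^sup>2)) \<le> 1 / \<epsilon>"
      by (auto intro!: AE_I2)
  qed
  have "(LINT s:{\<alpha>..\<beta>}|lborel. (LINT t|M. \<epsilon> / ((t - s)\<^sup>2 + \<epsilon>\<^sup>2))) = (LINT s|?L. (LINT t|M. \<epsilon> / ((t - s)\<^sup>2 + \<epsilon>\<^sup>2)))"
    by (simp add: set_lebesgue_integral_def integral_restrict_space)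
  also have "\<dots> = (LINT t|M. (LINT s|?L. \<epsilon> / ((t - s)\<^sup>2 + \<epsilon>\<^sup>2)))"
    by (rule LM.Fubini_integral[OF int, symmetric])
  also have "\<dots> = (LINT t|M. arctan ((\<beta> - t) / \<epsilon>) - arctan ((\<alpha> - t) / \<epsilon>))"
  proof (rule Bochner_Integration.integral_cong[OF refl])
    fix t
    have "((\<lambda>s. arctan ((s - t) / \<epsilon>)) has_vector_derivative \<epsilon> / ((t - s)\<^sup>2 + \<epsilon>\<^sup>2)) (at s within {\<alpha>..\<beta>})" for s
    proof -
      have "\<epsilon> / ((t - s)\<^sup>2 + \<epsilon>\<^sup>2) = inverse (1 + ((s - t) / \<epsilon>)\<^sup>2) * (1 / \<epsilon>)"
      proof -
        have "1 + ((s - t) / \<epsilon>)\<^sup>2 = ((t - s)\<^sup>2 + \<epsilon>\<^sup>2) / \<epsilon>\<^sup>2"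
          using e by (simp add: power_divide add_divide_distrib power2_commute)
        then show ?thesis using e by (simp add: power2_eq_square)
      qed
      moreover have "((\<lambda>s. arctan ((s - t) / \<epsilon>)) has_real_derivative inverse (1 + ((s - t) / \<epsilon>)\<^sup>2) * (1 / \<epsilon>)) (at s within {\<alpha>..\<beta>})"
        using e by (auto intro!: derivative_eq_intros)
      ultimately show ?thesis by (simp add: has_real_derivative_iff_has_vector_derivative[symmetric])
    qed
    moreover have "continuous_on {\<alpha>..\<beta>} (\<lambda>s. \<epsilon> / ((t - s)\<^sup>2 + \<epsilon>\<^sup>2))"
      by (intro continuous_intros ballI) (metis pos less_irrefl)
    ultimately have "integral\<^sup>L lborel (\<lambda>s. indicator {\<alpha>..\<beta>} s *\<^sub>R (\<epsilon> / ((t - s)\<^sup>2 + \<epsilon>\<^sup>2))) = arctan ((\<beta> - t) / \<epsilon>) - arctan ((\<alpha> - t) / \<epsilon>)"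
      by (intro integral_FTC_atLeastAtMost ab) auto
    then show "(LINT s|?L. \<epsilon> / ((t - s)\<^sup>2 + \<epsilon>\<^sup>2)) = arctan ((\<beta> - t) / \<epsilon>) - arctan ((\<alpha> - t) / \<epsilon>)"
      by (simp add: integral_restrict_space)
  qed
  finally show ?thesis .
qed

text \<open>arctan(y/\<epsilon>) tends to (\<pi>/2) sgn y. At an endpoint one of the two signs is 0,
  which explains the half weights; between them the difference is \<pi>, the constant in Stone's
  formula.\<close>

lemma poisson_limit:
  fixes M :: "real measure"
  assumes M: "finite_measure M" "sets M = sets borel" and ab: "\<alpha> < \<beta>"
  shows "(\<lambda>m. LINT t|M. arctan ((\<beta> - t) / (1 / real (Suc m))) - arctan ((\<alpha> - t) / (1 / real (Suc m))))
    \<longlonglongrightarrow> pi * measure M {\<alpha><..<\<beta>} + pi / 2 * (measure M {\<alpha>} + measure M {\<beta>})"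
proof -
  interpret M: finite_measure M by fact
  note [measurable_cong] = M(2)
  have lim: "(\<lambda>m. arctan (y / (1 / real (Suc m)))) \<longlonglongrightarrow> pi / 2 * sgn y" for y :: real
  proof -
    have f: "filterlim (\<lambda>m. real (Suc m)) at_top sequentially"
      by (rule filterlim_compose[OF filterlim_real_sequentially filterlim_Suc])
    consider "y > 0" | "y < 0" | "y = 0" by linarith
    then show ?thesis
    proof cases
      case 1
      then have "filterlim (\<lambda>m. y * real (Suc m)) at_top sequentially"
        by (intro filterlim_tendsto_pos_mult_at_top[OF tendsto_const _ f])
      from filterlim_compose[OF tendsto_arctan_at_top this] show ?thesis using 1 by simp
    next
      case 2
      then have "filterlim (\<lambda>m. y * real (Suc m)) at_bot sequentially"
        by (intro filterlim_tendsto_neg_mult_at_bot[OF tendsto_const _ f])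
      from filterlim_compose[OF tendsto_arctan_at_bot this] show ?thesis using 2 by simp
    qed simp
  qed
  have "(\<lambda>m. LINT t|M. arctan ((\<beta> - t) / (1 / real (Suc m))) - arctan ((\<alpha> - t) / (1 / real (Suc m))))
    \<longlonglongrightarrow> (LINT t|M. pi / 2 * sgn (\<beta> - t) - pi / 2 * sgn (\<alpha> - t))"
  proof (rule integral_dominated_convergence[where w="\<lambda>_. 2 * pi"])
    have "\<bar>arctan x - arctan y\<bar> \<le> 2 * pi" for x y
      using arctan_lbound[of x] arctan_ubound[of x] arctan_lbound[of y] arctan_ubound[of y] pi_gt_zero
      unfolding abs_le_iff by linarith
    then show "AE t in M. norm (arctan ((\<beta> - t) / (1 / real (Suc m))) - arctan ((\<alpha> - t) / (1 / real (Suc m)))) \<le> 2 * pi" for m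
      by simp
    show "AE t in M. (\<lambda>m. arctan ((\<beta> - t) / (1 / real (Suc m))) - arctan ((\<alpha> - t) / (1 / real (Suc m))))
        \<longlonglongrightarrow> pi / 2 * sgn (\<beta> - t) - pi / 2 * sgn (\<alpha> - t)"
      by (intro AE_I2 tendsto_diff lim)
  qed (auto simp: borel_measurable_continuous_onI continuous_on_arctan continuous_on_id)
  also have "(LINT t|M. pi / 2 * sgn (\<beta> - t) - pi / 2 * sgn (\<alpha> - t)) =
      (LINT t|M. pi * indicator {\<alpha><..<\<beta>} t + pi / 2 * (indicator {\<alpha>} t + indicator {\<beta>} t))"
    by (intro Bochner_Integration.integral_cong refl) (use ab in \<open>auto simp: sgn_if indicator_def\<close>)
  also have "\<dots> = pi * measure M {\<alpha><..<\<beta>} + pi / 2 * (measure M {\<alpha>} + measure M {\<beta>})"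
  proof -
    have i: "integrable M (indicator S :: real \<Rightarrow> real)" if "S \<in> sets borel" for S
      using that M(2) by (intro integrable_real_indicator) (auto simp: less_top[symmetric])
    have "(LINT t|M. pi * indicator {\<alpha><..<\<beta>} t + pi / 2 * (indicator {\<alpha>} t + indicator {\<beta>} t)) =
        pi * (LINT t|M. indicator {\<alpha><..<\<beta>} t) + pi / 2 * ((LINT t|M. indicator {\<alpha>} t) + (LINT t|M. indicator {\<beta>} t))"
      using i by (subst Bochner_Integration.integral_add) auto
    then show ?thesis by (simp add: sets_eq_imp_space_eq[OF M(2)])
  qed
  finally show ?thesis .
qed

lemma integrable_inverse_sqrt:
  assumes "\<alpha> \<le> \<beta>"
  shows "set_integrable lborel {\<alpha>..\<beta>} (\<lambda>s. 1 / sqrt \<bar>s - p\<bar>)"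
proof -
  let ?F = "\<lambda>s. 2 * sgn (s - p) * sqrt \<bar>s - p\<bar>"
  \<comment> \<open>Written with \<open>max\<close>, the primitive is visibly continuous at p, the
    one point where it is not differentiable.\<close>
  have F: "?F = (\<lambda>s. 2 * (sqrt (max 0 (s - p)) - sqrt (max 0 (p - s))))"
    by (auto simp: fun_eq_iff sgn_if max_def)
  have "continuous_on {\<alpha>..\<beta>} ?F"
    unfolding F by (intro continuous_intros)
  moreover have "(?F has_vector_derivative 1 / sqrt \<bar>s - p\<bar>) (at s)" if "s \<noteq> p" for s
  proof (cases "s > p")
    case True
    have "((\<lambda>s. 2 * sqrt (s - p)) has_real_derivative 1 / sqrt \<bar>s - p\<bar>) (at s)"
    proof -
      have "((\<lambda>s. s - p) has_real_derivative 1) (at s)" by (auto intro!: derivative_eq_intros)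
      from DERIV_cmult[OF DERIV_chain2[OF DERIV_real_sqrt this], of 2] True
      show ?thesis by (simp add: inverse_eq_divide)
    qed
    then have "(?F has_real_derivative 1 / sqrt \<bar>s - p\<bar>) (at s)"
      by (rule has_field_derivative_transform_within_open[where S="{p<..}"]) (use True in auto)
    then show ?thesis by (simp add: has_real_derivative_iff_has_vector_derivative)
  next
    case False
    have "((\<lambda>s. - 2 * sqrt (p - s)) has_real_derivative 1 / sqrt \<bar>s - p\<bar>) (at s)"
    proof -
      have "((\<lambda>s. p - s) has_real_derivative -1) (at s)" by (auto intro!: derivative_eq_intros)
      from DERIV_cmult[OF DERIV_chain2[OF DERIV_real_sqrt this], of "-2"] False that
      show ?thesis by (simp add: inverse_eq_divide)
    qed
    then have "(?F has_real_derivative 1 / sqrt \<bar>s - p\<bar>) (at s)"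
      by (rule has_field_derivative_transform_within_open[where S="{..<p}"]) (use False that in auto)
    then show ?thesis by (simp add: has_real_derivative_iff_has_vector_derivative)
  qed
  ultimately have "((\<lambda>s. 1 / sqrt \<bar>s - p\<bar>) has_integral (?F \<beta> - ?F \<alpha>)) {\<alpha>..\<beta>}"
    using assms by (intro fundamental_theorem_of_calculus_strong[of "{p}"]) auto
  then have "(\<lambda>s. 1 / sqrt \<bar>s - p\<bar>) absolutely_integrable_on {\<alpha>..\<beta>}"
    by (intro nonnegative_absolutely_integrable_1) (auto simp: integrable_on_def)
  moreover have "(\<lambda>s. indicator {\<alpha>..\<beta>} s *\<^sub>R (1 / sqrt \<bar>s - p\<bar>)) \<in> borel_measurable borel"
    by measurable
  ultimately show ?thesis unfolding set_integrable_def by (simp add: integrable_completion)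
qed

lemma continuous_on_Ie:
  assumes f: "continuous_on {0..} f" shows "continuous_on S (\<lambda>\<kappa>. Ie R \<kappa> f)"
proof -
  have "continuous_on S (\<lambda>\<kappa>. integral (cbox 0 R) (\<lambda>y. expm \<kappa> y * f y))"
    by (rule integral_continuous_on_param)
      (auto simp: case_prod_beta intro!: continuous_intros continuous_on_compose2[OF f])
  then show ?thesis by (simp add: Ie_def)
qed

lemma continuous_on_Jg:
  assumes f: "continuous_on {0..} f" shows "continuous_on S (\<lambda>\<kappa>. Jg R \<kappa> f)"
proof -
  have 1: "continuous_on (S \<times> cbox 0 R) (\<lambda>p. integral (cbox 0 R) (\<lambda>y. green (fst p) (snd p) y * f y))"
    by (rule integral_continuous_on_param)
      (auto simp: case_prod_beta intro!: continuous_intros continuous_on_compose2[OF f])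
  have "continuous_on S (\<lambda>\<kappa>. integral (cbox 0 R) (\<lambda>x. integral (cbox 0 R) (\<lambda>y. green \<kappa> x y * f y) * cnj (f x)))"
  proof (rule integral_continuous_on_param)
    show "continuous_on (S \<times> cbox 0 R) (\<lambda>(\<kappa>, x). integral (cbox 0 R) (\<lambda>y. green \<kappa> x y * f y) * cnj (f x))"
      using 1 by (auto simp: case_prod_beta intro!: continuous_intros continuous_on_compose2[OF f])
  qed
  then show ?thesis by (simp add: Jg_def)
qed

locale star_network = star_resolution +
  assumes n_pos: "1 \<le> n" and c_pos: "\<And>k. k \<in> {1..n} \<Longrightarrow> 0 < c k"
begin

abbreviation "\<kappa> \<equiv> kap c a"
abbreviation "W \<equiv> kapW n c a"

lemma W_nonzero:
  assumes "Im z \<le> 0" "z \<noteq> of_real (a k)" "k \<in> {1..n}" shows "W z \<noteq> 0"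
proof
  assume "W z = 0"
  then have "c k * cmod (\<kappa> k z) \<le> 0" using kapW_lower[where n=n and c=c and z=z and k=k and a=a] c_pos assms by auto
  then have "\<kappa> k z = 0" using c_pos[OF assms(3)] by (auto simp: mult_le_0_iff)
  then show False using kap_power2[of c k a z] c_pos[OF assms(3)] assms(2) by auto
qed

lemma inverse_W_bound:
  assumes "\<epsilon> \<ge> 0" "s \<noteq> a 1"
  shows "1 / cmod (W (Complex s (-\<epsilon>))) \<le> (2 / sqrt (c 1)) * (1 / sqrt \<bar>s - a 1\<bar>)"
proof -
  let ?z = "Complex s (-\<epsilon>)"
  have 1: "1 \<in> {1..n}" using n_pos by auto
  have c: "c 1 > 0" using c_pos[OF 1] .
  have "\<bar>s - a 1\<bar> \<le> cmod (of_real (a 1) - ?z)"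
    using abs_Re_le_cmod[of "of_real (a 1) - ?z"] by simp
  then have "sqrt (\<bar>s - a 1\<bar> / c 1) \<le> cmod (\<kappa> 1 ?z)"
    using c by (simp add: cmod_kap divide_right_mono)
  then have "c 1 * sqrt (\<bar>s - a 1\<bar> / c 1) \<le> c 1 * cmod (\<kappa> 1 ?z)" using c by simp
  also have "\<dots> \<le> 2 * cmod (W ?z)" using kapW_lower[where n=n and c=c and z="?z" and k=1 and a=a] c_pos assms 1 by auto
  finally have "sqrt (c 1) * sqrt \<bar>s - a 1\<bar> \<le> 2 * cmod (W ?z)"
  proof -
    have "c 1 * sqrt (\<bar>s - a 1\<bar> / c 1) = (c 1 / sqrt (c 1)) * sqrt \<bar>s - a 1\<bar>"
      by (simp add: real_sqrt_divide)
    then have "c 1 * sqrt (\<bar>s - a 1\<bar> / c 1) = sqrt (c 1) * sqrt \<bar>s - a 1\<bar>"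
      using c by (simp only: real_div_sqrt less_imp_le)
    moreover assume "c 1 * sqrt (\<bar>s - a 1\<bar> / c 1) \<le> 2 * cmod (W ?z)"
    ultimately show ?thesis by simp
  qed
  moreover have "sqrt (c 1) * sqrt \<bar>s - a 1\<bar> > 0" using c assms by simp
  ultimately have "2 / (2 * cmod (W ?z)) \<le> 2 / (sqrt (c 1) * sqrt \<bar>s - a 1\<bar>)"
    by (intro frac_le) (assumption | simp)+
  then show ?thesis by simp
qed

text \<open>The resolvent form splits as N1 + N2/W, where N1 and N2 are continuous up to the real
  axis and only 1/W can be singular. The half masses at the endpoints remain here and are removed in
  \<open>stone_formula\<close>.\<close>

lemma spectral_density:
  assumes R: "0 \<le> R" and f: "\<And>k. k \<in> {1..n} \<Longrightarrow> continuous_on {0..} (f k)"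
    and supp: "\<And>k x. k \<in> {1..n} \<Longrightarrow> x \<ge> R \<Longrightarrow> f k x = 0" and ab: "\<alpha> < \<beta>"
  defines "\<rho> \<equiv> \<lambda>s. - Im (resolvent_form n c a R f (of_real s))"
  shows "set_integrable lborel {\<alpha>..\<beta>} \<rho>"
    "pi * measure (sd f) {\<alpha><..<\<beta>} + pi / 2 * (measure (sd f) {\<alpha>} + measure (sd f) {\<beta>}) = (LINT s:{\<alpha>..\<beta>}|lborel. \<rho> s)"
proof -
  have fH: "f \<in> H"
    unfolding L2_star_def
    by (auto intro!: bounded_support_L2_half[of R] continuous_on_subset[OF f] supp)
  define N1 where "N1 z = (\<Sum>k=1..n. Jg R (\<kappa> k z) (f k) / of_real (c k))" for z
  define N2 where "N2 z = (\<Sum>k=1..n. Ie R (\<kappa> k z) (f k)) * (\<Sum>k=1..n. Ie R (\<kappa> k z) (\<lambda>x. cnj (f k x)))" for z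
  have form_eq: "resolvent_form n c a R f z = N1 z + N2 z / W z" for z
    by (simp add: resolvent_form_def N1_def N2_def)
  have ck: "continuous_on {z. Im z \<le> 0} (\<kappa> k)" if "k \<in> {1..n}" for k
    by (rule continuous_on_kap[where c=c and k=k, OF c_pos[OF that]])
  have cf: "continuous_on {0..} (\<lambda>x. cnj (f k x))" if "k \<in> {1..n}" for k
    by (intro continuous_intros f that)
  have cN1: "continuous_on {z. Im z \<le> 0} N1"
    unfolding N1_def using c_pos
    by (intro continuous_on_sum continuous_on_divide continuous_on_const
        continuous_on_compose2[OF continuous_on_Jg ck]) (force intro: f)+
  have cN2: "continuous_on {z. Im z \<le> 0} N2"
    unfolding N2_def
    by (intro continuous_on_sum continuous_on_mult continuous_on_compose2[OF continuous_on_Ie ck]) (auto intro: f cf)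
  have cW: "continuous_on {z. Im z \<le> 0} W" by (rule continuous_on_kapW) (rule c_pos)
  \<comment> \<open>A compact box touching the real axis from below; it contains all points s - i
    \<epsilon> considered, since \<epsilon> \<le> 1.\<close>
  let ?K = "cbox (Complex \<alpha> (-1)) (Complex \<beta> 0)"
  have K: "z \<in> ?K \<longleftrightarrow> \<alpha> \<le> Re z \<and> Re z \<le> \<beta> \<and> -1 \<le> Im z \<and> Im z \<le> 0" for z
    by (auto simp: in_cbox_complex_iff)
  have "bounded (N1 ` ?K)" "bounded (N2 ` ?K)"
    by (intro compact_imp_bounded compact_continuous_image compact_cbox
        continuous_on_subset[OF cN1] continuous_on_subset[OF cN2]; use K in auto)+
  then obtain B1 B2 where B: "\<And>z. z \<in> ?K \<Longrightarrow> cmod (N1 z) \<le> B1" "\<And>z. z \<in> ?K \<Longrightarrow> cmod (N2 z) \<le> B2"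
    unfolding bounded_iff by (metis imageI)
  have B2: "0 \<le> B2" using B(2)[of "Complex \<alpha> 0"] ab norm_ge_zero order_trans
    unfolding K by (metis complex.sel less_imp_le neg_le_0_iff_le order_refl zero_le_one)
  define w where "w s = B1 + B2 * ((2 / sqrt (c 1)) * (1 / sqrt \<bar>s - a 1\<bar>))" for s
  have wi: "set_integrable lborel {\<alpha>..\<beta>} w"
  proof -
    have "set_integrable lborel {\<alpha>..\<beta>} (\<lambda>s. B1)"
      using ab by (auto simp: set_integrable_def intro!: integrable_mult_left integrable_real_indicator)
    moreover have "set_integrable lborel {\<alpha>..\<beta>} (\<lambda>s. B2 * ((2 / sqrt (c 1)) * (1 / sqrt \<bar>s - a 1\<bar>)))"
      using ab by (intro set_integrable_mult_right integrable_inverse_sqrt) auto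
    ultimately show ?thesis unfolding w_def by (rule set_integral_add)
  qed
  define \<epsilon> where "\<epsilon> m = 1 / real (Suc m)" for m
  have \<epsilon>: "0 < \<epsilon> m" "\<epsilon> m \<le> 1" for m by (auto simp: \<epsilon>_def)
  define g where "g m s = - Im (resolvent_form n c a R f (Complex s (- \<epsilon> m)))" for m s
  \<comment> \<open>The minus sign in \<open>g\<close> comes from the order of the arguments: the
    Poisson integral is Im (f, u), while the resolvent form is (u, f).\<close>
  have gM: "g m s = (LINT t|sd f. \<epsilon> m / ((t - s)\<^sup>2 + (\<epsilon> m)\<^sup>2))" for m s
  proof -
    have im: "Im (Complex s (- \<epsilon> m)) < 0" using \<epsilon>[of m] by simp
    obtain u where u: "u \<in> D" "star_eq n f (star_lin 1 (A u) (- Complex s (- \<epsilon> m)) u)"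
        "ip u f = resolvent_form n c a R f (Complex s (- \<epsilon> m))"
      by (rule resolvent_exists[where n=n and c=c and R=R and f=f and a=a, OF n_pos c_pos im R f supp])
    have "g m s = Im (ip f u)" using star_inner_sym[of n f u] by (simp add: g_def u(3))
    also have "\<dots> = (LINT t|sd f. \<epsilon> m / ((t - s)\<^sup>2 + (\<epsilon> m)\<^sup>2))"
      by (rule Im_resolvent_form[OF u(1) fH u(2) refl \<epsilon>(1)])
    finally show ?thesis .
  qed
  have bnd: "\<bar>g m s\<bar> \<le> w s" if "s \<in> {\<alpha>..\<beta>}" "s \<noteq> a 1" for m s
  proof -
    let ?z = "Complex s (- \<epsilon> m)"
    have zK: "?z \<in> ?K" using that \<epsilon>[of m] by (simp add: K)
    have "\<bar>g m s\<bar> \<le> cmod (N1 ?z + N2 ?z / W ?z)"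
      unfolding g_def form_eq using abs_Im_le_cmod[of "N1 ?z + N2 ?z / W ?z"] by simp
    also have "\<dots> \<le> cmod (N1 ?z) + cmod (N2 ?z) * (1 / cmod (W ?z))"
      using norm_triangle_ineq[of "N1 ?z" "N2 ?z / W ?z"] by (simp add: norm_divide)
    also have "\<dots> \<le> w s"
      unfolding w_def using B(1)[OF zK] B(2)[OF zK] B2 inverse_W_bound[of "\<epsilon> m" s] that \<epsilon>[of m]
      by (intro add_mono mult_mono) auto
    finally show ?thesis .
  qed
  have lim: "(\<lambda>m. g m s) \<longlonglongrightarrow> \<rho> s" if "s \<noteq> a 1" for s
  proof -
    have zl: "(\<lambda>m. Complex s (- \<epsilon> m)) \<longlonglongrightarrow> of_real s"
    proof -
      have "(\<lambda>m. of_real s - \<i> * of_real (inverse (real (Suc m)))) \<longlonglongrightarrow> of_real s - \<i> * of_real 0"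
        by (intro tendsto_intros LIMSEQ_inverse_real_of_nat)
      then show ?thesis by (simp add: \<epsilon>_def Complex_eq divide_inverse)
    qed
    have c: "(\<lambda>m. h (Complex s (- \<epsilon> m))) \<longlonglongrightarrow> h (of_real s)" if "continuous_on {z. Im z \<le> 0} h" for h :: "complex \<Rightarrow> complex"
      by (rule continuous_on_tendsto_compose[OF that zl]) (use \<epsilon>(1) in \<open>auto simp: less_imp_le\<close>)
    have "W (of_real s) \<noteq> 0" using that n_pos by (intro W_nonzero[of _ 1]) auto
    then show ?thesis unfolding g_def \<rho>_def form_eq
      by (intro tendsto_intros c cN1 cN2 cW)
  qed
  have AEs: "AE s in lborel. s \<noteq> a 1"
    by (rule AE_lborel_singleton)
  have gm: "(\<lambda>s. indicator {\<alpha>..\<beta>} s *\<^sub>R g m s) \<in> borel_measurable lborel" for m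
  proof -
    have "continuous_on UNIV (g m)"
    proof -
      have cc: "continuous_on UNIV (\<lambda>s. h (Complex s (- \<epsilon> m)))" if "continuous_on {z. Im z \<le> 0} h" for h :: "complex \<Rightarrow> complex"
        by (rule continuous_on_compose2[OF that]) (use \<epsilon>[of m] in \<open>auto simp: Complex_eq intro!: continuous_intros\<close>)
      have "W (Complex s (- \<epsilon> m)) \<noteq> 0" for s
        using n_pos \<epsilon>[of m] by (intro W_nonzero[of _ 1]) (auto simp: complex_eq_iff)
      then show ?thesis unfolding g_def form_eq
        by (intro continuous_intros cc cN1 cN2 cW) auto
    qed
    then have "g m \<in> borel_measurable borel" by (rule borel_measurable_continuous_onI)
    then show ?thesis by simp
  qed
  have \<rho>m: "(\<lambda>s. indicator {\<alpha>..\<beta>} s *\<^sub>R \<rho> s) \<in> borel_measurable lborel"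
  proof -
    have cc: "(\<lambda>s. h (of_real s)) \<in> borel_measurable borel" if "continuous_on {z. Im z \<le> 0} h" for h :: "complex \<Rightarrow> complex"
      by (intro borel_measurable_continuous_onI continuous_on_compose2[OF that]) (auto intro!: continuous_intros)
    have "\<rho> \<in> borel_measurable borel"
      unfolding \<rho>_def form_eq using cc[OF cN1] cc[OF cN2] cc[OF cW] by measurable
    then show ?thesis by simp
  qed
  have i: "integrable lborel (\<lambda>s. indicator {\<alpha>..\<beta>} s *\<^sub>R \<rho> s)"
    and l: "(\<lambda>m. integral\<^sup>L lborel (\<lambda>s. indicator {\<alpha>..\<beta>} s *\<^sub>R g m s)) \<longlonglongrightarrow> integral\<^sup>L lborel (\<lambda>s. indicator {\<alpha>..\<beta>} s *\<^sub>R \<rho> s)"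
  proof -
    have A1: "AE s in lborel. (\<lambda>m. indicator {\<alpha>..\<beta>} s *\<^sub>R g m s) \<longlonglongrightarrow> indicator {\<alpha>..\<beta>} s *\<^sub>R \<rho> s"
      using AEs by eventually_elim (intro tendsto_intros lim)
    have A2: "AE s in lborel. norm (indicator {\<alpha>..\<beta>} s *\<^sub>R g m s) \<le> indicator {\<alpha>..\<beta>} s *\<^sub>R w s" for m
      using AEs by eventually_elim (use bnd in \<open>auto simp: indicator_def\<close>)
    show "integrable lborel (\<lambda>s. indicator {\<alpha>..\<beta>} s *\<^sub>R \<rho> s)"
      "(\<lambda>m. integral\<^sup>L lborel (\<lambda>s. indicator {\<alpha>..\<beta>} s *\<^sub>R g m s)) \<longlonglongrightarrow> integral\<^sup>L lborel (\<lambda>s. indicator {\<alpha>..\<beta>} s *\<^sub>R \<rho> s)"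
      using integrable_dominated_convergence[OF \<rho>m gm wi[unfolded set_integrable_def] A1 A2]
        integral_dominated_convergence[OF \<rho>m gm wi[unfolded set_integrable_def] A1 A2] by blast+
  qed
  show "set_integrable lborel {\<alpha>..\<beta>} \<rho>" using i by (simp add: set_integrable_def)
  have "integral\<^sup>L lborel (\<lambda>s. indicator {\<alpha>..\<beta>} s *\<^sub>R g m s) =
      (LINT t|sd f. arctan ((\<beta> - t) / (1 / real (Suc m))) - arctan ((\<alpha> - t) / (1 / real (Suc m))))" for m
    using poisson_integral[OF finite_measure_sd[OF fH] sets_sd \<epsilon>(1)[of m], of \<alpha> \<beta>] ab
    by (simp add: gM set_lebesgue_integral_def \<epsilon>_def)
  with l have "(\<lambda>m. LINT t|sd f. arctan ((\<beta> - t) / (1 / real (Suc m))) - arctan ((\<alpha> - t) / (1 / real (Suc m))))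
     \<longlonglongrightarrow> (LINT s:{\<alpha>..\<beta>}|lborel. \<rho> s)"
    by (simp add: set_lebesgue_integral_def)
  with poisson_limit[OF finite_measure_sd[OF fH] sets_sd ab]
  show "pi * measure (sd f) {\<alpha><..<\<beta>} + pi / 2 * (measure (sd f) {\<alpha>} + measure (sd f) {\<beta>}) = (LINT s:{\<alpha>..\<beta>}|lborel. \<rho> s)"
    by (rule LIMSEQ_unique)
qed

text \<open>There are no atoms: half of the mass of {p}, times \<pi>, is at most the integral of the
  density over [p - 1/(m+1), p], which tends to 0.\<close>

lemma stone_formula:
  assumes R: "0 \<le> R" and f: "\<And>k. k \<in> {1..n} \<Longrightarrow> continuous_on {0..} (f k)"
    and supp: "\<And>k x. k \<in> {1..n} \<Longrightarrow> x \<ge> R \<Longrightarrow> f k x = 0" and ab: "\<alpha> < \<beta>"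
  shows "pi * measure (sd f) {\<alpha><..<\<beta>} = (LINT s:{\<alpha>..\<beta>}|lborel. - Im (resolvent_form n c a R f (of_real s)))"
proof -
  let ?\<rho> = "\<lambda>s. - Im (resolvent_form n c a R f (of_real s))"
  have sp1: "set_integrable lborel {p..q} ?\<rho>" if "p < q" for p q
    by (rule spectral_density(1)) (use R f supp that in auto)
  have sp2: "pi * measure (sd f) {p<..<q} + pi / 2 * (measure (sd f) {p} + measure (sd f) {q}) = (LINT s:{p..q}|lborel. ?\<rho> s)"
    if "p < q" for p q
    by (rule spectral_density(2)) (use R f supp that in auto)
  have "measure (sd f) {p} = 0" for p
  proof -
    define T where "T m = {p - 1 / real (Suc m)..p}" for m
    have "(\<lambda>m. LINT s:T m|lborel. ?\<rho> s) \<longlonglongrightarrow> (LINT s:(\<Inter>m. T m)|lborel. ?\<rho> s)"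
    proof (rule set_integral_cont_down)
      have "1 / real (Suc k) \<le> 1 / real (Suc m)" if "m \<le> k" for m k
        using that by (intro divide_left_mono) auto
      then show "decseq T" by (force simp: T_def decseq_def)
      show "set_integrable lborel (T 0) ?\<rho>" using sp1[of "p - 1" p] by (simp add: T_def)
    qed (simp add: T_def)
    moreover have "(\<Inter>m. T m) = {p}"
    proof
      show "(\<Inter>m. T m) \<subseteq> {p}"
      proof
        fix y assume y: "y \<in> (\<Inter>m. T m)"
        show "y \<in> {p}"
        proof (rule ccontr)
          assume "y \<notin> {p}"
          then have "0 < p - y" using y by (auto simp: T_def)
          then obtain m where "inverse (real (Suc m)) < p - y" using reals_Archimedean by blast
          moreover have "y \<in> T m" using y by blast
          ultimately show False by (simp add: T_def inverse_eq_divide)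
        qed
      qed
    qed (auto simp: T_def)
    moreover have "(LINT s:{p}|lborel. ?\<rho> s) = 0"
    proof -
      have "AE s in lborel. s \<noteq> p" by (rule AE_lborel_singleton)
      then have "AE s in lborel. indicator {p} s *\<^sub>R ?\<rho> s = 0" by eventually_elim simp
      then show ?thesis unfolding set_lebesgue_integral_def by (rule integral_eq_zero_AE)
    qed
    ultimately have lim: "(\<lambda>m. LINT s:T m|lborel. ?\<rho> s) \<longlonglongrightarrow> 0" by simp
    have "pi / 2 * measure (sd f) {p} \<le> (LINT s:T m|lborel. ?\<rho> s)" for m
    proof -
      have "p - 1 / real (Suc m) < p" by simp
      from sp2[OF this] show ?thesis
      proof -
        let ?q = "p - 1 / real (Suc m)"
        assume "pi * measure (sd f) {?q<..<p} + pi / 2 * (measure (sd f) {?q} + measure (sd f) {p})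
          = (LINT s:{?q..p}|lborel. ?\<rho> s)"
        moreover have "0 \<le> pi * measure (sd f) {?q<..<p}" "0 \<le> pi / 2 * measure (sd f) {?q}" by simp_all
        ultimately show ?thesis unfolding T_def distrib_left by linarith
      qed
    qed
    then have "pi / 2 * measure (sd f) {p} \<le> 0"
      using LIMSEQ_le_const[OF lim] by blast
    then show ?thesis using measure_nonneg[of "sd f" "{p}"] pi_gt_zero by (simp add: mult_le_0_iff)
  qed
  then show ?thesis using sp2[OF ab] by simp
qed

end

subsection \<open>Generalized eigenfunctions on the real axis\<close>

text \<open>On the negative axis the lower branch takes -i sqrt |y|, opposite to the principal
  branch; turning the argument by -1 inside and by -i outside absorbs this difference.\<close>

lemma csqrt_low_of_real: "csqrt_low (of_real y) = - \<i> * csqrt (of_real (- y))"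
proof -
  consider "y > 0" | "y < 0" | "y = 0" by linarith
  then show ?thesis
  proof cases
    case 1
    then have "Arg (of_real y) = 0" by (simp add: Arg_of_real)
    then show ?thesis using 1 by (simp add: csqrt_low_def csqrt_of_real' rcis_def)
  next
    case 2
    then have "Arg (of_real y) = pi" by (simp add: Arg_of_real)
    moreover have "rcis (sqrt \<bar>y\<bar>) (- (pi / 2)) = - \<i> * of_real (sqrt \<bar>y\<bar>)"
      by (simp add: complex_eq_iff)
    ultimately show ?thesis using 2 by (simp add: csqrt_low_def csqrt_of_real')
  qed (simp add: csqrt_low_def)
qed

lemma xi_of_real: "xi c a k (of_real t) = - \<i> * kap c a k (of_real t)"
proof -
  have "(of_real t - of_real (a k)) / of_real (c k) = complex_of_real ((t - a k) / c k)"
    "(of_real (a k) - of_real t) / of_real (c k) = complex_of_real (- ((t - a k) / c k))"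
    by (simp_all add: minus_divide_left)
  then show ?thesis unfolding xi_def kap_def by (simp only: csqrt_low_of_real)
qed

lemma kap_of_real_cases:
  "kap c a k (of_real t) = of_real (Re (kap c a k (of_real t))) \<or>
   kap c a k (of_real t) = \<i> * of_real (Im (kap c a k (of_real t)))"
proof -
  have "(of_real (a k) - of_real t) / of_real (c k) = complex_of_real ((a k - t) / c k)" by simp
  then show ?thesis unfolding kap_def by (simp only: csqrt_of_real') (auto simp: complex_eq_iff)
qed

lemma expm_cnj: "cnj (expm \<kappa> x) = expm (cnj \<kappa>) x"
  by (simp add: expm_def exp_cnj)

lemma sinhq_cnj: "cnj (sinhq \<kappa> x) = sinhq (cnj \<kappa>) x"
  by (simp add: sinhq_def sinh_def exp_cnj scaleR_conv_of_real)

lemma sinhq_minus: "sinhq (- \<kappa>) x = sinhq \<kappa> x"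
  by (simp add: sinhq_def)

lemma expm_minus: "expm (- \<kappa>) x = expm \<kappa> x + 2 * \<kappa> * sinhq \<kappa> x"
  by (simp add: expm_def sinhq_def sinh_def scaleR_conv_of_real)

text \<open>On the real axis conjugation maps \<kappa> to \<kappa> or -\<kappa>. The Dirichlet
  solution is even in \<kappa>, hence real; the decaying exponential changes by a multiple of it,
  and this change is the source of every jump across the spectrum.\<close>

lemma on_axis:
  assumes "\<kappa> = of_real (Re \<kappa>) \<or> \<kappa> = \<i> * of_real (Im \<kappa>)"
  shows "cnj (sinhq \<kappa> x) = sinhq \<kappa> x" "cnj (expm \<kappa> x) = expm \<kappa> x + 2 * \<i> * of_real (Im \<kappa>) * sinhq \<kappa> x"
proof -
  consider "cnj \<kappa> = \<kappa>" "Im \<kappa> = 0" | "cnj \<kappa> = - \<kappa>" "\<kappa> = \<i> * of_real (Im \<kappa>)"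
    using assms by (auto simp: complex_eq_iff)
  then have "cnj (sinhq \<kappa> x) = sinhq \<kappa> x \<and> cnj (expm \<kappa> x) = expm \<kappa> x + 2 * \<i> * of_real (Im \<kappa>) * sinhq \<kappa> x"
  proof cases
    case 1 then show ?thesis by (simp add: sinhq_cnj expm_cnj)
  next
    case 2
    have "2 * \<i> * of_real (Im \<kappa>) * sinhq \<kappa> x = 2 * \<kappa> * sinhq \<kappa> x" by (subst (2) 2(2)) simp
    then show ?thesis using 2(1) by (simp only: sinhq_cnj expm_cnj sinhq_minus expm_minus)
  qed
  then show "cnj (sinhq \<kappa> x) = sinhq \<kappa> x" "cnj (expm \<kappa> x) = expm \<kappa> x + 2 * \<i> * of_real (Im \<kappa>) * sinhq \<kappa> x"
    by auto
qed

definition Is :: "real \<Rightarrow> complex \<Rightarrow> (real \<Rightarrow> complex) \<Rightarrow> complex" where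
  "Is R \<kappa> f = integral {0..R} (\<lambda>y. sinhq \<kappa> y * f y)"

text \<open>The imaginary part of the Green kernel has rank one, namely -(Im \<kappa>)
  \<open>sinhq \<kappa> x\<close> \<open>sinhq \<kappa> y\<close>, because the value at min(x, y)
  times the value at max(x, y) no longer depends on the order of x and y.\<close>

lemma Im_Jg:
  assumes ax: "\<kappa> = of_real (Re \<kappa>) \<or> \<kappa> = \<i> * of_real (Im \<kappa>)" and f: "continuous_on {0..} f"
  shows "Im (Jg R \<kappa> f) = - Im \<kappa> * (cmod (Is R \<kappa> f))\<^sup>2"
proof -
  have f': "continuous_on {0..R} f" by (rule continuous_on_subset[OF f]) auto
  \<comment> \<open>Exchanging the integrals and using the symmetry of the kernel leaves the
    conjugation on the kernel alone, so that the two forms can be subtracted.\<close>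
  have "cnj (Jg R \<kappa> f) = integral (cbox 0 R) (\<lambda>x. integral (cbox 0 R) (\<lambda>y. cnj (green \<kappa> x y) * cnj (f y) * f x))"
    by (simp add: Jg_def Henstock_Kurzweil_Integration.integral_cnj)
  also have "\<dots> = integral (cbox 0 R) (\<lambda>y. integral (cbox 0 R) (\<lambda>x. cnj (green \<kappa> x y) * cnj (f y) * f x))"
    by (rule integral_swap_continuous)
      (auto simp: case_prod_beta cbox_Pair_eq intro!: continuous_intros continuous_on_compose2[OF f'])
  also have "\<dots> = integral {0..R} (\<lambda>y. integral {0..R} (\<lambda>x. cnj (green \<kappa> y x) * f x) * cnj (f y))"
    by (simp add: green_sym[of \<kappa>] mult.assoc mult.left_commute[of _ "cnj (f _)"] mult.commute[of _ "cnj (f _)"])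
  finally have c: "cnj (Jg R \<kappa> f) = integral {0..R} (\<lambda>x. integral {0..R} (\<lambda>y. cnj (green \<kappa> x y) * f y) * cnj (f x))" .
  have d: "integral {0..R} (\<lambda>y. green \<kappa> x y * f y) - integral {0..R} (\<lambda>y. cnj (green \<kappa> x y) * f y) =
      - (2 * \<i> * of_real (Im \<kappa>)) * sinhq \<kappa> x * Is R \<kappa> f" for x
  proof -
    have "integral {0..R} (\<lambda>y. green \<kappa> x y * f y) - integral {0..R} (\<lambda>y. cnj (green \<kappa> x y) * f y) =
        integral {0..R} (\<lambda>y. green \<kappa> x y * f y - cnj (green \<kappa> x y) * f y)"
      by (intro Henstock_Kurzweil_Integration.integral_diff[symmetric] integrable_continuous_real continuous_intros f')
    also have "\<dots> = integral {0..R} (\<lambda>y. (- (2 * \<i> * of_real (Im \<kappa>)) * sinhq \<kappa> x) * (sinhq \<kappa> y * f y))"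
    proof (rule Henstock_Kurzweil_Integration.integral_cong)
      fix y
      have "sinhq \<kappa> (min x y) * sinhq \<kappa> (max x y) = sinhq \<kappa> x * sinhq \<kappa> y" by (auto simp: min_def max_def)
      then show "green \<kappa> x y * f y - cnj (green \<kappa> x y) * f y = (- (2 * \<i> * of_real (Im \<kappa>)) * sinhq \<kappa> x) * (sinhq \<kappa> y * f y)"
        by (simp add: green_def on_axis[OF ax] algebra_simps)
    qed
    also have "\<dots> = (- (2 * \<i> * of_real (Im \<kappa>)) * sinhq \<kappa> x) * Is R \<kappa> f"
      unfolding Is_def by (rule integral_mult_right)
    finally show ?thesis .
  qed
  have cg: "continuous_on {0..R} (\<lambda>x. integral (cbox 0 R) (\<lambda>y. green \<kappa> x y * f y))"
    "continuous_on {0..R} (\<lambda>x. integral (cbox 0 R) (\<lambda>y. cnj (green \<kappa> x y) * f y))"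
    by (rule integral_continuous_on_param;
        auto simp: case_prod_beta intro!: continuous_intros continuous_on_compose2[OF f'])+
  have "Jg R \<kappa> f - cnj (Jg R \<kappa> f) = integral {0..R} (\<lambda>x. integral {0..R} (\<lambda>y. green \<kappa> x y * f y) * cnj (f x)
      - integral {0..R} (\<lambda>y. cnj (green \<kappa> x y) * f y) * cnj (f x))"
    unfolding c unfolding Jg_def using cg
    by (intro Henstock_Kurzweil_Integration.integral_diff[symmetric] integrable_continuous_real continuous_intros f') auto
  also have "\<dots> = integral {0..R} (\<lambda>x. (- (2 * \<i> * of_real (Im \<kappa>)) * Is R \<kappa> f) * cnj (sinhq \<kappa> x * f x))"
  proof (rule Henstock_Kurzweil_Integration.integral_cong)
    fix x
    have "integral {0..R} (\<lambda>y. green \<kappa> x y * f y) * cnj (f x) - integral {0..R} (\<lambda>y. cnj (green \<kappa> x y) * f y) * cnj (f x)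
      = (- (2 * \<i> * of_real (Im \<kappa>)) * sinhq \<kappa> x * Is R \<kappa> f) * cnj (f x)"
      unfolding left_diff_distrib[symmetric] d by (rule refl)
    then show "integral {0..R} (\<lambda>y. green \<kappa> x y * f y) * cnj (f x) - integral {0..R} (\<lambda>y. cnj (green \<kappa> x y) * f y) * cnj (f x)
      = (- (2 * \<i> * of_real (Im \<kappa>)) * Is R \<kappa> f) * cnj (sinhq \<kappa> x * f x)"
      by (simp only: complex_cnj_mult on_axis[OF ax] mult_ac)
  qed
  also have "\<dots> = - (2 * \<i> * of_real (Im \<kappa>)) * (Is R \<kappa> f * cnj (Is R \<kappa> f))"
    unfolding Henstock_Kurzweil_Integration.integral_mult_right Is_def Henstock_Kurzweil_Integration.integral_cnj by simp
  finally have "Jg R \<kappa> f - cnj (Jg R \<kappa> f) = - (2 * \<i> * of_real (Im \<kappa>)) * of_real ((cmod (Is R \<kappa> f))\<^sup>2)"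
    by (simp only: complex_norm_square)
  then show ?thesis by (simp add: complex_eq_iff)
qed

context star_network
begin

text \<open>\<open>Ft l t\<close> is \<open>F_minus\<close> at \<open>t\<close>, except at \<open>t = a l\<close>, where it is the limit and \<open>F_minus\<close> is junk because
  \<open>s_coeff\<close> divides by \<open>0\<close>.\<close>

definition Ft :: "nat \<Rightarrow> real \<Rightarrow> star_fun" where
  "Ft l t k x = expm (\<kappa> k (of_real t)) x +
    (if k = l then W (of_real t) / of_real (c l) * sinhq (\<kappa> l (of_real t)) x else 0)"

text \<open>The real value of \<open>q_coeff\<close>. Since Im \<kappa>_l vanishes up to a_l, no
  case distinction is required.\<close>

definition qr :: "nat \<Rightarrow> real \<Rightarrow> real" where
  "qr l t = c l * Im (\<kappa> l (of_real t)) / (cmod (W (of_real t)))\<^sup>2"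

lemma Ft_0 [simp]: "Ft l t k 0 = 1" by (simp add: Ft_def)

lemma kappa_eq_0_iff: "k \<in> {1..n} \<Longrightarrow> \<kappa> k (of_real t) = 0 \<longleftrightarrow> t = a k"
  using c_pos[of k] by (auto simp: kap_def)

text \<open>With \<xi> = -i \<kappa> the trigonometric functions become hyperbolic, and s_l = 1 -
  W/(c_l \<kappa>_l). The summand 1 combines with cosh to the exponential, and the rest is a
  multiple of the Dirichlet solution.\<close>

lemma F_minus_eq:
  assumes l: "l \<in> {1..n}" and t: "t \<noteq> a l"
  shows "F_minus n c a l (of_real t) k x = Ft l t k x"
proof (cases "k = l")
  case True
  let ?k = "\<kappa> l (of_real t)"
  have k0: "?k \<noteq> 0" using kappa_eq_0_iff[OF l] t by simp
  have c0: "c l \<noteq> 0" using c_pos[OF l] by simp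
  have "(\<Sum>j\<in>{1..n} - {l}. of_real (c j) * xi c a j (of_real t)) = - \<i> * (\<Sum>j\<in>{1..n} - {l}. of_real (c j) * \<kappa> j (of_real t))"
    by (simp add: xi_of_real sum_distrib_left mult.left_commute)
  also have "(\<Sum>j\<in>{1..n} - {l}. of_real (c j) * \<kappa> j (of_real t)) = W (of_real t) - of_real (c l) * ?k"
    unfolding kapW_def using l by (simp add: sum_diff1)
  finally have sm: "(\<Sum>j\<in>{1..n} - {l}. of_real (c j) * xi c a j (of_real t)) = - \<i> * (W (of_real t) - of_real (c l) * ?k)" .
  have s: "s_coeff n c a l (of_real t) = 1 - W (of_real t) / (of_real (c l) * ?k)"
    unfolding s_coeff_def sm unfolding xi_of_real using k0 c0 by (simp add: field_simps)
  have arg: "xi c a l (of_real t) * of_real x = - \<i> * (?k * of_real x)" by (simp add: xi_of_real)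
  have cs: "cos (- \<i> * z) = cosh z" "sin (- \<i> * z) = - \<i> * sinh z" for z :: complex
    by (simp_all add: cos_exp_eq sin_exp_eq cosh_def sinh_def scaleR_conv_of_real field_simps)
  have "F_minus n c a l (of_real t) k x = cosh (?k * of_real x) - (1 - W (of_real t) / (of_real (c l) * ?k)) * sinh (?k * of_real x)"
    unfolding F_minus_def using True by (simp only: arg cs s if_True) (simp add: algebra_simps)
  also have "\<dots> = (cosh (?k * of_real x) - sinh (?k * of_real x)) + W (of_real t) / of_real (c l) * (sinh (?k * of_real x) / ?k)"
    using k0 c0 by (simp add: field_simps)
  also have "\<dots> = Ft l t k x"
    using True k0 by (simp add: Ft_def sinhq_def expm_def cosh_minus_sinh)
  finally show ?thesis .
next
  case False
  then show ?thesis by (simp add: F_minus_def Ft_def expm_def xi_of_real)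
qed

lemma cmod_w: "cmod (w_coeff n c a t) = cmod (W (of_real t))"
proof -
  have "w_coeff n c a t = - \<i> * (- \<i> * W (of_real t))"
    unfolding w_coeff_def kapW_def by (simp add: xi_of_real sum_distrib_left mult.left_commute)
  then show ?thesis by (simp add: norm_mult)
qed

lemma kappa_open: "k \<in> {1..n} \<Longrightarrow> a k < t \<Longrightarrow> \<kappa> k (of_real t) = \<i> * of_real (Im (\<kappa> k (of_real t)))"
  and Im_kappa_closed: "k \<in> {1..n} \<Longrightarrow> t \<le> a k \<Longrightarrow> Im (\<kappa> k (of_real t)) = 0"
  and Im_kappa_open: "k \<in> {1..n} \<Longrightarrow> a k < t \<Longrightarrow> 0 < Im (\<kappa> k (of_real t))"
proof -
  assume k: "k \<in> {1..n}"
  have *: "\<kappa> k (of_real t) = of_real (sqrt \<bar>(a k - t) / c k\<bar>) * (if (a k - t) / c k \<ge> 0 then 1 else \<i>)"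
    unfolding kap_def by (simp flip: of_real_diff of_real_divide add: csqrt_of_real' del: of_real_sqrt)
  show "\<kappa> k (of_real t) = \<i> * of_real (Im (\<kappa> k (of_real t)))" "0 < Im (\<kappa> k (of_real t))" if "a k < t"
  proof -
    define y where "y = (a k - t) / c k"
    have "y < 0" using that c_pos[OF k] by (simp add: y_def divide_neg_pos)
    note * = *[folded y_def]
    with \<open>y < 0\<close> show "\<kappa> k (of_real t) = \<i> * of_real (Im (\<kappa> k (of_real t)))" "0 < Im (\<kappa> k (of_real t))"
      unfolding * by (auto simp: complex_eq_iff)
  qed
  show "Im (\<kappa> k (of_real t)) = 0" if "t \<le> a k"
  proof -
    have "(a k - t) / c k \<ge> 0" using that c_pos[OF k] by simp
    then show ?thesis unfolding * by simp
  qed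
qed

lemma q_coeff_eq:
  assumes l: "l \<in> {1..n}" shows "q_coeff n c a l t = of_real (qr l t)"
proof (cases "a l < t")
  case True
  have "- \<i> * \<kappa> l (of_real t) = of_real (Im (\<kappa> l (of_real t)))"
    by (subst kappa_open[OF l True]) simp
  then show ?thesis using True by (simp add: q_coeff_def qr_def cmod_w xi_of_real)
next
  case False
  then show ?thesis using Im_kappa_closed[OF l, of t] by (simp add: q_coeff_def qr_def)
qed

lemma qr_at_threshold: "l \<in> {1..n} \<Longrightarrow> qr l (a l) = 0"
  using Im_kappa_closed[of l "a l"] by (simp add: qr_def)

lemma qr_nonneg: "l \<in> {1..n} \<Longrightarrow> 0 \<le> qr l t"
  using Im_kappa_closed[of l t] Im_kappa_open[of l t] c_pos[of l] by (cases "t \<le> a l") (auto simp: qr_def)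

definition G :: "nat \<Rightarrow> real \<Rightarrow> star_fun \<Rightarrow> complex" where
  "G l t f = star_integral n (\<lambda>j y. cnj (Ft l t j y) * f j y)"

lemma continuous_on_Ft [continuous_intros]:
  assumes l: "l \<in> {1..n}" and k: "k \<in> {1..n}" and g: "continuous_on S g" and h: "continuous_on S h"
  shows "continuous_on S (\<lambda>p. Ft l (g p) k (h p))"
proof -
  have 1: "continuous_on S (\<lambda>p. \<kappa> j (of_real (g p)))" if "j \<in> {1..n}" for j
    by (rule continuous_on_compose2[OF continuous_on_kap[where c=c and k=j, OF c_pos[OF that]]])
      (auto intro!: continuous_intros g)
  have 2: "continuous_on S (\<lambda>p. W (of_real (g p)))"
    by (rule continuous_on_compose2[OF continuous_on_kapW[where c=c and n=n, OF c_pos]])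
      (auto intro!: continuous_intros g)
  show ?thesis
    unfolding Ft_def using c_pos[OF l]
    by (cases "k = l") (auto intro!: continuous_intros 1 2 h l k)
qed

text \<open>This is the jump of the resolvent kernel across the spectrum; in the notation of the
  generalized eigenfunctions it reads \<open>- Im K(x, y) = \<Sum>\<^sub>l q\<^sub>l F\<^sub>l(x) cnj (F\<^sub>l(y))\<close>.\<close>

lemma Im_resolvent_form_real:
  assumes R: "0 \<le> R" and f: "\<And>k. k \<in> {1..n} \<Longrightarrow> continuous_on {0..} (f k)"
    and supp: "\<And>k x. k \<in> {1..n} \<Longrightarrow> x \<ge> R \<Longrightarrow> f k x = 0" and W0: "W (of_real t) \<noteq> 0"
  shows "- Im (resolvent_form n c a R f (of_real t)) = (\<Sum>l=1..n. qr l t * (cmod (G l t f))\<^sup>2)"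
proof -
  let ?k = "\<lambda>k. \<kappa> k (of_real t)"
  let ?W = "W (of_real t)"
  define \<xi> where "\<xi> k = Im (?k k)" for k
  define s where "s k = Is R (?k k) (f k)" for k
  define P where "P = (\<Sum>k=1..n. Ie R (?k k) (f k))"
  define P' where "P' = (\<Sum>k=1..n. integral {0..R} (\<lambda>y. cnj (expm (?k k) y) * f k y))"
  define T where "T = (\<Sum>k=1..n. of_real (\<xi> k) * s k)"
  note ax = kap_of_real_cases[of c a _ t]
  have f': "continuous_on {0..R} (f k)" if "k \<in> {1..n}" for k by (rule continuous_on_subset[OF f[OF that]]) auto
  have i: "(\<lambda>y. g y * f k y) integrable_on {0..R}" if "k \<in> {1..n}" "continuous_on {0..R} g" for k g
    using that by (intro integrable_continuous_real continuous_intros f')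
  have ce: "continuous_on {0..R} (expm q)" "continuous_on {0..R} (sinhq q)" for q
    by (intro continuous_intros)+
  have e: "integral {0..R} (\<lambda>y. cnj (expm (?k k) y) * f k y) = Ie R (?k k) (f k) + 2 * \<i> * of_real (\<xi> k) * s k"
    if k: "k \<in> {1..n}" for k
  proof -
    have "integral {0..R} (\<lambda>y. cnj (expm (?k k) y) * f k y) =
      integral {0..R} (\<lambda>y. expm (?k k) y * f k y + (2 * \<i> * of_real (\<xi> k)) * (sinhq (?k k) y * f k y))"
      by (simp only: on_axis[OF ax] \<xi>_def distrib_right mult.assoc)
    also have "\<dots> = integral {0..R} (\<lambda>y. expm (?k k) y * f k y) + integral {0..R} (\<lambda>y. (2 * \<i> * of_real (\<xi> k)) * (sinhq (?k k) y * f k y))"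
      by (intro Henstock_Kurzweil_Integration.integral_add integrable_on_mult_right i[OF k] ce)
    finally show ?thesis by (simp add: Ie_def s_def Is_def)
  qed
  \<comment> \<open>The change of the exponentials under conjugation, summed over the branches; it
    allows P to be eliminated in favour of P'.\<close>
  have PT: "P' = P + 2 * \<i> * T"
    unfolding P'_def P_def T_def by (simp add: e sum.distrib sum_distrib_left mult.assoc)
  have cP: "(\<Sum>k=1..n. Ie R (?k k) (\<lambda>x. cnj (f k x))) = cnj P'"
    unfolding P'_def Ie_def by (simp add: Henstock_Kurzweil_Integration.integral_cnj)
  have G: "G l t f = P' + cnj ?W / of_real (c l) * s l" if l: "l \<in> {1..n}" for l
  proof -
    have "(LINT y|lebesgue_on {0<..}. cnj (Ft l t j y) * f j y) =
       integral {0..R} (\<lambda>y. cnj (expm (?k j) y) * f j y) + (if j = l then cnj ?W / of_real (c l) * s l else 0)"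
      if j: "j \<in> {1..n}" for j
    proof -
      have "(LINT y|lebesgue_on {0<..}. cnj (Ft l t j y) * f j y) = integral {0..R} (\<lambda>y. cnj (Ft l t j y) * f j y)"
        using supp[OF j] by (intro half_line_integral continuous_intros l j f') auto
      also have "\<dots> = integral {0..R} (\<lambda>y. cnj (expm (?k j) y) * f j y
          + (if j = l then cnj ?W / of_real (c l) else 0) * (sinhq (?k j) y * f j y))"
        by (intro Henstock_Kurzweil_Integration.integral_cong) (auto simp: Ft_def on_axis(1)[OF ax] algebra_simps)
      also have "\<dots> = integral {0..R} (\<lambda>y. cnj (expm (?k j) y) * f j y)
          + integral {0..R} (\<lambda>y. (if j = l then cnj ?W / of_real (c l) else 0) * (sinhq (?k j) y * f j y))"
        by (intro Henstock_Kurzweil_Integration.integral_add integrable_on_mult_right i[OF j] ce continuous_intros)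
      also have "integral {0..R} (\<lambda>y. (if j = l then cnj ?W / of_real (c l) else 0) * (sinhq (?k j) y * f j y))
          = (if j = l then cnj ?W / of_real (c l) * s l else 0)"
        unfolding Henstock_Kurzweil_Integration.integral_mult_right by (auto simp: s_def Is_def)
      finally show ?thesis .
    qed
    then show ?thesis using l by (simp add: G_def star_integral_def sum.distrib P'_def)
  qed
  have ImW: "Im ?W = (\<Sum>k=1..n. c k * \<xi> k)" by (simp add: kapW_def \<xi>_def)
  let ?w2 = "(cmod ?W)\<^sup>2"
  have w2: "?w2 > 0" using W0 by simp
  have term1: "Im (Jg R (?k k) (f k) / of_real (c k)) = - \<xi> k * (cmod (s k))\<^sup>2 / c k" if "k \<in> {1..n}" for k
    using Im_Jg[OF ax f[OF that], of R] by (simp add: \<xi>_def s_def Im_divide_of_real)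
  have "- Im (P * cnj P' / ?W) = (Im ?W * (cmod P')\<^sup>2 + 2 * Re (T * cnj P' * cnj ?W)) / ?w2"
  proof -
    have "P * cnj P' / ?W = (P' - 2 * \<i> * T) * cnj P' * cnj ?W / of_real ?w2"
      unfolding complex_norm_square using W0 by (simp add: PT)
    also have "\<dots> = (of_real ((cmod P')\<^sup>2) * cnj ?W - 2 * \<i> * (T * cnj P' * cnj ?W)) / of_real ?w2"
      unfolding complex_norm_square by (simp add: algebra_simps)
    finally have eq: "P * cnj P' / ?W = (of_real ((cmod P')\<^sup>2) * cnj ?W - 2 * \<i> * (T * cnj P' * cnj ?W)) / of_real ?w2" .
    have "- Im (of_real ((cmod P')\<^sup>2) * cnj ?W - 2 * \<i> * (T * cnj P' * cnj ?W)) =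
        Im ?W * (cmod P')\<^sup>2 + 2 * Re (T * cnj P' * cnj ?W)"
      by (simp add: algebra_simps)
    then show ?thesis unfolding eq Im_divide_of_real minus_divide_left by (rule arg_cong)
  qed
  moreover have "(\<Sum>l=1..n. qr l t * (cmod (G l t f))\<^sup>2) =
      (Im ?W * (cmod P')\<^sup>2 + 2 * Re (T * cnj P' * cnj ?W)) / ?w2 + (\<Sum>k=1..n. \<xi> k * (cmod (s k))\<^sup>2 / c k)"
  proof -
    \<comment> \<open>Expanding |G_l|^2 gives three kinds of terms. In the sum over l, the squares
      of P' collect to Im W, the mixed terms to T, and the squares of s_l to the Dirichlet
      contributions.\<close>
    have "qr l t * (cmod (G l t f))\<^sup>2 =
      (c l * \<xi> l * (cmod P')\<^sup>2 + 2 * (\<xi> l * Re (s l * cnj P' * cnj ?W))) / ?w2 + \<xi> l * (cmod (s l))\<^sup>2 / c l"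
      if l: "l \<in> {1..n}" for l
    proof -
      have sq: "(cmod (p + q))\<^sup>2 = (cmod p)\<^sup>2 + 2 * Re (q * cnj p) + (cmod q)\<^sup>2" for p q
        unfolding cmod_power2 by (simp add: power2_eq_square algebra_simps)
      have "(cmod (G l t f))\<^sup>2 = (cmod P')\<^sup>2 + 2 * Re (cnj ?W / of_real (c l) * s l * cnj P') + (cmod (cnj ?W / of_real (c l) * s l))\<^sup>2"
        unfolding G[OF l] by (rule sq)
      also have "Re (cnj ?W / of_real (c l) * s l * cnj P') = Re (s l * cnj P' * cnj ?W) / c l"
        by (simp add: Re_divide_of_real[symmetric] mult_ac del: Re_divide_of_real)
      also have "(cmod (cnj ?W / of_real (c l) * s l))\<^sup>2 = ?w2 * (cmod (s l))\<^sup>2 / (c l)\<^sup>2"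
        by (simp add: norm_mult norm_divide power_mult_distrib power_divide)
      finally have qq: "qr l t * (cmod (G l t f))\<^sup>2 = c l * \<xi> l / ?w2 *
        ((cmod P')\<^sup>2 + 2 * (Re (s l * cnj P' * cnj ?W) / c l) + ?w2 * (cmod (s l))\<^sup>2 / (c l)\<^sup>2)"
        by (simp add: qr_def \<xi>_def)
      have alg: "C * x / w * (A + 2 * (B / C) + w * S / C\<^sup>2) = (C * x * A + 2 * (x * B)) / w + x * S / C"
        if "C \<noteq> 0" "w \<noteq> 0" for C w A B S x :: real
        using that by (simp add: field_simps power2_eq_square)
      show ?thesis unfolding qq by (rule alg) (use c_pos[OF l] w2 in auto)
    qed
    then have "(\<Sum>l=1..n. qr l t * (cmod (G l t f))\<^sup>2) =
      (\<Sum>l=1..n. c l * \<xi> l * (cmod P')\<^sup>2 + 2 * (\<xi> l * Re (s l * cnj P' * cnj ?W))) / ?w2 + (\<Sum>k=1..n. \<xi> k * (cmod (s k))\<^sup>2 / c k)"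
      unfolding sum_divide_distrib sum.distrib[symmetric] by (intro sum.cong refl)
    also have "(\<Sum>l=1..n. c l * \<xi> l * (cmod P')\<^sup>2 + 2 * (\<xi> l * Re (s l * cnj P' * cnj ?W))) =
        Im ?W * (cmod P')\<^sup>2 + 2 * Re (T * cnj P' * cnj ?W)"
    proof -
      have "T * cnj P' * cnj ?W = (\<Sum>l=1..n. of_real (\<xi> l) * (s l * cnj P' * cnj ?W))"
        by (simp add: T_def sum_distrib_right mult.assoc)
      then have "Re (T * cnj P' * cnj ?W) = (\<Sum>l=1..n. \<xi> l * Re (s l * cnj P' * cnj ?W))" by simp
      then show ?thesis by (simp only: sum.distrib ImW sum_distrib_right sum_distrib_left)
    qed
    finally show ?thesis .
  qed
  moreover have "Im (\<Sum>k=1..n. Jg R (?k k) (f k) / of_real (c k)) = - (\<Sum>k=1..n. \<xi> k * (cmod (s k))\<^sup>2 / c k)"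
    using term1 by (simp add: sum_negf[symmetric] del: Im_divide_of_real)
  ultimately show ?thesis
    unfolding resolvent_form_def cP P_def[symmetric] plus_complex.sel by linarith
qed

end

subsection \<open>The spectral projections as integral operators\<close>

lemma (in pair_sigma_finite) integrable_fst_times_snd:
  fixes f :: "_ \<Rightarrow> real" and g :: "_ \<Rightarrow> real"
  assumes f: "integrable M1 f" and g: "integrable M2 g"
  shows "integrable (M1 \<Otimes>\<^sub>M M2) (\<lambda>p. f (fst p) * g (snd p))"
proof (rule Fubini_integrable)
  note [measurable] = borel_measurable_integrable[OF f] borel_measurable_integrable[OF g]
  show "(\<lambda>p. f (fst p) * g (snd p)) \<in> borel_measurable (M1 \<Otimes>\<^sub>M M2)" by measurable
  show "integrable M1 (\<lambda>x. \<integral>y. norm (f (fst (x, y)) * g (snd (x, y))) \<partial>M2)"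
    using f by (simp add: abs_mult)
  show "AE x in M1. integrable M2 (\<lambda>y. f (fst (x, y)) * g (snd (x, y)))"
    using g by simp
qed

text \<open>Stone's formula is stated with closed intervals and Borel measure,
  \<open>pointwise_integral\<close> with open intervals and completed measure; the two endpoints are
  a null set.\<close>

lemma lborel_integral_open:
  fixes g :: "real \<Rightarrow> 'b::{banach, second_countable_topology}"
  assumes g: "g \<in> borel_measurable borel"
  shows "set_integrable lborel {\<alpha>..\<beta>} g \<longleftrightarrow> integrable (lebesgue_on {\<alpha><..<\<beta>}) g"
    "(LINT s:{\<alpha>..\<beta>}|lborel. g s) = (LINT s|lebesgue_on {\<alpha><..<\<beta>}. g s)"
proof -
  have ae: "AE s in lborel. indicator {\<alpha>..\<beta>} s *\<^sub>R g s = indicator {\<alpha><..<\<beta>} s *\<^sub>R g s"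
    using AE_lborel_singleton[of \<alpha>] AE_lborel_singleton[of \<beta>]
    by eventually_elim (auto simp: indicator_def)
  have m: "(\<lambda>s. indicator {\<alpha>..\<beta>} s *\<^sub>R g s) \<in> borel_measurable lborel"
    "(\<lambda>s. indicator {\<alpha><..<\<beta>} s *\<^sub>R g s) \<in> borel_measurable lborel"
    using g by auto
  show "set_integrable lborel {\<alpha>..\<beta>} g \<longleftrightarrow> integrable (lebesgue_on {\<alpha><..<\<beta>}) g"
    unfolding set_integrable_def using integrable_cong_AE[OF m ae] m
    by (simp add: integrable_restrict_space integrable_completion)
  show "(LINT s:{\<alpha>..\<beta>}|lborel. g s) = (LINT s|lebesgue_on {\<alpha><..<\<beta>}. g s)"
    unfolding set_lebesgue_integral_def using integral_cong_AE[OF m ae] m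
    by (simp add: integral_restrict_space integral_completion)
qed

lemma borel_measurable_half_line:
  fixes g :: "real \<Rightarrow> complex"
  assumes "continuous_on {0..} g" shows "g \<in> borel_measurable (lebesgue_on {0<..})"
  by (rule continuous_imp_measurable_on_sets_lebesgue[OF continuous_on_subset[OF assms]]) auto

context star_network
begin

section \<open>Functions of bounded support and estimates for their transforms\<close>

definition local_fun :: "real \<Rightarrow> star_fun \<Rightarrow> bool" where
  "local_fun R f \<longleftrightarrow> f \<in> H \<and> (\<forall>k\<in>{1..n}. \<forall>x>R. f k x = 0)"

text \<open>The functions with an explicit resolvent. Vanishing at R itself is included, so that
  cutting off at R preserves continuity.\<close>

definition cont_fun :: "real \<Rightarrow> star_fun \<Rightarrow> bool" where
  "cont_fun R f \<longleftrightarrow> 0 \<le> R \<and> (\<forall>k\<in>{1..n}. continuous_on {0..} (f k) \<and> (\<forall>x\<ge>R. f k x = 0))"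

lemma cont_fun_local: "cont_fun R f \<Longrightarrow> local_fun R f"
  unfolding cont_fun_def local_fun_def L2_star_def
  by (auto intro!: bounded_support_L2_half[of R] elim!: continuous_on_subset)

lemma cont_fun_mono: "cont_fun R f \<Longrightarrow> R \<le> R' \<Longrightarrow> cont_fun R' f"
  unfolding cont_fun_def by force

lemma local_fun_mono: "local_fun R f \<Longrightarrow> R \<le> R' \<Longrightarrow> local_fun R' f"
  unfolding local_fun_def by force

lemma cont_fun_lin: "cont_fun R f \<Longrightarrow> cont_fun R h \<Longrightarrow> cont_fun R (star_lin z f w h)"
  unfolding cont_fun_def star_lin_def by (auto intro!: continuous_intros)

lemma local_fun_integrable:
  assumes f: "local_fun R f" and k: "k \<in> {1..n}"
  shows "integrable (lebesgue_on {0<..}) (f k)"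
proof -
  let ?i = "\<lambda>x. if x \<le> R then 1 else (0::complex)"
  have "continuous_on {0..R} ?i" by (rule continuous_on_eq[OF continuous_on_const[of _ 1]]) auto
  then have "?i \<in> L2_half" by (rule bounded_support_L2_half) auto
  moreover have "f k \<in> L2_half" using f k by (auto simp: local_fun_def L2_star_def)
  ultimately have "integrable (lebesgue_on {0<..}) (\<lambda>x. f k x * ?i x)"
    by (intro L2_half_mult_integrable)
  moreover have "(\<lambda>x. f k x * ?i x) = f k" using f k by (auto simp: local_fun_def fun_eq_iff not_le)
  ultimately show ?thesis by simp
qed

lemma Ft_bound:
  obtains B where "0 \<le> B"
    "\<And>l k t x. l \<in> {1..n} \<Longrightarrow> k \<in> {1..n} \<Longrightarrow> t \<in> {\<alpha>..\<beta>} \<Longrightarrow> x \<in> {0..R} \<Longrightarrow> cmod (Ft l t k x) \<le> B"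
proof -
  define P where "P l k b \<longleftrightarrow> 0 \<le> b \<and> (\<forall>t\<in>{\<alpha>..\<beta>}. \<forall>x\<in>{0..R}. cmod (Ft l t k x) \<le> b)" for l k b
  have ex: "\<exists>b. P l k b" if "l \<in> {1..n}" "k \<in> {1..n}" for l k
  proof -
    let ?F = "(\<lambda>p. Ft l (fst p) k (snd p)) ` ({\<alpha>..\<beta>} \<times> {0..R})"
    have "compact ?F"
      by (intro compact_continuous_image compact_Times compact_Icc continuous_intros that)
    then have "bounded ?F" by (rule compact_imp_bounded)
    then obtain B where B: "\<And>q. q \<in> ?F \<Longrightarrow> cmod q \<le> B" unfolding bounded_iff by blast
    have "cmod (Ft l t k x) \<le> max B 0" if "t \<in> {\<alpha>..\<beta>}" "x \<in> {0..R}" for t x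
      using B[of "Ft l t k x"] that by (force simp: le_max_iff_disj)
    then have "P l k (max B 0)" by (simp add: P_def)
    then show ?thesis by blast
  qed
  define b where "b l k = (SOME b. P l k b)" for l k
  have P: "P l k (b l k)" if "l \<in> {1..n}" "k \<in> {1..n}" for l k
    unfolding b_def by (rule someI_ex[OF ex[OF that]])
  have b: "\<And>l k. l \<in> {1..n} \<Longrightarrow> k \<in> {1..n} \<Longrightarrow> 0 \<le> b l k"
      "\<And>l k t x. l \<in> {1..n} \<Longrightarrow> k \<in> {1..n} \<Longrightarrow> t \<in> {\<alpha>..\<beta>} \<Longrightarrow> x \<in> {0..R} \<Longrightarrow> cmod (Ft l t k x) \<le> b l k"
    using P unfolding P_def by auto
  show thesis
  \<comment> \<open>The sum of finitely many nonnegative constants dominates each of them, giving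
    one bound for all branches.\<close>
  proof (rule that[of "\<Sum>l=1..n. \<Sum>k=1..n. b l k"])
    show "0 \<le> (\<Sum>l=1..n. \<Sum>k=1..n. b l k)" using b(1) by (intro sum_nonneg) auto
    fix l k t x assume *: "l \<in> {1..n}" "k \<in> {1..n}" "t \<in> {\<alpha>..\<beta>}" "x \<in> {0..R}"
    have "cmod (Ft l t k x) \<le> b l k" by (rule b(2)[OF *])
    also have "\<dots> \<le> (\<Sum>k=1..n. b l k)" using * b(1) by (intro member_le_sum) auto
    also have "\<dots> \<le> (\<Sum>l=1..n. \<Sum>k=1..n. b l k)" using * b(1)
      by (intro member_le_sum[where f="\<lambda>l. \<Sum>k=1..n. b l k"] sum_nonneg) auto
    finally show "cmod (Ft l t k x) \<le> (\<Sum>l=1..n. \<Sum>k=1..n. b l k)" .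
  qed
qed

lemma borel_measurable_kapW: "(\<lambda>t. W (of_real t)) \<in> borel_measurable borel"
  by (intro borel_measurable_continuous_onI continuous_on_compose2[OF continuous_on_kapW[where c=c and n=n, OF c_pos]])
    (auto intro!: continuous_intros)

lemma qr_measurable: "l \<in> {1..n} \<Longrightarrow> qr l \<in> borel_measurable borel"
proof -
  assume l: "l \<in> {1..n}"
  have "(\<lambda>t. \<kappa> l (of_real t)) \<in> borel_measurable borel"
    by (intro borel_measurable_continuous_onI continuous_on_compose2[OF continuous_on_kap[where c=c and k=l, OF c_pos[OF l]]])
      (auto intro!: continuous_intros)
  then show ?thesis unfolding qr_def[abs_def] using borel_measurable_kapW by measurable
qed

text \<open>By \<open>kapW_lower\<close> the numerator c_l Im \<kappa>_l is at most 2 |W|, so q_l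
  \<le> 2/|W|, and 1/|W| has an integrable inverse square root as majorant.\<close>

lemma qr_integrable:
  assumes l: "l \<in> {1..n}" shows "integrable (lebesgue_on {\<alpha><..<\<beta>}) (qr l)"
proof (cases "\<alpha> \<le> \<beta>")
  case True
  have "set_integrable lborel {\<alpha>..\<beta>} (qr l)"
    unfolding set_integrable_def
  proof (rule Bochner_Integration.integrable_bound)
    have "set_integrable lborel {\<alpha>..\<beta>} (\<lambda>s. 4 / sqrt (c 1) * (1 / sqrt \<bar>s - a 1\<bar>))"
      using True by (intro set_integrable_mult_right integrable_inverse_sqrt) auto
    then show "integrable lborel (\<lambda>s. indicator {\<alpha>..\<beta>} s *\<^sub>R (4 / sqrt (c 1) * (1 / sqrt \<bar>s - a 1\<bar>)))"
      by (simp add: set_integrable_def)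
    show "(\<lambda>s. indicator {\<alpha>..\<beta>} s *\<^sub>R qr l s) \<in> borel_measurable lborel"
      using qr_measurable[OF l] by simp
    have bnd: "\<bar>qr l s\<bar> \<le> 4 / sqrt (c 1) * (1 / sqrt \<bar>s - a 1\<bar>)" if s: "s \<noteq> a 1" for s
    proof -
      let ?w = "cmod (W (of_real s))"
      have w: "?w > 0" using W_nonzero[of "of_real s" 1] s n_pos by simp
      have "c l * Im (\<kappa> l (of_real s)) \<le> c l * cmod (\<kappa> l (of_real s))"
        using c_pos[OF l] abs_Im_le_cmod[of "\<kappa> l (of_real s)"] by (intro mult_left_mono) auto
      also have "\<dots> \<le> 2 * ?w" using kapW_lower[where n=n and c=c and z="of_real s" and k=l and a=a] c_pos l by simp
      finally have "qr l s \<le> 2 * ?w / ?w\<^sup>2" unfolding qr_def by (intro divide_right_mono) auto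
      also have "\<dots> = 2 * (1 / ?w)" using w by (simp add: power2_eq_square)
      also have "\<dots> \<le> 2 * ((2 / sqrt (c 1)) * (1 / sqrt \<bar>s - a 1\<bar>))"
        using inverse_W_bound[of 0 s] s by (intro mult_left_mono) (auto simp: Complex_eq)
      finally show ?thesis using qr_nonneg[OF l, of s] by simp
    qed
    show "AE s in lborel. norm (indicator {\<alpha>..\<beta>} s *\<^sub>R qr l s) \<le> norm (indicator {\<alpha>..\<beta>} s *\<^sub>R (4 / sqrt (c 1) * (1 / sqrt \<bar>s - a 1\<bar>)))"
      using AE_lborel_singleton[of "a 1"]
    proof eventually_elim
      fix s assume "s \<noteq> a 1"
      then have "\<bar>qr l s\<bar> \<le> \<bar>4 / sqrt (c 1) * (1 / sqrt \<bar>s - a 1\<bar>)\<bar>"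
        by (rule order_trans[OF bnd abs_ge_self])
      then show "norm (indicator {\<alpha>..\<beta>} s *\<^sub>R qr l s) \<le> norm (indicator {\<alpha>..\<beta>} s *\<^sub>R (4 / sqrt (c 1) * (1 / sqrt \<bar>s - a 1\<bar>)))"
        by (auto simp: indicator_def)
    qed
  qed
  then show ?thesis using lborel_integral_open(1)[OF qr_measurable[OF l]] by blast
next
  case False
  then have "{\<alpha><..<\<beta>} = {}" by auto
  then show ?thesis by (simp only:) (rule integrable_lebesgue_on_empty)
qed

lemma Ft_measurable_pair:
  assumes "l \<in> {1..n}" "k \<in> {1..n}"
    and [measurable]: "(\<lambda>t. t) \<in> borel_measurable M" "(\<lambda>t. t) \<in> borel_measurable N"
  shows "(\<lambda>p. Ft l (fst p) k (snd p)) \<in> borel_measurable (M \<Otimes>\<^sub>M N)"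
proof -
  have "continuous_on UNIV (\<lambda>p. Ft l (fst p) k (snd p))"
    by (intro continuous_intros assms)
  then have m: "(\<lambda>p. Ft l (fst p) k (snd p)) \<in> borel_measurable borel" by (rule borel_measurable_continuous_onI)
  have "(\<lambda>p. (fst p, snd p)) \<in> measurable (M \<Otimes>\<^sub>M N) (borel \<Otimes>\<^sub>M borel)"
    by measurable
  then have "(\<lambda>p. p) \<in> measurable (M \<Otimes>\<^sub>M N) (borel :: (real \<times> real) measure)"
    by (simp add: borel_prod)
  from measurable_compose[OF this m] show ?thesis by simp
qed

lemma id_measurable_lebesgue_on: "(\<lambda>t. t) \<in> borel_measurable (lebesgue_on S)" for S :: "real set"
  using id_borel_measurable_lebesgue_on[of S] by (simp add: id_def)

lemma Ft_times_integrable: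
  assumes f: "local_fun R f" and l: "l \<in> {1..n}" and k: "k \<in> {1..n}"
    and B: "\<And>x. x \<in> {0..R} \<Longrightarrow> cmod (Ft l t k x) \<le> B"
  shows "integrable (lebesgue_on {0<..}) (\<lambda>y. cnj (Ft l t k y) * f k y)"
    "cmod (LINT y|lebesgue_on {0<..}. cnj (Ft l t k y) * f k y) \<le> B * (LINT y|lebesgue_on {0<..}. cmod (f k y))"
proof -
  note i = local_fun_integrable[OF f k]
  have "continuous_on {0..} (Ft l t k)"
    using continuous_on_Ft[OF l k continuous_on_const continuous_on_id] .
  then have m: "(\<lambda>y. cnj (Ft l t k y) * f k y) \<in> borel_measurable (lebesgue_on {0<..})"
    using borel_measurable_times[OF borel_measurable_half_line[OF continuous_on_cnj] borel_measurable_integrable[OF i]] by blast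
  have le: "norm (cnj (Ft l t k y) * f k y) \<le> B * cmod (f k y)" if "y > 0" for y
  proof (cases "y \<le> R")
    case True then show ?thesis using B[of y] that by (auto simp: norm_mult intro!: mult_right_mono)
  next
    case False then show ?thesis using f k by (simp add: local_fun_def)
  qed
  show I: "integrable (lebesgue_on {0<..}) (\<lambda>y. cnj (Ft l t k y) * f k y)"
    by (rule Bochner_Integration.integrable_bound[OF integrable_mult_right[OF integrable_norm[OF i], of B] m])
      (use le in \<open>auto intro!: AE_I2 intro: order_trans[OF _ abs_ge_self]\<close>)
  have "cmod (LINT y|lebesgue_on {0<..}. cnj (Ft l t k y) * f k y) \<le> (LINT y|lebesgue_on {0<..}. norm (cnj (Ft l t k y) * f k y))"
    by (rule integral_norm_bound)
  also have "\<dots> \<le> (LINT y|lebesgue_on {0<..}. B * cmod (f k y))"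
    by (rule integral_mono[OF integrable_norm[OF I] integrable_mult_right[OF integrable_norm[OF i]]]) (use le in auto)
  finally show "cmod (LINT y|lebesgue_on {0<..}. cnj (Ft l t k y) * f k y) \<le> B * (LINT y|lebesgue_on {0<..}. cmod (f k y))"
    by simp
qed

lemma Ft_times_integrable':
  assumes f: "local_fun R f" and l: "l \<in> {1..n}" and k: "k \<in> {1..n}"
  shows "integrable (lebesgue_on {0<..}) (\<lambda>y. cnj (Ft l t k y) * f k y)"
proof -
  obtain B where "0 \<le> B" "\<And>l k s x. l \<in> {1..n} \<Longrightarrow> k \<in> {1..n} \<Longrightarrow> s \<in> {t..t} \<Longrightarrow> x \<in> {0..R} \<Longrightarrow> cmod (Ft l s k x) \<le> B"
    by (rule Ft_bound[of t t R]) blast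
  then show ?thesis using l k by (intro Ft_times_integrable(1)[OF f l k, where B=B]) auto
qed

lemma G_lin:
  assumes f: "local_fun R f" and h: "local_fun R h" and l: "l \<in> {1..n}"
  shows "G l t (star_lin z f w h) = z * G l t f + w * G l t h"
proof -
  have "(LINT y|lebesgue_on {0<..}. cnj (Ft l t k y) * (z * f k y + w * h k y)) =
     z * (LINT y|lebesgue_on {0<..}. cnj (Ft l t k y) * f k y) + w * (LINT y|lebesgue_on {0<..}. cnj (Ft l t k y) * h k y)"
    if k: "k \<in> {1..n}" for k
  proof -
    have "(LINT y|lebesgue_on {0<..}. cnj (Ft l t k y) * (z * f k y + w * h k y)) =
      (LINT y|lebesgue_on {0<..}. z * (cnj (Ft l t k y) * f k y) + w * (cnj (Ft l t k y) * h k y))"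
      by (rule Bochner_Integration.integral_cong[OF refl]) (simp only: distrib_left mult.left_commute)
    then show ?thesis using Ft_times_integrable'[OF f l k] Ft_times_integrable'[OF h l k] by simp
  qed
  then show ?thesis
    unfolding G_def star_integral_def star_lin_def by (simp add: sum.distrib sum_distrib_left)
qed

lemma G_measurable:
  assumes f: "local_fun R f" and l: "l \<in> {1..n}"
  shows "(\<lambda>t. G l t f) \<in> borel_measurable borel"
  unfolding G_def star_integral_def
proof (rule borel_measurable_sum)
  fix k assume k: "k \<in> {1..n}"
  interpret X: sigma_finite_measure "lebesgue_on {0::real<..}" by (rule sigma_finite_lebesgue_on) simp
  have 1: "(\<lambda>p. Ft l (fst p) k (snd p)) \<in> borel_measurable (borel \<Otimes>\<^sub>M lebesgue_on {0<..})"
    by (rule Ft_measurable_pair[OF l k _ id_measurable_lebesgue_on]) simp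
  have 2: "(\<lambda>p. f k (snd p)) \<in> borel_measurable (borel \<Otimes>\<^sub>M lebesgue_on {0<..})"
    using measurable_compose[OF measurable_snd borel_measurable_integrable[OF local_fun_integrable[OF f k]]] .
  have "(\<lambda>p. cnj (Ft l (fst p) k (snd p))) \<in> borel_measurable (borel \<Otimes>\<^sub>M lebesgue_on {0<..})"
    using measurable_compose[OF 1 borel_measurable_continuous_onI[OF continuous_on_cnj[OF continuous_on_id]]] .
  then have "(\<lambda>(t, y). cnj (Ft l t k y) * f k y) \<in> borel_measurable (borel \<Otimes>\<^sub>M lebesgue_on {0<..})"
    unfolding case_prod_beta using 2 by (rule borel_measurable_times)
  then show "(\<lambda>t. LINT y|lebesgue_on {0<..}. cnj (Ft l t k y) * f k y) \<in> borel_measurable borel"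
    by (rule X.borel_measurable_lebesgue_integral)
qed

lemma G_bound:
  assumes f: "local_fun R f"
  obtains C where "0 \<le> C" "\<And>l t. l \<in> {1..n} \<Longrightarrow> t \<in> {\<alpha>..\<beta>} \<Longrightarrow> cmod (G l t f) \<le> C"
proof -
  obtain B where B: "0 \<le> B"
      "\<And>l k t x. l \<in> {1..n} \<Longrightarrow> k \<in> {1..n} \<Longrightarrow> t \<in> {\<alpha>..\<beta>} \<Longrightarrow> x \<in> {0..R} \<Longrightarrow> cmod (Ft l t k x) \<le> B"
    by (rule Ft_bound[of \<alpha> \<beta> R]) blast
  show thesis
  proof (rule that[of "\<Sum>k=1..n. B * (LINT y|lebesgue_on {0<..}. cmod (f k y))"])
    show "0 \<le> (\<Sum>k=1..n. B * (LINT y|lebesgue_on {0<..}. cmod (f k y)))"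
      using B by (intro sum_nonneg mult_nonneg_nonneg) auto
    fix l t assume "l \<in> {1..n}" "t \<in> {\<alpha>..\<beta>}"
    then show "cmod (G l t f) \<le> (\<Sum>k=1..n. B * (LINT y|lebesgue_on {0<..}. cmod (f k y)))"
      unfolding G_def star_integral_def
      by (intro order_trans[OF norm_sum] sum_mono Ft_times_integrable(2)[OF f] B(2)) auto
  qed
qed

text \<open>The density of \<pi> (E(.) f, h), as \<open>ip_E_formula\<close> shows on
  intervals.\<close>

definition Bf :: "star_fun \<Rightarrow> star_fun \<Rightarrow> real \<Rightarrow> complex" where
  "Bf f h t = (\<Sum>l=1..n. of_real (qr l t) * G l t f * cnj (G l t h))"

text \<open>The integrand of the spectral representation at the point x of branch k, before division
  by \<pi>.\<close>

definition dens :: "star_fun \<Rightarrow> real \<Rightarrow> star_fun" where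
  "dens f t k x = (\<Sum>l=1..n. of_real (qr l t) * Ft l t k x * G l t f)"

lemma qr_times_integrable:
  assumes l: "l \<in> {1..n}" and g: "g \<in> borel_measurable borel" "\<And>t. t \<in> {\<alpha>..\<beta>} \<Longrightarrow> cmod (g t) \<le> C"
  shows "integrable (lebesgue_on {\<alpha><..<\<beta>}) (\<lambda>t. of_real (qr l t) * g t)"
proof (rule Bochner_Integration.integrable_bound)
  show "integrable (lebesgue_on {\<alpha><..<\<beta>}) (\<lambda>t. qr l t * C)" using qr_integrable[OF l] by simp
  have "(\<lambda>t. of_real (qr l t) * g t) \<in> borel_measurable borel" using qr_measurable[OF l] g(1) by measurable
  then show "(\<lambda>t. of_real (qr l t) * g t) \<in> borel_measurable (lebesgue_on {\<alpha><..<\<beta>})"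
    using measurable_compose[OF id_measurable_lebesgue_on] by blast
  show "AE t in lebesgue_on {\<alpha><..<\<beta>}. norm (of_real (qr l t) * g t) \<le> norm (qr l t * C)"
    using g(2) qr_nonneg[OF l] by (intro AE_I2) (auto simp: norm_mult intro!: mult_left_mono intro: order_trans[OF _ abs_ge_self])
qed

lemma Bf_integrable:
  assumes f: "local_fun R f" and h: "local_fun R h"
  shows "integrable (lebesgue_on {\<alpha><..<\<beta>}) (Bf f h)" "Bf f h \<in> borel_measurable borel"
proof -
  obtain C where C: "0 \<le> C" "\<And>l t. l \<in> {1..n} \<Longrightarrow> t \<in> {\<alpha>..\<beta>} \<Longrightarrow> cmod (G l t f) \<le> C"
    using G_bound[OF f] by blast
  obtain C' where C': "0 \<le> C'" "\<And>l t. l \<in> {1..n} \<Longrightarrow> t \<in> {\<alpha>..\<beta>} \<Longrightarrow> cmod (G l t h) \<le> C'"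
    using G_bound[OF h] by blast
  have cm: "(\<lambda>t. cnj (G l t h)) \<in> borel_measurable borel" if "l \<in> {1..n}" for l
    using measurable_compose[OF G_measurable[OF h that] borel_measurable_continuous_onI[OF continuous_on_cnj[OF continuous_on_id]]] .
  have m: "(\<lambda>t. G l t f * cnj (G l t h)) \<in> borel_measurable borel" if "l \<in> {1..n}" for l
    using G_measurable[OF f that] cm[OF that] by measurable
  show "integrable (lebesgue_on {\<alpha><..<\<beta>}) (Bf f h)"
    unfolding Bf_def[abs_def] mult.assoc
  proof (rule Bochner_Integration.integrable_sum)
    fix l assume l: "l \<in> {1..n}"
    show "integrable (lebesgue_on {\<alpha><..<\<beta>}) (\<lambda>t. of_real (qr l t) * (G l t f * cnj (G l t h)))"
      using C C' l by (intro qr_times_integrable[OF l m[OF l], of _ _ "C * C'"]) (auto simp: norm_mult intro!: mult_mono)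
  qed
  show "Bf f h \<in> borel_measurable borel"
    unfolding Bf_def[abs_def] mult.assoc
  proof (rule borel_measurable_sum)
    fix l assume l: "l \<in> {1..n}"
    have "(\<lambda>t. complex_of_real (qr l t)) \<in> borel_measurable borel" using qr_measurable[OF l] by measurable
    then show "(\<lambda>t. of_real (qr l t) * (G l t f * cnj (G l t h))) \<in> borel_measurable borel"
      using m[OF l] by (rule borel_measurable_times)
  qed
qed

lemma ip_E_self_formula:
  assumes f: "cont_fun R f" and ab: "\<alpha> < \<beta>"
  shows "of_real pi * ip (E {\<alpha><..<\<beta>} f) f = (LINT t|lebesgue_on {\<alpha><..<\<beta>}. Bf f f t)"
proof -
  have R: "0 \<le> R" and cf: "\<And>k. k \<in> {1..n} \<Longrightarrow> continuous_on {0..} (f k)"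
    and supp: "\<And>k x. k \<in> {1..n} \<Longrightarrow> x \<ge> R \<Longrightarrow> f k x = 0"
    using f by (auto simp: cont_fun_def)
  have fl: "local_fun R f" by (rule cont_fun_local[OF f])
  then have fH: "f \<in> H" by (simp add: local_fun_def)
  have Bff: "Bf f f t = of_real (\<Sum>l=1..n. qr l t * (cmod (G l t f))\<^sup>2)" for t
    by (simp only: Bf_def mult.assoc complex_norm_square[symmetric] of_real_mult[symmetric] of_real_sum)
  define r where "r t = (\<Sum>l=1..n. qr l t * (cmod (G l t f))\<^sup>2)" for t
  have rm: "r \<in> borel_measurable borel"
  proof -
    have "(\<lambda>t. Re (Bf f f t)) \<in> borel_measurable borel" using Bf_integrable(2)[OF fl fl] by measurable
    then show ?thesis by (simp add: Bff r_def[abs_def] del: of_real_sum)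
  qed
  have "pi * measure (sd f) {\<alpha><..<\<beta>} = (LINT s:{\<alpha>..\<beta>}|lborel. - Im (resolvent_form n c a R f (of_real s)))"
    by (rule stone_formula[OF R cf supp ab])
  also have "\<dots> = (LINT s:{\<alpha>..\<beta>}|lborel. r s)"
    unfolding set_lebesgue_integral_def
  proof (rule integral_cong_AE)
    show "(\<lambda>s. indicator {\<alpha>..\<beta>} s *\<^sub>R - Im (resolvent_form n c a R f (of_real s))) \<in> borel_measurable lborel"
      using spectral_density(1)[OF R cf supp ab] by (simp add: set_integrable_def borel_measurable_integrable)
    show "(\<lambda>s. indicator {\<alpha>..\<beta>} s *\<^sub>R r s) \<in> borel_measurable lborel" using rm by simp
    show "AE s in lborel. indicator {\<alpha>..\<beta>} s *\<^sub>R - Im (resolvent_form n c a R f (of_real s)) = indicator {\<alpha>..\<beta>} s *\<^sub>R r s"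
      \<comment> \<open>W can vanish at s only if s equals every a_k, so excluding a_1
        suffices.\<close>
      using AE_lborel_singleton[of "a 1"]
    proof eventually_elim
      fix s assume "s \<noteq> a 1"
      then have "W (of_real s) \<noteq> 0" using n_pos by (intro W_nonzero[of _ 1]) auto
      then show "indicator {\<alpha>..\<beta>} s *\<^sub>R - Im (resolvent_form n c a R f (of_real s)) = indicator {\<alpha>..\<beta>} s *\<^sub>R r s"
        using Im_resolvent_form_real[OF R cf supp] by (simp add: r_def)
    qed
  qed
  also have "\<dots> = (LINT s|lebesgue_on {\<alpha><..<\<beta>}. r s)" by (rule lborel_integral_open(2)[OF rm])
  finally have "complex_of_real (pi * measure (sd f) {\<alpha><..<\<beta>}) = (LINT s|lebesgue_on {\<alpha><..<\<beta>}. Bf f f s)"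
    by (simp only: Bff r_def[symmetric] integral_complex_of_real)
  moreover have "ip (E {\<alpha><..<\<beta>} f) f = of_real (measure (sd f) {\<alpha><..<\<beta>})"
    using ip_E_self(2)[of "{\<alpha><..<\<beta>}" f] fH by (simp add: measure_sd)
  ultimately show ?thesis by simp
qed

lemma Bf_expand:
  assumes f: "local_fun R f" and h: "local_fun R h"
  shows "Bf (star_lin 1 f z h) (star_lin 1 f z h) t =
     Bf f f t + cnj z * Bf f h t + z * Bf h f t + z * cnj z * Bf h h t"
proof -
  show ?thesis
    unfolding Bf_def sum_distrib_left sum.distrib[symmetric]
    by (intro sum.cong refl) (simp add: G_lin[OF f h] algebra_simps)
qed

text \<open>The difference d of the two sides is sesquilinear and vanishes on the diagonal;
  inserting f + z h with z = 1 and z = i makes it vanish off the diagonal too.\<close>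

lemma ip_E_formula:
  assumes f: "cont_fun R f" and h: "cont_fun R h" and ab: "\<alpha> < \<beta>"
  shows "of_real pi * ip (E {\<alpha><..<\<beta>} f) h = (LINT t|lebesgue_on {\<alpha><..<\<beta>}. Bf f h t)"
proof -
  let ?S = "{\<alpha><..<\<beta>}"
  note fl = cont_fun_local[OF f] and hl = cont_fun_local[OF h]
  have H: "f \<in> H" "h \<in> H" using fl hl by (auto simp: local_fun_def)
  define d where "d u v = of_real pi * ip (E ?S u) v - (LINT t|lebesgue_on ?S. Bf u v t)" for u v
  have d0: "d u u = 0" if "cont_fun R u" for u using ip_E_self_formula[OF that ab] by (simp add: d_def)
  have ex: "d (star_lin 1 f z h) (star_lin 1 f z h) = d f f + cnj z * d f h + z * d h f + z * cnj z * d h h" for z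
  proof -
    have "(LINT t|lebesgue_on ?S. Bf (star_lin 1 f z h) (star_lin 1 f z h) t) =
      (LINT t|lebesgue_on ?S. Bf f f t) + cnj z * (LINT t|lebesgue_on ?S. Bf f h t)
        + z * (LINT t|lebesgue_on ?S. Bf h f t) + z * cnj z * (LINT t|lebesgue_on ?S. Bf h h t)"
      unfolding Bf_expand[OF fl hl] using Bf_integrable(1) fl hl by simp
    moreover have "ip (E ?S (star_lin 1 f z h)) (star_lin 1 f z h) =
      ip (E ?S f) f + cnj z * ip (E ?S f) h + z * ip (E ?S h) f + z * cnj z * ip (E ?S h) h"
      using H by (simp add: ip_E_lin_left ip_E_lin_right star_lin_L2 algebra_simps)
    ultimately show ?thesis unfolding d_def by (simp add: algebra_simps)
  qed
  have "cnj z * d f h + z * d h f = 0" for z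
    using ex[of z] d0[OF f] d0[OF h] d0[OF cont_fun_lin[OF f h, of 1 z]] by simp
  from this[of 1] this[of \<i>] have "d f h = 0" by (simp add: algebra_simps complex_eq_iff)
  then show ?thesis by (simp add: d_def)
qed

lemma dens_integrable:
  assumes f: "local_fun R f" and k: "k \<in> {1..n}" and x: "0 \<le> x"
  shows "integrable (lebesgue_on {\<alpha><..<\<beta>}) (\<lambda>t. dens f t k x)"
  unfolding dens_def mult.assoc
proof (rule Bochner_Integration.integrable_sum)
  fix l assume l: "l \<in> {1..n}"
  obtain C where C: "0 \<le> C" "\<And>l t. l \<in> {1..n} \<Longrightarrow> t \<in> {\<alpha>..\<beta>} \<Longrightarrow> cmod (G l t f) \<le> C"
    using G_bound[OF f] by blast
  obtain B where B: "0 \<le> B"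
      "\<And>l k t y. l \<in> {1..n} \<Longrightarrow> k \<in> {1..n} \<Longrightarrow> t \<in> {\<alpha>..\<beta>} \<Longrightarrow> y \<in> {0..x} \<Longrightarrow> cmod (Ft l t k y) \<le> B"
    by (rule Ft_bound[of \<alpha> \<beta> x]) blast
  have "continuous_on UNIV (\<lambda>t. Ft l t k x)" by (intro continuous_intros l k)
  then have "(\<lambda>t. Ft l t k x) \<in> borel_measurable borel" by (rule borel_measurable_continuous_onI)
  then have "(\<lambda>t. Ft l t k x * G l t f) \<in> borel_measurable borel" using G_measurable[OF f l] by measurable
  then show "integrable (lebesgue_on {\<alpha><..<\<beta>}) (\<lambda>t. of_real (qr l t) * (Ft l t k x * G l t f))"
    using B C l k x by (intro qr_times_integrable[OF l, of _ _ _ "B * C"]) (auto simp: norm_mult intro!: mult_mono)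
qed

text \<open>The majorant in t is uniform for x in [0, M]; it serves both the continuity in x and the
  application of Fubini.\<close>

lemma dens_bound:
  assumes f: "local_fun R f"
  obtains w where "integrable (lebesgue_on {\<alpha><..<\<beta>}) w" "\<And>t. 0 \<le> w t"
    "\<And>t k x. t \<in> {\<alpha><..<\<beta>} \<Longrightarrow> k \<in> {1..n} \<Longrightarrow> x \<in> {0..M} \<Longrightarrow> cmod (dens f t k x) \<le> w t"
proof -
  obtain C where C: "0 \<le> C" "\<And>l t. l \<in> {1..n} \<Longrightarrow> t \<in> {\<alpha>..\<beta>} \<Longrightarrow> cmod (G l t f) \<le> C"
    using G_bound[OF f] by blast
  obtain B where B: "0 \<le> B"
      "\<And>l k t y. l \<in> {1..n} \<Longrightarrow> k \<in> {1..n} \<Longrightarrow> t \<in> {\<alpha>..\<beta>} \<Longrightarrow> y \<in> {0..M} \<Longrightarrow> cmod (Ft l t k y) \<le> B"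
    by (rule Ft_bound[of \<alpha> \<beta> M]) blast
  show thesis
  proof (rule that[of "\<lambda>t. \<Sum>l=1..n. qr l t * (B * C)"])
    show "integrable (lebesgue_on {\<alpha><..<\<beta>}) (\<lambda>t. \<Sum>l=1..n. qr l t * (B * C))"
      using qr_integrable by (intro Bochner_Integration.integrable_sum integrable_mult_left) auto
    show "0 \<le> (\<Sum>l=1..n. qr l t * (B * C))" for t
      using qr_nonneg B C by (intro sum_nonneg mult_nonneg_nonneg) auto
    fix t k x assume *: "t \<in> {\<alpha><..<\<beta>}" "k \<in> {1..n}" "x \<in> {0..M}"
    have "cmod (of_real (qr l t) * Ft l t k x * G l t f) \<le> qr l t * (B * C)" if "l \<in> {1..n}" for l
      unfolding mult.assoc norm_mult using qr_nonneg[OF that, of t] B(1) B(2)[OF that *(2) _ *(3), of t] C(2)[OF that, of t] *(1)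
      by (auto intro!: mult_mono)
    then show "cmod (dens f t k x) \<le> (\<Sum>l=1..n. qr l t * (B * C))"
      unfolding dens_def by (intro order_trans[OF norm_sum] sum_mono) auto
  qed
qed

section \<open>The continuous representative of the projected function\<close>

definition gsol :: "real \<Rightarrow> real \<Rightarrow> star_fun \<Rightarrow> star_fun" where
  "gsol \<alpha> \<beta> f k x = (LINT t|lebesgue_on {\<alpha><..<\<beta>}. of_real (1 / pi) * dens f t k x)"

lemma continuous_on_gsol:
  assumes f: "local_fun R f" and k: "k \<in> {1..n}"
  shows "continuous_on {0..} (gsol \<alpha> \<beta> f k)"
  unfolding continuous_on_sequentially
proof (intro allI ballI impI)
  fix u :: "nat \<Rightarrow> real" and x :: real assume x: "x \<in> {0..}" and u: "(\<forall>m. u m \<in> {0..}) \<and> u \<longlonglongrightarrow> x"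
  then have "bounded (range u)" using convergent_imp_bounded by blast
  then obtain M where M: "\<And>m. \<bar>u m\<bar> \<le> M" by (auto simp: bounded_iff)
  have uM: "u m \<in> {0..M}" for m using u M[of m] by auto
  obtain w where w: "integrable (lebesgue_on {\<alpha><..<\<beta>}) w" "\<And>t. 0 \<le> w t"
    "\<And>t k x. t \<in> {\<alpha><..<\<beta>} \<Longrightarrow> k \<in> {1..n} \<Longrightarrow> x \<in> {0..M} \<Longrightarrow> cmod (dens f t k x) \<le> w t"
    using dens_bound[OF f] by blast
  have "(\<lambda>m. LINT t|lebesgue_on {\<alpha><..<\<beta>}. dens f t k (u m)) \<longlonglongrightarrow> (LINT t|lebesgue_on {\<alpha><..<\<beta>}. dens f t k x)"
  proof (rule integral_dominated_convergence[OF _ _ w(1)])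
    show "(\<lambda>t. dens f t k x) \<in> borel_measurable (lebesgue_on {\<alpha><..<\<beta>})"
      using x by (intro borel_measurable_integrable dens_integrable[OF f k]) auto
    show "(\<lambda>t. dens f t k (u m)) \<in> borel_measurable (lebesgue_on {\<alpha><..<\<beta>})" for m
      using u by (intro borel_measurable_integrable dens_integrable[OF f k]) auto
    show "AE t in lebesgue_on {\<alpha><..<\<beta>}. norm (dens f t k (u m)) \<le> w t" for m
      using w(3)[OF _ k uM] by (intro AE_I2) simp
    have "(\<lambda>m. Ft l t k (u m)) \<longlonglongrightarrow> Ft l t k x" if "l \<in> {1..n}" for l t
    proof -
      have "continuous_on {0..} (Ft l t k)" using continuous_on_Ft[OF that k continuous_on_const continuous_on_id] .
      then show ?thesis using x u by (auto simp: continuous_on_sequentially o_def)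
    qed
    then show "AE t in lebesgue_on {\<alpha><..<\<beta>}. (\<lambda>m. dens f t k (u m)) \<longlonglongrightarrow> dens f t k x"
      unfolding dens_def by (intro AE_I2 tendsto_sum tendsto_mult tendsto_const) auto
  qed
  then have "(\<lambda>m. of_real (1 / pi) * (LINT t|lebesgue_on {\<alpha><..<\<beta>}. dens f t k (u m)))
     \<longlonglongrightarrow> of_real (1 / pi) * (LINT t|lebesgue_on {\<alpha><..<\<beta>}. dens f t k x)"
    by (intro tendsto_mult tendsto_const)
  then show "(gsol \<alpha> \<beta> f k \<circ> u) \<longlonglongrightarrow> gsol \<alpha> \<beta> f k x"
    by (simp only: gsol_def o_def Bochner_Integration.integral_mult_right_zero)
qed

text \<open>As h vanishes beyond R, the product of the majorant w(t) with |h(x)| is integrable over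
  the product space, which justifies the exchange of integrals.\<close>

lemma gsol_Fubini:
  assumes f: "local_fun R f" and h: "local_fun R h"
  shows "of_real pi * ip (gsol \<alpha> \<beta> f) h = (LINT t|lebesgue_on {\<alpha><..<\<beta>}. Bf f h t)"
proof -
  let ?T = "lebesgue_on {\<alpha><..<\<beta>}" and ?X = "lebesgue_on {0::real<..}"
  interpret T: sigma_finite_measure ?T by (rule sigma_finite_lebesgue_on) simp
  interpret X: sigma_finite_measure ?X by (rule sigma_finite_lebesgue_on) simp
  interpret TX: pair_sigma_finite ?T ?X ..
  obtain w where w: "integrable ?T w" "\<And>t. 0 \<le> w t"
    "\<And>t k x. t \<in> {\<alpha><..<\<beta>} \<Longrightarrow> k \<in> {1..n} \<Longrightarrow> x \<in> {0..R} \<Longrightarrow> cmod (dens f t k x) \<le> w t"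
    using dens_bound[OF f] by blast
  have 1: "(LINT x|?X. of_real pi * (gsol \<alpha> \<beta> f k x * cnj (h k x))) =
      (LINT t|?T. (\<Sum>l=1..n. of_real (qr l t) * G l t f * cnj (LINT x|?X. cnj (Ft l t k x) * h k x)))"
    and 2: "integrable ?T (\<lambda>t. \<Sum>l=1..n. of_real (qr l t) * G l t f * cnj (LINT x|?X. cnj (Ft l t k x) * h k x))"
    if k: "k \<in> {1..n}" for k
  proof -
    note hi = local_fun_integrable[OF h k]
    have hm: "(\<lambda>x. cnj (h k x)) \<in> borel_measurable ?X"
      using borel_measurable_integrable[OF hi] measurable_compose[OF _ borel_measurable_continuous_onI[OF continuous_on_cnj[OF continuous_on_id]]] by blast
    have m: "(\<lambda>p. dens f (fst p) k (snd p) * cnj (h k (snd p))) \<in> borel_measurable (?T \<Otimes>\<^sub>M ?X)"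
    proof (rule borel_measurable_times)
      show "(\<lambda>p. cnj (h k (snd p))) \<in> borel_measurable (?T \<Otimes>\<^sub>M ?X)"
        using measurable_compose[OF measurable_snd hm] .
      show "(\<lambda>p. dens f (fst p) k (snd p)) \<in> borel_measurable (?T \<Otimes>\<^sub>M ?X)"
        unfolding dens_def
      proof (intro borel_measurable_sum borel_measurable_times)
        fix l assume l: "l \<in> {1..n}"
        have mT: "(\<lambda>p. g (fst p)) \<in> borel_measurable (?T \<Otimes>\<^sub>M ?X)" if "g \<in> borel_measurable borel" for g :: "real \<Rightarrow> complex"
          using measurable_compose[OF measurable_compose[OF measurable_fst id_measurable_lebesgue_on] that] .
        show "(\<lambda>p. complex_of_real (qr l (fst p))) \<in> borel_measurable (?T \<Otimes>\<^sub>M ?X)"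
          using qr_measurable[OF l] by (intro mT) measurable
        show "(\<lambda>p. G l (fst p) f) \<in> borel_measurable (?T \<Otimes>\<^sub>M ?X)" by (rule mT[OF G_measurable[OF f l]])
        show "(\<lambda>p. Ft l (fst p) k (snd p)) \<in> borel_measurable (?T \<Otimes>\<^sub>M ?X)"
          by (rule Ft_measurable_pair[OF l k id_measurable_lebesgue_on id_measurable_lebesgue_on])
      qed
    qed
    have int: "integrable (?T \<Otimes>\<^sub>M ?X) (\<lambda>p. dens f (fst p) k (snd p) * cnj (h k (snd p)))"
    proof (rule Bochner_Integration.integrable_bound[OF TX.integrable_fst_times_snd[OF w(1) integrable_norm[OF hi]] m])
      show "AE p in ?T \<Otimes>\<^sub>M ?X. norm (dens f (fst p) k (snd p) * cnj (h k (snd p))) \<le> norm (w (fst p) * norm (h k (snd p)))"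
      proof (rule AE_I2)
        fix p assume "p \<in> space (?T \<Otimes>\<^sub>M ?X)"
        then have p: "fst p \<in> {\<alpha><..<\<beta>}" "snd p > 0" by (auto simp: space_pair_measure)
        show "norm (dens f (fst p) k (snd p) * cnj (h k (snd p))) \<le> norm (w (fst p) * norm (h k (snd p)))"
        proof (cases "snd p \<le> R")
          case True
          then have "cmod (dens f (fst p) k (snd p)) \<le> w (fst p)" using w(3)[OF p(1) k] p(2) by simp
          then show ?thesis using w(2)[of "fst p"] by (simp add: norm_mult mult_right_mono)
        next
          case False
          then show ?thesis using h k by (simp add: local_fun_def)
        qed
      qed
    qed
    have inner: "(LINT x|?X. dens f t k x * cnj (h k x)) =
       (\<Sum>l=1..n. of_real (qr l t) * G l t f * cnj (LINT x|?X. cnj (Ft l t k x) * h k x))" for t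
    proof -
      have "(LINT x|?X. dens f t k x * cnj (h k x)) =
        (LINT x|?X. (\<Sum>l=1..n. (of_real (qr l t) * G l t f) * cnj (cnj (Ft l t k x) * h k x)))"
        unfolding dens_def sum_distrib_right
        by (intro Bochner_Integration.integral_cong sum.cong refl) (simp only: complex_cnj_mult complex_cnj_cnj mult_ac)
      also have "\<dots> = (\<Sum>l=1..n. (LINT x|?X. (of_real (qr l t) * G l t f) * cnj (cnj (Ft l t k x) * h k x)))"
        by (intro Bochner_Integration.integral_sum integrable_mult_right integrable_cnj Ft_times_integrable'[OF h _ k])
      finally show ?thesis
        by (simp only: Bochner_Integration.integral_mult_right_zero Bochner_Integration.integral_cnj)
    qed
    have "(LINT x|?X. of_real pi * (gsol \<alpha> \<beta> f k x * cnj (h k x))) = (LINT x|?X. (LINT t|?T. dens f t k x * cnj (h k x)))"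
      by (rule Bochner_Integration.integral_cong[OF refl]) (simp add: gsol_def)
    also have "\<dots> = (LINT t|?T. (LINT x|?X. dens f t k x * cnj (h k x)))"
      by (rule TX.Fubini_integral) (unfold case_prod_beta, rule int)
    finally show "(LINT x|?X. of_real pi * (gsol \<alpha> \<beta> f k x * cnj (h k x))) =
      (LINT t|?T. (\<Sum>l=1..n. of_real (qr l t) * G l t f * cnj (LINT x|?X. cnj (Ft l t k x) * h k x)))"
      unfolding inner .
    show "integrable ?T (\<lambda>t. \<Sum>l=1..n. of_real (qr l t) * G l t f * cnj (LINT x|?X. cnj (Ft l t k x) * h k x))"
      using TX.integrable_fst'[OF int] by (simp add: inner)
  qed
  have "of_real pi * ip (gsol \<alpha> \<beta> f) h = (\<Sum>k=1..n. (LINT x|?X. of_real pi * (gsol \<alpha> \<beta> f k x * cnj (h k x))))"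
    by (simp add: star_inner_def star_integral_def sum_distrib_left)
  also have "\<dots> = (\<Sum>k=1..n. (LINT t|?T. (\<Sum>l=1..n. of_real (qr l t) * G l t f * cnj (LINT x|?X. cnj (Ft l t k x) * h k x))))"
    by (intro sum.cong refl 1)
  also have "\<dots> = (LINT t|?T. (\<Sum>k=1..n. \<Sum>l=1..n. of_real (qr l t) * G l t f * cnj (LINT x|?X. cnj (Ft l t k x) * h k x)))"
    by (rule Bochner_Integration.integral_sum[OF 2, symmetric])
  also have "\<dots> = (LINT t|?T. Bf f h t)"
  proof (rule Bochner_Integration.integral_cong[OF refl])
    fix t
    show "(\<Sum>k=1..n. \<Sum>l=1..n. of_real (qr l t) * G l t f * cnj (LINT x|?X. cnj (Ft l t k x) * h k x)) = Bf f h t"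
      unfolding Bf_def G_def[of _ t h] star_integral_def cnj_sum sum_distrib_left by (rule sum.swap)
  qed
  finally show ?thesis .
qed

text \<open>Membership of \<open>gsol\<close> in H is not known beforehand, so g enters through its
  continuity and through pairings with functions of bounded support. The radius R0 leaves room to
  enlarge the support of f to that of the test function.\<close>

lemma star_eq_if_cont_tests:
  assumes u: "u \<in> H" and g: "\<And>k. k \<in> {1..n} \<Longrightarrow> continuous_on {0..} (g k)"
    and eq: "\<And>R h. cont_fun R h \<Longrightarrow> R0 \<le> R \<Longrightarrow> ip u h = ip g h"
  shows "star_eq n g u"
  unfolding star_eq_def
proof
  fix k assume k: "k \<in> {1..n}"
  have uk: "u k \<in> L2_half" using u k by (simp add: L2_star_def)
  have "AE x in lebesgue_on {0<..}. g k x - u k x = 0"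
  proof (rule fundamental_lemma)
    fix r s :: real assume rs: "0 < r" "r < s"
    have "set_integrable lebesgue {r..s} (g k)"
      using rs by (intro absolutely_integrable_continuous_real continuous_on_subset[OF g[OF k]]) auto
    moreover have "set_integrable lebesgue {r..s} (u k)"
      using rs by (intro L2_half_locally_integrable[OF uk]) auto
    ultimately show "set_integrable lebesgue {r..s} (\<lambda>x. g k x - u k x)" by (rule set_integral_diff)
  next
    fix \<phi> assume t: "test_fun \<phi>"
    obtain r R' where R': "0 < r" "r < R'" "\<And>x. x \<le> r \<Longrightarrow> \<phi> x = 0" "\<And>x. x \<ge> R' \<Longrightarrow> \<phi> x = 0"
      by (rule test_fun_support[OF t]) blast
    define R where "R = max R0 R'"
    define h where "h j x = (if j = k then complex_of_real (\<phi> x) else 0)" for j :: nat and x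
    have "continuous_on {0..} (h j)" for j
      unfolding h_def by (cases "j = k") (auto intro!: continuous_intros test_fun_continuous[OF t])
    then have h: "cont_fun R h"
      unfolding cont_fun_def using R' by (auto simp: R_def h_def)
    have ip1: "ip v h = (LINT x|lebesgue_on {0<..}. v k x * of_real (\<phi> x))" for v
    proof -
      have "ip v h = (\<Sum>j=1..n. if j = k then (LINT x|lebesgue_on {0<..}. v k x * of_real (\<phi> x)) else 0)"
        unfolding star_inner_def star_integral_def by (intro sum.cong) (auto simp: h_def)
      then show ?thesis using k by simp
    qed
    have gi: "integrable (lebesgue_on {0<..}) (\<lambda>x. g k x * of_real (\<phi> x))"
    proof -
      have "(\<lambda>x. if x \<le> R then g k x else 0) \<in> L2_half"
      proof (rule bounded_support_L2_half)
        have "continuous_on {0..R} (g k)" by (rule continuous_on_subset[OF g[OF k]]) auto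
        then show "continuous_on {0..R} (\<lambda>x. if x \<le> R then g k x else 0)"
          by (rule continuous_on_eq) auto
      qed auto
      from L2_half_mult_integrable[OF this test_fun_L2_half[OF t]]
      show ?thesis
        by (rule Bochner_Integration.integrable_cong[THEN iffD1, rotated 2]) (use R'(4) in \<open>auto simp: R_def\<close>)
    qed
    have "(LINT x|lebesgue_on {0<..}. (g k x - u k x) * of_real (\<phi> x)) =
        (LINT x|lebesgue_on {0<..}. g k x * of_real (\<phi> x) - u k x * of_real (\<phi> x))"
      by (simp only: left_diff_distrib)
    also have "\<dots> = ip g h - ip u h"
      using gi L2_half_mult_integrable[OF uk test_fun_L2_half[OF t]] by (simp add: ip1)
    also have "\<dots> = 0" using eq[OF h] by (simp add: R_def)
    finally show "(LINT x|lebesgue_on {0<..}. (g k x - u k x) * of_real (\<phi> x)) = 0" .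
  qed
  then show "AE x in lebesgue_on {0<..}. g k x = u k x" by simp
qed

lemma E_eq_gsol_cont:
  assumes f: "cont_fun R f" and ab: "\<alpha> < \<beta>"
  shows "star_eq n (gsol \<alpha> \<beta> f) (E {\<alpha><..<\<beta>} f)"
proof (rule star_eq_if_cont_tests)
  show "E {\<alpha><..<\<beta>} f \<in> H" using cont_fun_local[OF f] by (intro E_L2) (auto simp: local_fun_def)
  show "continuous_on {0..} (gsol \<alpha> \<beta> f k)" if "k \<in> {1..n}" for k
    by (rule continuous_on_gsol[OF cont_fun_local[OF f] that])
  fix R' h assume h: "cont_fun R' h" "R \<le> R'"
  have f': "cont_fun R' f" by (rule cont_fun_mono[OF f h(2)])
  have "of_real pi * ip (E {\<alpha><..<\<beta>} f) h = of_real pi * ip (gsol \<alpha> \<beta> f) h"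
    using ip_E_formula[OF f' h(1) ab] gsol_Fubini[OF cont_fun_local[OF f'] cont_fun_local[OF h(1)]] by simp
  then show "ip (E {\<alpha><..<\<beta>} f) h = ip (gsol \<alpha> \<beta> f) h" by simp
qed

text \<open>For merely square-integrable \<open>f\<close> the projection is moved to the continuous test function,
  where it is already known.\<close>

lemma E_eq_gsol:
  assumes f: "local_fun R f" and ab: "\<alpha> < \<beta>"
  shows "star_eq n (gsol \<alpha> \<beta> f) (E {\<alpha><..<\<beta>} f)"
proof (rule star_eq_if_cont_tests)
  have fH: "f \<in> H" using f by (simp add: local_fun_def)
  show "E {\<alpha><..<\<beta>} f \<in> H" using fH by (intro E_L2) auto
  show "continuous_on {0..} (gsol \<alpha> \<beta> f k)" if "k \<in> {1..n}" for k
    by (rule continuous_on_gsol[OF f that])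
  fix R' h assume h: "cont_fun R' h" "R \<le> R'"
  have f': "local_fun R' f" by (rule local_fun_mono[OF f h(2)])
  note hl = cont_fun_local[OF h(1)]
  have hH: "h \<in> H" using hl by (simp add: local_fun_def)
  have "ip (E {\<alpha><..<\<beta>} f) h = ip f (E {\<alpha><..<\<beta>} h)" using fH hH by (intro E_sym) auto
  also have "\<dots> = ip f (gsol \<alpha> \<beta> h)"
    unfolding star_inner_def star_integral_def
  proof (intro sum.cong refl integral_cong_AE)
    fix k assume k: "k \<in> {1..n}"
    have fk: "f k \<in> borel_measurable (lebesgue_on {0<..})"
      using fH k by (auto simp: L2_star_def L2_half_def)
    have "E {\<alpha><..<\<beta>} h k \<in> L2_half" using E_L2[of "{\<alpha><..<\<beta>}", OF _ hH] k by (auto simp: L2_star_def)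
    then show "(\<lambda>x. f k x * cnj (E {\<alpha><..<\<beta>} h k x)) \<in> borel_measurable (lebesgue_on {0<..})"
      using fk L2_half_cnj by (intro borel_measurable_times) (auto simp: L2_half_def)
    show "(\<lambda>x. f k x * cnj (gsol \<alpha> \<beta> h k x)) \<in> borel_measurable (lebesgue_on {0<..})"
      by (intro borel_measurable_times fk borel_measurable_half_line continuous_on_cnj continuous_on_gsol[OF hl k])
    show "AE x in lebesgue_on {0<..}. f k x * cnj (E {\<alpha><..<\<beta>} h k x) = f k x * cnj (gsol \<alpha> \<beta> h k x)"
      using bspec[OF E_eq_gsol_cont[OF h(1) ab, unfolded star_eq_def] k] by eventually_elim simp
  qed
  also have "\<dots> = cnj (ip (gsol \<alpha> \<beta> h) f)" by (rule star_inner_sym)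
  finally have "of_real pi * ip (E {\<alpha><..<\<beta>} f) h = cnj (of_real pi * ip (gsol \<alpha> \<beta> h) f)" by simp
  also have "\<dots> = (LINT t|lebesgue_on {\<alpha><..<\<beta>}. cnj (Bf h f t))"
    by (simp only: gsol_Fubini[OF hl f'] Bochner_Integration.integral_cnj)
  also have "\<dots> = (LINT t|lebesgue_on {\<alpha><..<\<beta>}. Bf f h t)"
    by (rule Bochner_Integration.integral_cong[OF refl]) (simp add: Bf_def mult_ac)
  also have "\<dots> = of_real pi * ip (gsol \<alpha> \<beta> f) h" by (rule gsol_Fubini[OF f' hl, symmetric])
  finally show "ip (E {\<alpha><..<\<beta>} f) h = ip (gsol \<alpha> \<beta> f) h" by simp
qed

end

subsection \<open>Uniqueness of the spectral matrix\<close>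

lemma zero_if_zero_on_rationals:
  fixes g :: "real \<Rightarrow> complex"
  assumes g: "continuous_on {0..} g" and z: "\<And>r. r \<in> \<rat> \<Longrightarrow> r > 0 \<Longrightarrow> g r = 0" and x: "x \<ge> 0"
  shows "g x = 0"
proof (rule ccontr)
  assume "g x \<noteq> 0"
  then have "norm (g x) > 0" by simp
  then obtain d where d: "d > 0" "\<And>y. y \<in> {0..} \<Longrightarrow> dist y x < d \<Longrightarrow> dist (g y) (g x) < norm (g x)"
    using g x unfolding continuous_on_iff by (metis atLeast_iff)
  obtain r where r: "r \<in> \<rat>" "x < r" "r < x + d" using Rats_dense_in_real[of x "x + d"] d(1) by auto
  then have "dist (g r) (g x) < norm (g x)" using x by (intro d(2)) (auto simp: dist_real_def)
  then show False using z[of r] r x by (simp add: dist_norm)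
qed

lemma zero_if_integrals_zero:
  fixes g :: "real \<Rightarrow> complex"
  assumes g: "continuous_on {0..} g" and z: "\<And>s. s > 0 \<Longrightarrow> integral {0..s} g = 0" and x: "x \<ge> 0"
  shows "g x = 0"
proof (rule zero_if_zero_on_rationals[OF g _ x])
  fix r :: real assume r: "r > 0"
  have n: "at r within {0..} = at r" using r by (intro at_within_interior) auto
  have "((\<lambda>u. integral {0..u} g) has_vector_derivative g r) (at r)"
    using integral_has_vector_derivative_half_line[OF g, of r] r n by simp
  moreover have "((\<lambda>u. integral {0..u} g) has_vector_derivative 0) (at r)"
    by (rule has_vector_derivative_transform_within_open[of "\<lambda>_. 0" _ _ "{0<..}"]) (use r z in auto)
  ultimately show "g r = 0" by (rule vector_derivative_unique_at)
qed

lemma zero_if_AE_zero: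
  fixes g :: "real \<Rightarrow> complex"
  assumes g: "continuous_on {0..} g" and z: "AE x in lebesgue_on {0<..}. g x = 0" and x: "x \<ge> 0"
  shows "g x = 0"
proof (rule zero_if_integrals_zero[OF g _ x])
  fix s :: real assume "s > 0"
  have "continuous_on {0..s} g" by (rule continuous_on_subset[OF g]) auto
  then have "continuous_on {0..s} (\<lambda>x. if x \<le> s then g x else 0)" by (rule continuous_on_eq) auto
  then have "(LINT x|lebesgue_on {0<..}. (if x \<le> s then g x else 0)) = integral {0..s} (\<lambda>x. if x \<le> s then g x else 0)"
    by (rule half_line_integral) auto
  moreover have "(LINT x|lebesgue_on {0<..}. (if x \<le> s then g x else 0)) = 0"
    using z by (intro integral_eq_zero_AE) (auto elim!: eventually_mono)
  moreover have "integral {0..s} (\<lambda>x. if x \<le> s then g x else 0) = integral {0..s} g"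
    by (rule Henstock_Kurzweil_Integration.integral_cong) auto
  ultimately show "integral {0..s} g = 0" by simp
qed

text \<open>Otherwise both sinh \<kappa> and, by differentiation at 1, cosh \<kappa> would vanish,
  contradicting cosh^2 - sinh^2 = 1. A rational point is wanted because only countably many points
  can be tested almost everywhere.\<close>

lemma sinhq_nonzero: "\<exists>r\<in>\<rat>. r > 0 \<and> sinhq \<kappa> r \<noteq> 0"
proof (rule ccontr)
  assume "\<not> ?thesis"
  then have nz: "\<And>r. r \<in> \<rat> \<Longrightarrow> r > 0 \<Longrightarrow> sinhq \<kappa> r = 0" by blast
  have cs: "continuous_on {0..} (sinhq \<kappa>)"
    by (rule continuous_on_sinhq[OF continuous_on_const continuous_on_id])
  have z: "sinhq \<kappa> x = 0" if "x \<ge> 0" for x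
    by (rule zero_if_zero_on_rationals[OF cs nz that])
  have "\<kappa> \<noteq> 0" using z[of 1] by (auto simp: sinhq_def)
  then have "sinh \<kappa> = 0" using z[of 1] by (simp add: sinhq_def)
  moreover have "cosh \<kappa> = 0"
  proof -
    have "(sinhq \<kappa> has_vector_derivative cosh \<kappa>) (at 1)"
      using sinhq_has_derivative[of \<kappa> 1 UNIV] by simp
    moreover have "(sinhq \<kappa> has_vector_derivative 0) (at 1)"
      by (rule has_vector_derivative_transform_within_open[of "\<lambda>_. 0" _ _ "{0<..}"]) (use z in auto)
    ultimately show ?thesis by (rule vector_derivative_unique_at)
  qed
  ultimately show False using hyperbolic_pythagoras[of \<kappa>] by simp
qed

lemma AE_zero_if_open_integrals_zero:
  fixes v :: "real \<Rightarrow> complex"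
  assumes v: "\<And>\<alpha> \<beta>. \<alpha> < \<beta> \<Longrightarrow> has_bochner_integral (lebesgue_on {\<alpha><..<\<beta>}) v 0"
  shows "AE t in lebesgue. v t = 0"
proof -
  have "AE t in lebesgue. t \<in> {- real (Suc m)<..<real (Suc m)} \<longrightarrow> v t = 0" for m
  proof -
    let ?I = "{- real (Suc m)<..<real (Suc m)}"
    let ?w = "\<lambda>t. indicator ?I t *\<^sub>R v t"
    have "AE t in lebesgue. ?w t = 0"
    proof (rule AE_zero_if_interval_integrals_zero)
      have "integrable (lebesgue_on ?I) v" using v[of "- real (Suc m)" "real (Suc m)"] by (auto elim: integrable.intros)
      then show "integrable lebesgue ?w" by (simp add: integrable_restrict_space)
      fix r s :: real assume "r < s"
      let ?r = "max r (- real (Suc m))" and ?s = "min s (real (Suc m))"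
      have eq: "(LINT x:{r<..<s}|lebesgue. ?w x) = (LINT x:{?r<..<?s}|lebesgue. v x)"
        unfolding set_lebesgue_integral_def
        by (intro Bochner_Integration.integral_cong refl) (auto simp: indicator_def)
      show "(LINT x:{r<..<s}|lebesgue. ?w x) = 0"
      proof (cases "?r < ?s")
        case True
        have "(LINT x:{?r<..<?s}|lebesgue. v x) = (LINT x|lebesgue_on {?r<..<?s}. v x)"
          by (simp only: set_lebesgue_integral_def) (subst integral_restrict_space, auto)
        then show ?thesis unfolding eq using has_bochner_integral_integral_eq[OF v[OF True]] by simp
      next
        case False
        then have "{?r<..<?s} = {}" by (simp only: greaterThanLessThan_empty_iff not_less)
        then show ?thesis unfolding eq by (simp only: set_lebesgue_integral_def) simp
      qed
    qed
    then show ?thesis by (auto elim!: eventually_mono simp: indicator_def)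
  qed
  then have "AE t in lebesgue. \<forall>m. t \<in> {- real (Suc m)<..<real (Suc m)} \<longrightarrow> v t = 0"
    unfolding AE_all_countable by blast
  then show ?thesis
  proof (rule eventually_mono)
    fix t assume *: "\<forall>m. t \<in> {- real (Suc m)<..<real (Suc m)} \<longrightarrow> v t = 0"
    obtain m where "\<bar>t\<bar> < real m" using reals_Archimedean2 by blast
    then have "t \<in> {- real (Suc m)<..<real (Suc m)}" by auto
    then show "v t = 0" using * by blast
  qed
qed

text \<open>The two continuous representatives agree almost everywhere, hence at every point; this
  turns the comparison of two integrands at a fixed x into vanishing integrals.\<close>

lemma pointwise_integral_diff:
  assumes 1: "pointwise_integral n u \<alpha> \<beta> \<Phi>" and 2: "pointwise_integral n u \<alpha> \<beta> \<Phi>'"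
    and k: "k \<in> {1..n}" and x: "x \<ge> 0"
  shows "has_bochner_integral (lebesgue_on {\<alpha><..<\<beta>}) (\<lambda>t. \<Phi> t k x - \<Phi>' t k x) 0"
proof -
  obtain g where g: "T0 n g" "star_eq n g u"
    "\<And>k x. k \<in> {1..n} \<Longrightarrow> x \<ge> 0 \<Longrightarrow> has_bochner_integral (lebesgue_on {\<alpha><..<\<beta>}) (\<lambda>t. \<Phi> t k x) (g k x)"
    using 1 unfolding pointwise_integral_def by auto
  obtain g' where g': "T0 n g'" "star_eq n g' u"
    "\<And>k x. k \<in> {1..n} \<Longrightarrow> x \<ge> 0 \<Longrightarrow> has_bochner_integral (lebesgue_on {\<alpha><..<\<beta>}) (\<lambda>t. \<Phi>' t k x) (g' k x)"
    using 2 unfolding pointwise_integral_def by auto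
  have "continuous_on {0..} (\<lambda>x. g k x - g' k x)"
    using g(1) g'(1) k unfolding T0_def by (intro continuous_intros) auto
  moreover have "AE x in lebesgue_on {0<..}. g k x - g' k x = 0"
    using bspec[OF g(2)[unfolded star_eq_def] k] bspec[OF g'(2)[unfolded star_eq_def] k] by eventually_elim simp
  ultimately have "g k x - g' k x = 0" using x by (rule zero_if_AE_zero)
  then show ?thesis using has_bochner_integral_diff[OF g(3)[OF k x] g'(3)[OF k x]] by simp
qed

context star_network
begin

text \<open>Changes f on a null set so that it vanishes everywhere beyond the compact set, as the
  estimates for the transforms require.\<close>

lemma local_representative:
  assumes f: "f \<in> H" and B: "compact_star n B" and v: "vanishes_outside n f B"
  obtains R f' where "local_fun R f'" "star_eq n f f'"
proof -
  have "bounded (\<Union>k\<in>{1..n}. B k)"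
    using B by (intro bounded_UN) (auto simp: compact_star_def compact_imp_bounded)
  then obtain R where "\<forall>x\<in>(\<Union>k\<in>{1..n}. B k). norm x \<le> R" unfolding bounded_iff by blast
  then have R: "\<And>k x. k \<in> {1..n} \<Longrightarrow> x \<in> B k \<Longrightarrow> \<bar>x\<bar> \<le> R" by auto
  define f' where "f' k x = (if x \<le> R then f k x else 0)" for k x
  have "f' k \<in> L2_half" if k: "k \<in> {1..n}" for k
  proof -
    have fk: "f k \<in> L2_half" using f k by (simp add: L2_star_def)
    have "(\<lambda>x. if x \<le> R then 1 else (0::complex)) \<in> borel_measurable borel" by measurable
    from borel_measurable_times[OF measurable_compose[OF id_measurable_lebesgue_on this] L2_halfD(1)[OF fk]]
    have "(\<lambda>x. (if x \<le> R then 1 else 0) * f k x) \<in> borel_measurable (lebesgue_on {0<..})" .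
    moreover have "(\<lambda>x. (if x \<le> R then 1 else 0) * f k x) = f' k" by (auto simp: f'_def fun_eq_iff)
    ultimately have m: "f' k \<in> borel_measurable (lebesgue_on {0<..})" by simp
    have "integrable (lebesgue_on {0<..}) (\<lambda>x. (cmod (f' k x))\<^sup>2)"
    proof (rule Bochner_Integration.integrable_bound[OF L2_halfD(2)[OF fk]])
      show "(\<lambda>x. (cmod (f' k x))\<^sup>2) \<in> borel_measurable (lebesgue_on {0<..})" using m by measurable
    qed (auto simp: f'_def)
    then show ?thesis using m by (simp add: L2_half_def)
  qed
  then have "local_fun R f'" by (auto simp: local_fun_def L2_star_def f'_def)
  moreover have "star_eq n f f'"
    unfolding star_eq_def
  proof
    fix k assume k: "k \<in> {1..n}"
    show "AE x in lebesgue_on {0<..}. f k x = f' k x"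
      using bspec[OF v[unfolded vanishes_outside_def] k]
      by (rule eventually_mono) (use R[OF k] in \<open>force simp: f'_def\<close>)
  qed
  ultimately show thesis by (rule that)
qed

lemma star_integral_F_minus:
  assumes f: "f \<in> H" and f': "f' \<in> H" "star_eq n f f'" and m: "m \<in> {1..n}" "t \<noteq> a m"
  shows "star_integral n (\<lambda>j y. cnj (F_minus n c a m (of_real t) j y) * f j y) = G m t f'"
  unfolding G_def star_integral_def F_minus_eq[OF m]
proof (intro sum.cong refl integral_cong_AE)
  fix k assume k: "k \<in> {1..n}"
  have F: "(\<lambda>y. cnj (Ft m t k y)) \<in> borel_measurable (lebesgue_on {0<..})"
    by (rule borel_measurable_half_line[OF continuous_on_cnj[OF continuous_on_Ft[OF m(1) k continuous_on_const continuous_on_id]]])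
  have fm: "f k \<in> borel_measurable (lebesgue_on {0<..})" "f' k \<in> borel_measurable (lebesgue_on {0<..})"
    using f f' k by (auto simp: L2_star_def L2_half_def)
  show "(\<lambda>y. cnj (Ft m t k y) * f k y) \<in> borel_measurable (lebesgue_on {0<..})"
    "(\<lambda>y. cnj (Ft m t k y) * f' k y) \<in> borel_measurable (lebesgue_on {0<..})"
    by (intro borel_measurable_times F fm)+
  show "AE y in lebesgue_on {0<..}. cnj (Ft m t k y) * f k y = cnj (Ft m t k y) * f' k y"
    using bspec[OF f'(2)[unfolded star_eq_def] k] by eventually_elim simp
qed

theorem spectral_representation:
  assumes f: "f \<in> H" and B: "compact_star n B" and v: "vanishes_outside n f B" and ab: "\<alpha> < \<beta>"
  shows "pointwise_integral n (E {\<alpha><..<\<beta>} f) \<alpha> \<beta> (\<lambda>t k x.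
    of_real (1 / pi) * (\<Sum>l=1..n. q_coeff n c a l t * F_minus n c a l (of_real t) k x *
      star_integral n (\<lambda>j y. cnj (F_minus n c a l (of_real t) j y) * f j y)))"
proof -
  obtain R f' where f': "local_fun R f'" "star_eq n f f'" by (rule local_representative[OF f B v])
  have f'H: "f' \<in> H" using f'(1) by (simp add: local_fun_def)
  have eq: "(\<Sum>l=1..n. q_coeff n c a l t * F_minus n c a l (of_real t) k x *
      star_integral n (\<lambda>j y. cnj (F_minus n c a l (of_real t) j y) * f j y)) = dens f' t k x" for t k x
    unfolding dens_def
  proof (rule sum.cong[OF refl])
    fix l assume l: "l \<in> {1..n}"
    show "q_coeff n c a l t * F_minus n c a l (of_real t) k x *
      star_integral n (\<lambda>j y. cnj (F_minus n c a l (of_real t) j y) * f j y) = of_real (qr l t) * Ft l t k x * G l t f'"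
    proof (cases "t = a l")
      \<comment> \<open>At its own threshold q_l is 0 and removes the meaningless value of
        \<open>F_minus\<close>.\<close>
      case True
      then show ?thesis using qr_at_threshold[OF l] by (simp add: q_coeff_eq[OF l])
    next
      case False
      then show ?thesis by (simp only: q_coeff_eq[OF l] F_minus_eq[OF l False] star_integral_F_minus[OF f f'H f'(2) l False, unfolded F_minus_eq[OF l False]])
    qed
  qed
  show ?thesis
    unfolding pointwise_integral_def eq
  proof (intro exI[of _ "gsol \<alpha> \<beta> f'"] conjI ballI allI impI)
    \<comment> \<open>Agreement at the vertex holds because every \<open>Ft\<close> has the value 1
      there on all branches.\<close>
    show "T0 n (gsol \<alpha> \<beta> f')"
      unfolding T0_def using continuous_on_gsol[OF f'(1)] by (auto simp: gsol_def dens_def)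
    have "star_eq n (E {\<alpha><..<\<beta>} f') (E {\<alpha><..<\<beta>} f)"
      using f f'H f'(2) by (intro E_cong star_eq_sym[OF f'(2)]) auto
    then show "star_eq n (gsol \<alpha> \<beta> f') (E {\<alpha><..<\<beta>} f)"
      by (rule star_eq_trans[OF E_eq_gsol[OF f'(1) ab]])
    fix k x assume k: "k \<in> {1..n}" and x: "0 \<le> (x::real)"
    show "has_bochner_integral (lebesgue_on {\<alpha><..<\<beta>}) (\<lambda>t. of_real (1 / pi) * dens f' t k x) (gsol \<alpha> \<beta> f' k x)"
      unfolding gsol_def using dens_integrable[OF f'(1) k x]
      by (intro has_bochner_integral_integrable integrable_mult_right)
  qed
qed

section \<open>Linear independence of the generalized eigenfunctions and step functions as test
  data\<close>

lemma sum_diag: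
  fixes q :: "nat \<Rightarrow> complex"
  shows "(\<Sum>l=1..n. \<Sum>m=1..n. (if l = m then q l else 0) * X l * Y m) = (\<Sum>l=1..n. q l * X l * Y l)"
proof (rule sum.cong[OF refl])
  fix l assume l: "l \<in> {1..n}"
  have "(\<Sum>m=1..n. (if l = m then q l else 0) * X l * Y m) = (\<Sum>m=1..n. if m = l then q l * X l * Y l else 0)"
    by (rule sum.cong[OF refl]) simp
  then show "(\<Sum>m=1..n. (if l = m then q l else 0) * X l * Y m) = q l * X l * Y l" using l by simp
qed

text \<open>At the vertex all functions equal 1, so the coefficients sum to 0 and the common
  exponential drops out on every branch. What remains on branch k is d_k times a nonzero multiple of
  the Dirichlet solution.\<close>

lemma Ft_independent:
  assumes d: "\<And>k x. k \<in> {1..n} \<Longrightarrow> x \<in> \<rat> \<Longrightarrow> x \<ge> 0 \<Longrightarrow> (\<Sum>l=1..n. d l * Ft l t k x) = 0"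
    and W0: "W (of_real t) \<noteq> 0" and k: "k \<in> {1..n}"
  shows "d k = 0"
proof -
  have s0: "(\<Sum>l=1..n. d l) = 0" using d[OF k, of 0] by simp
  obtain r where r: "r \<in> \<rat>" "r > 0" "sinhq (\<kappa> k (of_real t)) r \<noteq> 0" using sinhq_nonzero by blast
  have "0 = (\<Sum>l=1..n. d l * Ft l t k r)" using d[OF k r(1)] r(2) by simp
  also have "\<dots> = (\<Sum>l=1..n. d l * expm (\<kappa> k (of_real t)) r +
      (if l = k then d k * (W (of_real t) / of_real (c k) * sinhq (\<kappa> k (of_real t)) r) else 0))"
    by (rule sum.cong[OF refl]) (auto simp: Ft_def distrib_left)
  also have "\<dots> = (\<Sum>l=1..n. d l) * expm (\<kappa> k (of_real t)) r +
      d k * (W (of_real t) / of_real (c k) * sinhq (\<kappa> k (of_real t)) r)"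
    using k by (simp add: sum.distrib sum_distrib_right)
  finally have "d k * (W (of_real t) / of_real (c k) * sinhq (\<kappa> k (of_real t)) r) = 0" using s0 by simp
  then show ?thesis using W0 r(3) c_pos[OF k] by simp
qed

text \<open>Indicator of [0, s] on branch j. Its transforms are integrals of conjugated
  eigenfunctions over [0, s]; differentiation in s recovers the eigenfunctions pointwise.\<close>

definition step_fun :: "nat \<Rightarrow> real \<Rightarrow> star_fun" where
  "step_fun j s = (\<lambda>k x. if k = j \<and> x \<le> s then 1 else 0)"

lemma step_fun:
  assumes "s > 0"
  shows "step_fun j s \<in> H" "compact_star n (\<lambda>_. {0..s})" "vanishes_outside n (step_fun j s) (\<lambda>_. {0..s})"
proof -
  have "step_fun j s k \<in> L2_half" for k
  proof (rule bounded_support_L2_half)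
    show "continuous_on {0..s} (step_fun j s k)"
      by (rule continuous_on_eq[OF continuous_on_const[of _ "if k = j then 1 else 0"]]) (auto simp: step_fun_def)
  qed (auto simp: step_fun_def)
  then show "step_fun j s \<in> H" by (simp add: L2_star_def)
  show "compact_star n (\<lambda>_. {0..s})" using assms by (auto simp: compact_star_def)
  show "vanishes_outside n (step_fun j s) (\<lambda>_. {0..s})"
    unfolding vanishes_outside_def by (intro ballI AE_I2) (auto simp: step_fun_def)
qed

lemma G_step_fun:
  assumes j: "j \<in> {1..n}" and m: "m \<in> {1..n}"
  shows "G m t (step_fun j s) = integral {0..s} (\<lambda>y. cnj (Ft m t j y))"
proof -
  have "(LINT y|lebesgue_on {0<..}. cnj (Ft m t k y) * step_fun j s k y) =
      (if k = j then integral {0..s} (\<lambda>y. cnj (Ft m t j y)) else 0)" if k: "k \<in> {1..n}" for k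
  proof (cases "k = j")
    case True
    have "continuous_on {0..s} (\<lambda>y. cnj (Ft m t k y))"
      using continuous_on_Ft[OF m k continuous_on_const continuous_on_id] by (intro continuous_on_cnj)
    then have "continuous_on {0..s} (\<lambda>y. cnj (Ft m t k y) * step_fun j s k y)"
      by (rule continuous_on_eq) (use True in \<open>auto simp: step_fun_def\<close>)
    then have "(LINT y|lebesgue_on {0<..}. cnj (Ft m t k y) * step_fun j s k y) =
        integral {0..s} (\<lambda>y. cnj (Ft m t k y) * step_fun j s k y)"
      by (rule half_line_integral) (auto simp: step_fun_def)
    also have "\<dots> = integral {0..s} (\<lambda>y. cnj (Ft m t j y))"
      using True by (intro Henstock_Kurzweil_Integration.integral_cong) (auto simp: step_fun_def)
    finally show ?thesis using True by simp
  qed (simp add: step_fun_def)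
  then show ?thesis using j by (simp add: G_def star_integral_def)
qed

text \<open>Independence is used twice: first in the second index, after conjugating because the
  coefficients G contain conjugated eigenfunctions, and then in the first index.\<close>

lemma matrix_zero:
  assumes z: "\<And>k j x s. k \<in> {1..n} \<Longrightarrow> j \<in> {1..n} \<Longrightarrow> x \<in> \<rat> \<Longrightarrow> x \<ge> 0 \<Longrightarrow> s \<in> \<rat> \<Longrightarrow> s > 0 \<Longrightarrow>
      (\<Sum>l=1..n. \<Sum>m=1..n. M l m * Ft l t k x * G m t (step_fun j s)) = 0"
    and W0: "W (of_real t) \<noteq> 0" and l: "l \<in> {1..n}" and m: "m \<in> {1..n}"
  shows "M l m = 0"
proof -
  have "(\<Sum>l=1..n. M l m * Ft l t k x) = 0" if k: "k \<in> {1..n}" and x: "x \<in> \<rat>" "x \<ge> 0" and m: "m \<in> {1..n}" for k x m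
  proof -
    define e where "e m = (\<Sum>l=1..n. M l m * Ft l t k x)" for m
    have "(\<Sum>m=1..n. cnj (e m) * Ft m t j y) = 0" if j: "j \<in> {1..n}" and y: "y \<in> \<rat>" "y \<ge> 0" for j y
    proof -
      define \<psi> where "\<psi> y = (\<Sum>m=1..n. e m * cnj (Ft m t j y))" for y
      have cF: "continuous_on S (\<lambda>y. cnj (Ft m t j y))" if "m \<in> {1..n}" for m S
        using continuous_on_Ft[OF that j continuous_on_const continuous_on_id] by (intro continuous_on_cnj)
      have c\<psi>: "continuous_on S \<psi>" for S
        unfolding \<psi>_def by (intro continuous_on_sum continuous_on_mult continuous_on_const cF)
      have rz: "integral {0..s} \<psi> = 0" if s: "s \<in> \<rat>" "s > 0" for s
      proof -
        have "integral {0..s} \<psi> = (\<Sum>m=1..n. e m * integral {0..s} (\<lambda>y. cnj (Ft m t j y)))"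
          unfolding \<psi>_def
          by (subst integral_sum)
            (auto intro!: integrable_continuous_real continuous_on_mult continuous_on_const cF)
        also have "\<dots> = (\<Sum>m=1..n. e m * G m t (step_fun j s))" using G_step_fun[OF j] by simp
        also have "\<dots> = (\<Sum>l=1..n. \<Sum>m=1..n. M l m * Ft l t k x * G m t (step_fun j s))"
          unfolding e_def sum_distrib_right by (rule sum.swap)
        also have "\<dots> = 0" by (rule z[OF k j x s])
        finally show ?thesis .
      qed
      \<comment> \<open>The integral is continuous in s, so its vanishing at positive rational s
        extends to all s > 0.\<close>
      have ci: "continuous_on {0..} (\<lambda>s. integral {0..s} \<psi>)"
        by (rule continuous_on_vector_derivative) (rule integral_has_vector_derivative_half_line[OF c\<psi>], simp)
      have "integral {0..s} \<psi> = 0" if "s > 0" for s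
        by (rule zero_if_zero_on_rationals[OF ci rz]) (use that in auto)
      then have "\<psi> y = 0" by (rule zero_if_integrals_zero[OF c\<psi> _ y(2)])
      then have "cnj (\<psi> y) = 0" by simp
      then show ?thesis by (simp add: \<psi>_def)
    qed
    then have "cnj (e m) = 0" using W0 m by (rule Ft_independent)
    then show ?thesis by (simp only: e_def complex_cnj_zero_iff)
  qed
  then show ?thesis using W0 l m by (intro Ft_independent[of "\<lambda>l. M l m" t l]) auto
qed

theorem spectral_matrix_unique:
  assumes P: "represents_resolution n c a E P" and Q: "represents_resolution n c a E Q"
  shows "AE t in lebesgue. \<forall>l\<in>{1..n}. \<forall>m\<in>{1..n}. P t l m = Q t l m"
proof -
  let ?\<Phi> = "\<lambda>Q f t k x. complex_of_real (1 / pi) * (\<Sum>l=1..n. \<Sum>m=1..n. Q t l m * F_minus n c a l (of_real t) k x *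
      star_integral n (\<lambda>j y. cnj (F_minus n c a m (of_real t) j y) * f j y))"
  \<comment> \<open>Each test gives an identity off its own null set; with rational x and s there
    are only countably many tests, so one null set serves all of them.\<close>
  define I where "I = {1..n} \<times> {1..n} \<times> (\<rat> \<inter> {0::real..}) \<times> (\<rat> \<inter> {0::real<..})"
  have "AE t in lebesgue. ?\<Phi> P (step_fun j s) t k x - ?\<Phi> Q (step_fun j s) t k x = 0"
    if k: "k \<in> {1..n}" and x: "x \<ge> 0" and s: "s > 0" for k j x s
  proof (rule AE_zero_if_open_integrals_zero)
    fix \<alpha> \<beta> :: real assume ab: "\<alpha> < \<beta>"
    show "has_bochner_integral (lebesgue_on {\<alpha><..<\<beta>}) (\<lambda>t. ?\<Phi> P (step_fun j s) t k x - ?\<Phi> Q (step_fun j s) t k x) 0"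
      by (rule pointwise_integral_diff[OF P[unfolded represents_resolution_def, rule_format, OF step_fun[OF s] ab]
          Q[unfolded represents_resolution_def, rule_format, OF step_fun[OF s] ab] k x])
  qed
  then have "\<forall>i\<in>I. AE t in lebesgue. ?\<Phi> P (step_fun (fst (snd i)) (snd (snd (snd i)))) t (fst i) (fst (snd (snd i)))
      - ?\<Phi> Q (step_fun (fst (snd i)) (snd (snd (snd i)))) t (fst i) (fst (snd (snd i))) = 0"
    by (auto simp: I_def)
  moreover have "countable I" unfolding I_def by (intro countable_SIGMA countable_Int1 countable_rat) auto
  ultimately have A: "AE t in lebesgue. \<forall>i\<in>I. ?\<Phi> P (step_fun (fst (snd i)) (snd (snd (snd i)))) t (fst i) (fst (snd (snd i)))
      - ?\<Phi> Q (step_fun (fst (snd i)) (snd (snd (snd i)))) t (fst i) (fst (snd (snd i))) = 0"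
    by (subst AE_ball_countable) auto
  \<comment> \<open>The thresholds are discarded: away from them \<open>F_minus\<close> equals
    \<open>Ft\<close> and W does not vanish.\<close>
  have "finite (a ` {1..n})" by simp
  then have "a ` {1..n} \<in> null_sets lebesgue" by (metis negligible_finite negligible_iff_null_sets)
  then have "AE t in lebesgue. t \<notin> a ` {1..n}" by (rule AE_not_in)
  with A show ?thesis
  proof eventually_elim
    fix t assume z: "\<forall>i\<in>I. ?\<Phi> P (step_fun (fst (snd i)) (snd (snd (snd i)))) t (fst i) (fst (snd (snd i)))
      - ?\<Phi> Q (step_fun (fst (snd i)) (snd (snd (snd i)))) t (fst i) (fst (snd (snd i))) = 0"
      and t: "t \<notin> a ` {1..n}"
    have ta: "t \<noteq> a l" if "l \<in> {1..n}" for l using t that by auto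
    have W0: "W (of_real t) \<noteq> 0" using ta[of 1] n_pos by (intro W_nonzero[of _ 1]) auto
    have s\<Phi>: "?\<Phi> Q (step_fun j s) t k x = of_real (1 / pi) * (\<Sum>l=1..n. \<Sum>m=1..n. Q t l m * Ft l t k x * G m t (step_fun j s))"
      if "s > 0" for Q j s k x
    proof -
      have "Q t l m * F_minus n c a l (of_real t) k x * star_integral n (\<lambda>ja y. cnj (F_minus n c a m (of_real t) ja y) * step_fun j s ja y)
        = Q t l m * Ft l t k x * G m t (step_fun j s)" if l: "l \<in> {1..n}" and m: "m \<in> {1..n}" for l m
        using star_integral_F_minus[OF step_fun(1)[OF \<open>s > 0\<close>] step_fun(1)[OF \<open>s > 0\<close>] star_eq_refl m ta[OF m], of j]
          F_minus_eq[OF l ta[OF l]] by simp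
      then show ?thesis by (intro arg_cong[where f="\<lambda>z. of_real (1 / pi) * z"] sum.cong refl)
    qed
    show "\<forall>l\<in>{1..n}. \<forall>m\<in>{1..n}. P t l m = Q t l m"
    proof (intro ballI)
      fix l m assume lm: "l \<in> {1..n}" "m \<in> {1..n}"
      have "P t l m - Q t l m = 0"
      proof (rule matrix_zero[OF _ W0 lm])
        fix k j :: nat and x s :: real assume *: "k \<in> {1..n}" "j \<in> {1..n}" "x \<in> \<rat>" "x \<ge> 0" "s \<in> \<rat>" "s > 0"
        have "(k, j, x, s) \<in> I" using * by (auto simp: I_def)
        from bspec[OF z this] have "?\<Phi> P (step_fun j s) t k x - ?\<Phi> Q (step_fun j s) t k x = 0" by simp
        then have "(\<Sum>l=1..n. \<Sum>m=1..n. P t l m * Ft l t k x * G m t (step_fun j s)) -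
            (\<Sum>l=1..n. \<Sum>m=1..n. Q t l m * Ft l t k x * G m t (step_fun j s)) = 0"
          unfolding s\<Phi>[OF *(6)] by simp
        then show "(\<Sum>l=1..n. \<Sum>m=1..n. (P t l m - Q t l m) * Ft l t k x * G m t (step_fun j s)) = 0"
          by (simp add: left_diff_distrib sum_subtractf)
      qed
      then show "P t l m = Q t l m" by simp
    qed
  qed
qed

end

theorem theorem5p3:
  fixes n :: nat and c a :: "nat \<Rightarrow> real"
    and E :: "real set \<Rightarrow> star_fun \<Rightarrow> star_fun"
    and q :: "real \<Rightarrow> nat \<Rightarrow> nat \<Rightarrow> complex"
  assumes "n \<ge> 2"
    and "\<And>k. k \<in> {1..n} \<Longrightarrow> 0 < c k"
    and "0 \<le> a 1"
    and "mono_on {1..n} a"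
    and "resolution_of_identity n (star_domain n c) (star_op n c a) E"
    and "q = (\<lambda>t l m. if l = m then q_coeff n c a l t else 0)"
  shows "(\<forall>f B \<alpha> \<beta>. f \<in> L2_star n \<longrightarrow> compact_star n B \<longrightarrow> vanishes_outside n f B \<longrightarrow> \<alpha> < \<beta> \<longrightarrow>
            pointwise_integral n (E {\<alpha><..<\<beta>} f) \<alpha> \<beta> (\<lambda>t k x.
              of_real (1 / pi) * (\<Sum>l=1..n. q_coeff n c a l t * F_minus n c a l (of_real t) k x *
                star_integral n (\<lambda>j y. cnj (F_minus n c a l (of_real t) j y) * f j y)))) \<and>
         represents_resolution n c a E q \<and>
         (\<forall>Q. represents_resolution n c a E Q \<longrightarrow>
            (AE t in lebesgue. \<forall>l\<in>{1..n}. \<forall>m\<in>{1..n}. Q t l m = q t l m))"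
proof -
  interpret star_network n c a E
    using assms(1,2,5) by unfold_locales auto
  have q: "represents_resolution n c a E q"
    unfolding represents_resolution_def assms(6) sum_diag using spectral_representation by blast
  show ?thesis
    using spectral_representation q spectral_matrix_unique[OF _ q] by blast
qed

end
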